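(* Let $K$ be a field, $S=K[x_1,\ldots,x_n]$, $\mathfrak m=(x_1,\ldots,x_n)$, $s\ge 3$, and let $I=\bigcap_{i=1}^s P_i$ be a reduced (i.e. irredundant) intersection of monomial prime ideals of $S$ with $\sum_{i=1}^s P_i=\mathfrak m$. Assume that the big size of $I$ is two and that $P_1+P_2=(x_1,\ldots,x_r)$ for some $r<n$. Set $$q=\min\{\dim S/(P_i+P_j):\ i\ne j,\ P_i+P_j\ne\mathfrak m\}.$$ If $P_k+P_e=\mathfrak m$ for all distinct $k,e>2$, then the following statements hold: \begin{enumerate} \item $\operatorname{depth}_S S/I\in\{1,2,1+q\}$. \item $\operatorname{depth}_S S/I=1$ if and only if there exists $j>2$ such that $P_1+P_j=\mathfrak m=P_2+P_j$. \item $\operatorname{depth}_S S/I>2$ if and only if $q>1$ and each $j>2$ satisfies either $P_1+P_j\neq\mathfrak m=P_2+P_j$, or $P_2+P_j\ne\mathfrak m=P_1+P_j$. \item $\operatorname{depth}_S S/I=2$ if and only if both of the following conditions hold: (a) each $j>2$ satisfies either $P_1+P_j\ne\mathfrak m$ or $P_2+P_j\neq\mathfrak m$; (b) $q=1$ or there exists an index $k>2$ such that $P_1+P_k\ne\mathfrak m\ne P_2+P_k$. \end{enumerate}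
   Context: A monomial prime ideal of $S$ is an ideal generated by a subset of the variables; an intersection $\bigcap_i P_i$ is reduced (irredundant) if no $P_i$ can be omitted without changing it. Indices $i,j,k,e$ range over $\{1,\ldots,s\}$. Big size: for $I=\bigcap_{i=1}^s P_i$ as in the claim, with $\sum_{i=1}^sP_i=\mathfrak m$, the big size $t(I)$ is the minimal number $t<s$ such that the sum of any $t+1$ (distinct) prime ideals among $P_1,\ldots,P_s$ equals $\mathfrak m$. $\dim$ is Krull dimension and $\operatorname{depth}_S$ is depth with respect to $\mathfrak m$. *)

theory Defs
  imports
    "HOL-Algebra.Algebra"
    "HOL-Library.Poly_Mapping"
    "HOL-Library.Extended_Nat"
begin

text \<open>
  The polynomial ring in \<open>x\<^sub>1, \<dots>, x\<^sub>n\<close>, cut out of the ring of polynomials in countably many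
  variables: a monomial is its exponent vector of type \<open>nat \<Rightarrow>\<^sub>0 nat\<close>, and only exponent vectors
  supported on \<open>{1..n}\<close> may occur.
\<close>

definition mpoly_ring :: "nat \<Rightarrow> ((nat \<Rightarrow>\<^sub>0 nat) \<Rightarrow>\<^sub>0 'k::field) ring" where
  "mpoly_ring n =
     \<lparr>carrier = {f. \<forall>m \<in> Poly_Mapping.keys f. Poly_Mapping.keys m \<subseteq> {1..n}},
      monoid.mult = (*), monoid.one = 1, ring.zero = 0, ring.add = (+)\<rparr>"

definition var :: "nat \<Rightarrow> (nat \<Rightarrow>\<^sub>0 nat) \<Rightarrow>\<^sub>0 'k::field" where
  "var i = Poly_Mapping.single (Poly_Mapping.single i 1) 1"

definition var_ideal :: "nat \<Rightarrow> nat set \<Rightarrow> ((nat \<Rightarrow>\<^sub>0 nat) \<Rightarrow>\<^sub>0 'k::field) set" where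
  "var_ideal n A = Idl\<^bsub>mpoly_ring n\<^esub> (var ` A)"

text \<open>The empty set of variables is allowed; it generates the zero ideal.\<close>

definition monomial_prime :: "nat \<Rightarrow> ((nat \<Rightarrow>\<^sub>0 nat) \<Rightarrow>\<^sub>0 'k::field) set \<Rightarrow> bool" where
  "monomial_prime n Q \<longleftrightarrow> (\<exists>A \<subseteq> {1..n}. Q = var_ideal n A)"

definition ideal_sum :: "('a, 'b) ring_scheme \<Rightarrow> ('i \<Rightarrow> 'a set) \<Rightarrow> 'i set \<Rightarrow> 'a set" where
  "ideal_sum R P T = {finsum R f T |f. \<forall>i \<in> T. f i \<in> P i}"

text \<open>
  The big size refers to distinct primes among \<open>P\<^sub>1, \<dots>, P\<^sub>s\<close>; the definition chooses distinct
  indices, which is the same whenever the \<open>P\<^sub>i\<close> are pairwise distinct, as in an irredundant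
  intersection.
\<close>

definition big_size :: "('a, 'b) ring_scheme \<Rightarrow> 'a set \<Rightarrow> (nat \<Rightarrow> 'a set) \<Rightarrow> nat \<Rightarrow> nat" where
  "big_size R \<mm> P s =
     (LEAST t. t < s \<and> (\<forall>T \<subseteq> {1..s}. card T = t + 1 \<longrightarrow> ideal_sum R P T = \<mm>))"

text \<open>The zero ring gets dimension 0 here, since \<open>Sup {} = 0\<close> in \<^typ>\<open>enat\<close>.\<close>

definition krull_dim :: "('a, 'b) ring_scheme \<Rightarrow> enat" where
  "krull_dim R = Sup {enat l |l. \<exists>p. (\<forall>i \<le> l. primeideal (p i) R) \<and> (\<forall>i < l. p i \<subset> p (Suc i))}"

text \<open>The ring \<open>R/I\<close> as a module over \<open>R\<close>.\<close>

definition quot_module :: "('a, 'b) ring_scheme \<Rightarrow> 'a set \<Rightarrow> ('a, 'a set) module" where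
  "quot_module R I =
     \<lparr>carrier = carrier (R Quot I),
      monoid.mult = monoid.mult (R Quot I), monoid.one = monoid.one (R Quot I),
      ring.zero = ring.zero (R Quot I), ring.add = ring.add (R Quot I),
      smult = (\<lambda>a c. (I +>\<^bsub>R\<^esub> a) \<otimes>\<^bsub>R Quot I\<^esub> c)\<rparr>"

text \<open>The submodule \<open>(a\<^sub>1, \<dots>, a\<^sub>k)M\<close> of \<open>M\<close>.\<close>

definition seq_submodule :: "'a list \<Rightarrow> ('a, 'c, 'd) module_scheme \<Rightarrow> 'c set" where
  "seq_submodule as M =
     {finsum M (\<lambda>i. (as ! i) \<odot>\<^bsub>M\<^esub> f i) {..<length as} |f. \<forall>i < length as. f i \<in> carrier M}"

text \<open>
  The second condition says that \<open>a\<^sub>i\<close> is a nonzerodivisor on \<open>M/(a\<^sub>1, \<dots>, a\<^bsub>i-1\<^esub>)M\<close>, the third that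
  \<open>M/(a\<^sub>1, \<dots>, a\<^sub>k)M\<close> is nonzero.
\<close>

definition regular_sequence ::
    "('a, 'b) ring_scheme \<Rightarrow> ('a, 'c, 'd) module_scheme \<Rightarrow> 'a list \<Rightarrow> bool" where
  "regular_sequence R M as \<longleftrightarrow>
     set as \<subseteq> carrier R \<and>
     (\<forall>i < length as. \<forall>x \<in> carrier M.
        (as ! i) \<odot>\<^bsub>M\<^esub> x \<in> seq_submodule (take i as) M \<longrightarrow> x \<in> seq_submodule (take i as) M) \<and>
     seq_submodule as M \<noteq> carrier M"

definition depth ::
    "('a, 'b) ring_scheme \<Rightarrow> 'a set \<Rightarrow> ('a, 'c, 'd) module_scheme \<Rightarrow> enat" where
  "depth R J M = Sup {enat (length as) |as. set as \<subseteq> J \<and> regular_sequence R M as}"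

end

theory Submission
  imports Defs
begin

text \<open>
  Write \<open>P\<^sub>i\<close> as the prime generated by the variables with index in \<open>A\<^sub>i\<close>, and let \<open>F\<^sub>i = {1..n} - A\<^sub>i\<close>. Then
  \<open>I\<close> is spanned by the monomials whose support lies in no \<open>F\<^sub>i\<close>: it is the Stanley-Reisner ideal of the
  simplicial complex with facets \<open>F\<^sub>1, \<dots>, F\<^sub>s\<close>. In these terms \<open>P\<^sub>i + P\<^sub>j = \<mm>\<close> says that \<open>F\<^sub>i\<close> and \<open>F\<^sub>j\<close>
  are disjoint, and \<open>S/(P\<^sub>i + P\<^sub>j)\<close> has dimension \<open>|F\<^sub>i \<inter> F\<^sub>j|\<close>. The hypotheses become: no facet
  contains another, no three facets meet, \<open>F\<^sub>1\<close> meets \<open>F\<^sub>2\<close>, and \<open>F\<^sub>3, \<dots>, F\<^sub>s\<close> are pairwise disjoint.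
  So the graph of meeting facets consists of the edge from 1 to 2 and, for each \<open>j > 2\<close>, of edges
  from \<open>j\<close> to 1, to 2, to both or to neither. The depth is determined by three cases, and all four
  claims are read off from them:

  \<^item> some \<open>j\<close> is joined to neither: the complex is disconnected and the depth is 1
    (\<open>depth_disconnected\<close>);
  \<^item> the graph is connected and some \<open>j\<close> is joined to both: the complex has a cycle and the depth is 2
    (\<open>depth_cycle\<close>);
  \<^item> the graph is a tree: the depth is \<open>1 + q\<close>, since the complex is built by gluing simplices along
    simplices with at least \<open>q\<close> vertices, exactly \<open>q\<close> at one place (\<open>depth_tree\<close>).

  Upper bounds come from a cochain complex. The cochains of degree \<open>k\<close> are all functions on lists of
  \<open>k\<close> variables, and the differential is an alternating sum of deletions, as in the Koszul complex but
  without an antisymmetry requirement. With this choice the contracting homotopy for multiplication by a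
  variable is the recursive definition of the differential itself, and a weakly regular sequence of
  length more than \<open>k\<close> in \<open>\<mm>\<close> forces every \<open>k\<close>-cocycle modulo \<open>I\<close> to be a coboundary
  (\<open>cocycle_imp_coboundary\<close>). A set \<open>G\<close> of variables whose removal disconnects the complex gives a
  cocycle of degree \<open>|G| + 1\<close> that is no coboundary, so the depth is at most \<open>|G| + 1\<close>
  (\<open>length_le_of_cut\<close>). A cycle of facets gives such a cocycle of degree 2
  (\<open>length_le_of_cycle\<close>). In both cases comparing coefficients of squarefree monomials detects the class.

  Lower bounds come from explicit sequences and a gluing principle: a sequence that is regular modulo
  \<open>J\<close> and modulo \<open>L\<close>, and without its last entry also modulo \<open>J + L\<close>, is regular modulo \<open>J \<inter> L\<close>
  (\<open>weakly_regular_Int\<close>). The facets are glued one after the other. The sequence has to work over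
  every field, finite ones included, so generic linear forms are avoided: the variables are coloured
  such that each nonempty \<open>F\<^sub>i \<inter> F\<^sub>j\<close> shows all colours, which is possible because these sets are
  disjoint for different pairs and have at least as many elements as there are colours: one colour in the
  second case, \<open>q\<close> colours in the third. The entries are the sums of the colour classes and one further form
  that separates \<open>F\<^sub>1\<close> and \<open>F\<^sub>2\<close> from their intersection (\<open>ex_regular_colours\<close>).

  Finally \<open>q\<close> is a minimum of Krull dimensions, and \<open>krull_dim_vars_prime\<close> identifies them. For the upper
  bound, a chain of primes of length \<open>l\<close> yields \<open>l\<close> elements that satisfy no algebraic relation,
  whereas more polynomials than variables always satisfy one.
\<close>

abbreviation "keys \<equiv> Poly_Mapping.keys"
abbreviation "lookup \<equiv> Poly_Mapping.lookup"
abbreviation "single \<equiv> Poly_Mapping.single"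

section \<open>Weakly regular sequences and a cochain complex on lists\<close>

text \<open>
  Polynomials in the variables \<open>x\<^sub>1, \<dots>, x\<^sub>n\<close> form a subset of a type that is itself a commutative ring.
  Ideals, sums of ideals and regular sequences are therefore treated for an arbitrary subring of a ring
  type, which keeps the arithmetic of the type available.
\<close>

locale subring_of_type =
  fixes C :: "'a::comm_ring_1 set"
  assumes one_closed: "1 \<in> C"
    and diff_closed: "\<And>x y. x \<in> C \<Longrightarrow> y \<in> C \<Longrightarrow> x - y \<in> C"
    and mult_closed: "\<And>x y. x \<in> C \<Longrightarrow> y \<in> C \<Longrightarrow> x * y \<in> C"
begin

lemma zero_closed: "0 \<in> C"
  using diff_closed[OF one_closed one_closed] by simp

lemma uminus_closed: "x \<in> C \<Longrightarrow> - x \<in> C"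
  using diff_closed[OF zero_closed] by fastforce

lemma add_closed: "x \<in> C \<Longrightarrow> y \<in> C \<Longrightarrow> x + y \<in> C"
  using diff_closed[OF _ uminus_closed] by fastforce

lemma sum_closed: "(\<And>i. i \<in> A \<Longrightarrow> f i \<in> C) \<Longrightarrow> sum f A \<in> C"
  by (induction A rule: infinite_finite_induct) (auto intro: zero_closed add_closed)

lemma prod_closed: "(\<And>i. i \<in> A \<Longrightarrow> f i \<in> C) \<Longrightarrow> prod f A \<in> C"
  by (induction A rule: infinite_finite_induct) (auto intro: one_closed mult_closed)

lemma power_closed: "x \<in> C \<Longrightarrow> x ^ k \<in> C"
  by (induction k) (auto intro: one_closed mult_closed)

lemmas closed = zero_closed one_closed diff_closed uminus_closed add_closed mult_closed
  sum_closed prod_closed power_closed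

definition is_ideal :: "'a set \<Rightarrow> bool" where
  "is_ideal J \<longleftrightarrow> J \<subseteq> C \<and> 0 \<in> J \<and> (\<forall>x\<in>J. \<forall>y\<in>J. x + y \<in> J) \<and> (\<forall>x\<in>J. \<forall>c\<in>C. c * x \<in> J)"

lemma is_idealD:
  assumes "is_ideal J"
  shows "\<And>x. x \<in> J \<Longrightarrow> x \<in> C" "0 \<in> J" "\<And>x y. x \<in> J \<Longrightarrow> y \<in> J \<Longrightarrow> x + y \<in> J"
    "\<And>x c. x \<in> J \<Longrightarrow> c \<in> C \<Longrightarrow> c * x \<in> J"
    "\<And>x c. x \<in> J \<Longrightarrow> c \<in> C \<Longrightarrow> x * c \<in> J"
    "\<And>x. x \<in> J \<Longrightarrow> - x \<in> J" "\<And>x y. x \<in> J \<Longrightarrow> y \<in> J \<Longrightarrow> x - y \<in> J"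
proof -
  show *: "\<And>x. x \<in> J \<Longrightarrow> x \<in> C" "0 \<in> J" "\<And>x y. x \<in> J \<Longrightarrow> y \<in> J \<Longrightarrow> x + y \<in> J"
    "\<And>x c. x \<in> J \<Longrightarrow> c \<in> C \<Longrightarrow> c * x \<in> J"
    using assms by (auto simp: is_ideal_def)
  show "\<And>x c. x \<in> J \<Longrightarrow> c \<in> C \<Longrightarrow> x * c \<in> J" using *(4) by (simp add: mult.commute)
  show **: "\<And>x. x \<in> J \<Longrightarrow> - x \<in> J" using *(4)[of _ "-1"] by (simp add: closed)
  show "\<And>x y. x \<in> J \<Longrightarrow> y \<in> J \<Longrightarrow> x - y \<in> J" using *(3)[OF _ **] by fastforce
qed

lemma is_ideal_sum:
  assumes "is_ideal J" "\<And>i. i \<in> A \<Longrightarrow> f i \<in> J"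
  shows "sum f A \<in> J"
  using assms(2) by (induction A rule: infinite_finite_induct) (auto intro: is_idealD[OF assms(1)])

definition ideal_plus :: "'a set \<Rightarrow> 'a set \<Rightarrow> 'a set" where
  "ideal_plus J L = {x + y |x y. x \<in> J \<and> y \<in> L}"

lemma is_ideal_ideal_plus:
  assumes J: "is_ideal J" and L: "is_ideal L"
  shows "is_ideal (ideal_plus J L)"
  unfolding is_ideal_def
proof (intro conjI ballI)
  show "ideal_plus J L \<subseteq> C"
    using is_idealD(1)[OF J] is_idealD(1)[OF L] by (auto simp: ideal_plus_def intro: closed)
  show "0 \<in> ideal_plus J L"
    using is_idealD(2)[OF J] is_idealD(2)[OF L] by (force simp: ideal_plus_def)
next
  fix x y assume "x \<in> ideal_plus J L" "y \<in> ideal_plus J L"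
  then obtain a b c d where "x = a + b" "y = c + d" "a \<in> J" "c \<in> J" "b \<in> L" "d \<in> L"
    by (auto simp: ideal_plus_def)
  then have "x + y = (a + c) + (b + d)" "a + c \<in> J" "b + d \<in> L"
    using is_idealD(3)[OF J] is_idealD(3)[OF L] by auto
  then show "x + y \<in> ideal_plus J L" unfolding ideal_plus_def by blast
next
  fix x c assume "x \<in> ideal_plus J L" and c: "c \<in> C"
  then obtain a b where "x = a + b" "a \<in> J" "b \<in> L" by (auto simp: ideal_plus_def)
  then have "c * x = c * a + c * b" "c * a \<in> J" "c * b \<in> L"
    using is_idealD(4)[OF J _ c] is_idealD(4)[OF L _ c] by (auto simp: distrib_left)
  then show "c * x \<in> ideal_plus J L" unfolding ideal_plus_def by blast
qed

definition adjoin :: "'a set \<Rightarrow> 'a \<Rightarrow> 'a set" where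
  "adjoin J a = {j + a * u |j u. j \<in> J \<and> u \<in> C}"

lemma adjoinI: "j \<in> J \<Longrightarrow> u \<in> C \<Longrightarrow> j + a * u \<in> adjoin J a"
  unfolding adjoin_def by blast

lemma adjoinE:
  assumes "x \<in> adjoin J a"
  obtains j u where "x = j + a * u" "j \<in> J" "u \<in> C"
  using assms unfolding adjoin_def by blast

lemma adjoin_eq_ideal_plus: "adjoin J a = ideal_plus J ((*) a ` C)"
  unfolding adjoin_def ideal_plus_def by blast

lemma is_ideal_principal: "a \<in> C \<Longrightarrow> is_ideal ((*) a ` C)"
  unfolding is_ideal_def
  by (auto simp: mult_closed image_iff intro: closed bexI[of _ 0])
     (metis add_closed distrib_left, metis mult.left_commute mult_closed)

lemma is_ideal_adjoin: "is_ideal J \<Longrightarrow> a \<in> C \<Longrightarrow> is_ideal (adjoin J a)"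
  unfolding adjoin_eq_ideal_plus by (intro is_ideal_ideal_plus is_ideal_principal)

lemma adjoin_mono: "J \<subseteq> L \<Longrightarrow> adjoin J a \<subseteq> adjoin L a"
  unfolding adjoin_def by blast

lemma subset_adjoin: "J \<subseteq> adjoin J a"
  using adjoinI[of _ J 0 a] by (auto simp: closed)

lemma mem_adjoin: "is_ideal J \<Longrightarrow> a \<in> adjoin J a"
  using adjoinI[of 0 J 1 a] by (auto simp: closed is_idealD(2))

lemma adjoin_ideal_plus: "adjoin (ideal_plus J L) a = ideal_plus (adjoin J a) (adjoin L a)"
proof (intro equalityI subsetI)
  fix x assume "x \<in> adjoin (ideal_plus J L) a"
  then obtain j l u where "x = (j + a * u) + (l + a * 0)" "j \<in> J" "l \<in> L" "u \<in> C"
    by (auto simp: ideal_plus_def elim!: adjoinE) (metis add.assoc add.commute)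
  then show "x \<in> ideal_plus (adjoin J a) (adjoin L a)"
    unfolding ideal_plus_def by (blast intro: adjoinI closed)
next
  fix x assume "x \<in> ideal_plus (adjoin J a) (adjoin L a)"
  then obtain j l u v where "x = (j + a * u) + (l + a * v)" "j \<in> J" "l \<in> L" "u \<in> C" "v \<in> C"
    by (auto simp: ideal_plus_def elim!: adjoinE)
  moreover from this have "x = (j + l) + a * (u + v)" by (simp add: algebra_simps)
  ultimately show "x \<in> adjoin (ideal_plus J L) a"
    by (metis (mono_tags, lifting) add_closed adjoinI ideal_plus_def mem_Collect_eq)
qed

lemma is_ideal_foldl_adjoin:
  "is_ideal J \<Longrightarrow> set as \<subseteq> C \<Longrightarrow> is_ideal (foldl adjoin J as)"
  by (induction as arbitrary: J) (auto intro: is_ideal_adjoin)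

lemma subset_foldl_adjoin: "J \<subseteq> foldl adjoin J as"
proof (induction as rule: rev_induct)
  case (snoc a as)
  then show ?case using subset_adjoin[of "foldl adjoin J as" a] by simp
qed simp

definition nonzerodivisor_mod :: "'a \<Rightarrow> 'a set \<Rightarrow> bool" where
  "nonzerodivisor_mod a J \<longleftrightarrow> (\<forall>x\<in>C. a * x \<in> J \<longrightarrow> x \<in> J)"

text \<open>
  The nonzerodivisor part of regularity, in the form of conditions on a chain of ideals. That the last
  quotient is nonzero is supplied for sequences in \<open>\<mm>\<close> by \<open>depth_quot_module\<close>.
\<close>

definition weakly_regular :: "'a set \<Rightarrow> 'a list \<Rightarrow> bool" where
  "weakly_regular J as \<longleftrightarrow>
     (\<forall>i<length as. nonzerodivisor_mod (as ! i) (foldl adjoin J (take i as)))"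

lemma weakly_regular_Nil [simp]: "weakly_regular J []"
  by (simp add: weakly_regular_def)

lemma weakly_regular_Cons:
  "weakly_regular J (a # as) \<longleftrightarrow> nonzerodivisor_mod a J \<and> weakly_regular (adjoin J a) as"
  by (simp add: weakly_regular_def All_less_Suc2)

lemma weakly_regular_snoc:
  "weakly_regular J (as @ [a]) \<longleftrightarrow>
     weakly_regular J as \<and> nonzerodivisor_mod a (foldl adjoin J as)"
  by (auto simp: weakly_regular_def less_Suc_eq nth_append)

lemma nonzerodivisor_mod_Int:
  "nonzerodivisor_mod a J \<Longrightarrow> nonzerodivisor_mod a L \<Longrightarrow> nonzerodivisor_mod a (J \<inter> L)"
  by (auto simp: nonzerodivisor_mod_def)

text \<open>
  This is exactness of \<open>0 \<rightarrow> S/(J \<inter> L) \<rightarrow> S/J \<oplus> S/L \<rightarrow> S/(J + L) \<rightarrow> 0\<close> after division by \<open>a\<close>: if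
  \<open>j + a u = l + a v\<close> lies in both ideals, then \<open>a (u - v) \<in> J + L\<close>, so \<open>u\<close> and \<open>v\<close> can be replaced by a
  common value.
\<close>

lemma adjoin_Int:
  assumes J: "is_ideal J" and L: "is_ideal L" and a: "a \<in> C"
    and reg: "nonzerodivisor_mod a (ideal_plus J L)"
  shows "adjoin (J \<inter> L) a = adjoin J a \<inter> adjoin L a"
proof
  show "adjoin (J \<inter> L) a \<subseteq> adjoin J a \<inter> adjoin L a"
    by (simp add: adjoin_mono)
next
  show "adjoin J a \<inter> adjoin L a \<subseteq> adjoin (J \<inter> L) a"
  proof
    fix x assume "x \<in> adjoin J a \<inter> adjoin L a"
    then have "x \<in> adjoin J a" "x \<in> adjoin L a" by auto
    then obtain j u l v where x: "x = j + a * u" "x = l + a * v"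
      and mem: "j \<in> J" "l \<in> L" "u \<in> C" "v \<in> C"
      by (metis adjoinE)
    have "a * (u - v) = - j + l" using x by (simp add: algebra_simps)
    then have "a * (u - v) \<in> ideal_plus J L"
      unfolding ideal_plus_def using mem is_idealD(6)[OF J] by blast
    then have "u - v \<in> ideal_plus J L"
      using reg mem by (simp add: nonzerodivisor_mod_def closed)
    then obtain j' l' where u: "u - v = j' + l'" and mem': "j' \<in> J" "l' \<in> L"
      by (auto simp: ideal_plus_def)
    let ?w = "u - j'"
    have "x - a * ?w = j + a * j'" using x by (simp add: algebra_simps)
    then have 1: "x - a * ?w \<in> J" using mem mem' a is_idealD[OF J] by auto
    have "u = v + j' + l'" using u by (simp add: algebra_simps)
    then have "x - a * ?w = l - a * l'" using x by (simp add: algebra_simps)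
    then have 2: "x - a * ?w \<in> L" using mem mem' a is_idealD[OF L] by auto
    have "?w \<in> C" using mem mem' is_idealD(1)[OF J] by (auto intro: closed)
    then have "(x - a * ?w) + a * ?w \<in> adjoin (J \<inter> L) a"
      using 1 2 by (intro adjoinI) auto
    then show "x \<in> adjoin (J \<inter> L) a" by simp
  qed
qed

text \<open>
  The elementary form of the depth lemma for gluing: one entry fewer is required on the
  intersection of the two pieces, since the last step only uses that \<open>S/(J \<inter> L)\<close> embeds into
  \<open>S/J \<oplus> S/L\<close>.
\<close>

lemma weakly_regular_Int:
  assumes "is_ideal J" "is_ideal L" "set as \<subseteq> C" "b \<in> C"
    and "weakly_regular J (as @ [b])" "weakly_regular L (as @ [b])" "weakly_regular (ideal_plus J L) as"
  shows "weakly_regular (J \<inter> L) (as @ [b])"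
  using assms
proof (induction as arbitrary: J L)
  case Nil
  then show ?case by (simp add: weakly_regular_Cons nonzerodivisor_mod_Int)
next
  case (Cons a as)
  then show ?case
    by (simp add: weakly_regular_Cons nonzerodivisor_mod_Int adjoin_Int adjoin_ideal_plus
        is_ideal_adjoin)
qed

text \<open>
  In closed form the value at \<open>[s\<^sub>0, \<dots>, s\<^sub>k]\<close> is the sum of \<open>(-1)\<^sup>j \<phi>(s\<^sub>j)\<close> times the value of \<open>z\<close> at the
  list without \<open>s\<^sub>j\<close>. Read with \<open>z (s # _)\<close> as contraction by \<open>s\<close>, the recursive equation says that
  contraction by \<open>s\<close> is a homotopy between multiplication by \<open>\<phi>(s)\<close> and zero.
\<close>

primrec coboundary :: "('i \<Rightarrow> 'a) \<Rightarrow> ('i list \<Rightarrow> 'a) \<Rightarrow> 'i list \<Rightarrow> 'a" where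
  "coboundary \<phi> z [] = 0"
| "coboundary \<phi> z (s # t) = \<phi> s * z t - coboundary \<phi> (\<lambda>u. z (s # u)) t"

lemma coboundary_zero [simp]: "coboundary \<phi> (\<lambda>_. 0) t = 0"
  by (induction t) auto

lemma coboundary_add: "coboundary \<phi> (\<lambda>t. z t + w t) t = coboundary \<phi> z t + coboundary \<phi> w t"
  by (induction t arbitrary: z w) (auto simp: algebra_simps)

lemma coboundary_scale: "coboundary \<phi> (\<lambda>t. c * z t) t = c * coboundary \<phi> z t"
  by (induction t arbitrary: z) (auto simp: algebra_simps)

lemma coboundary_diff: "coboundary \<phi> (\<lambda>t. z t - w t) t = coboundary \<phi> z t - coboundary \<phi> w t"
  by (induction t arbitrary: z w) (auto simp: algebra_simps)

lemma coboundary_sum: "coboundary \<phi> (\<lambda>t. \<Sum>i\<in>A. z i t) t = (\<Sum>i\<in>A. coboundary \<phi> (z i) t)"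
  by (induction A rule: infinite_finite_induct) (auto simp: coboundary_add)

text \<open>
  The polarised form of the identity that the differential squares to zero; it supplies all signs in
  computations with \<open>wedge\<close>.
\<close>

lemma coboundary_anticommute: "coboundary \<phi> (coboundary \<psi> z) t = - coboundary \<psi> (coboundary \<phi> z) t"
proof (induction t arbitrary: z)
  case (Cons s t)
  have "coboundary \<phi> (coboundary \<psi> z) (s # t) =
      \<phi> s * coboundary \<psi> z t - \<psi> s * coboundary \<phi> z t + coboundary \<phi> (coboundary \<psi> (\<lambda>u. z (s # u))) t" for \<phi> \<psi>
    by (simp add: coboundary_diff coboundary_scale)
  from this[of \<phi> \<psi>] this[of \<psi> \<phi>] show ?case
    using Cons.IH[of "\<lambda>u. z (s # u)"] by (simp del: coboundary.simps)
qed auto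

lemma coboundary_twice: "coboundary \<phi> (coboundary \<phi> z) t = 0"
proof (induction t arbitrary: z)
  case (Cons s t)
  then show ?case by (simp add: coboundary_diff coboundary_scale)
qed auto

lemma coboundary_closed:
  assumes "is_ideal J" "\<And>s. s \<in> set t \<Longrightarrow> \<phi> s \<in> C"
    and "\<And>u. set u \<subseteq> set t \<Longrightarrow> length t = Suc (length u) \<Longrightarrow> z u \<in> J"
  shows "coboundary \<phi> z t \<in> J"
  using assms(2,3)
proof (induction t arbitrary: z)
  case Nil
  then show ?case using assms(1) by (simp add: is_idealD)
next
  case (Cons s t)
  have "\<phi> s * z t \<in> J" using Cons.prems by (intro is_idealD(4)[OF assms(1)]) auto
  moreover have "coboundary \<phi> (\<lambda>u. z (s # u)) t \<in> J"
  proof (rule Cons.IH)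
    fix u assume "set u \<subseteq> set t" "length t = Suc (length u)"
    then show "z (s # u) \<in> J" by (intro Cons.prems(2)) auto
  qed (use Cons.prems(1) in auto)
  ultimately show ?case by (simp add: is_idealD[OF assms(1)])
qed

lemma is_ideal_carrier: "is_ideal C"
  by (auto simp: is_ideal_def intro: closed)

text \<open>
  Cohomology of the quotient vanishes below the length of a weakly regular sequence. By the homotopy,
  the first entry \<open>a\<close> annihilates classes: \<open>a z = d w\<close> modulo \<open>J\<close>. Then \<open>w\<close> is a cocycle modulo
  \<open>J + (a)\<close>, so by induction \<open>w = d v + a u\<close>, hence \<open>a z = a d u\<close>, and \<open>a\<close> can be cancelled.
\<close>

lemma cocycle_imp_coboundary:
  assumes "is_ideal J" "finite V" "\<And>i. i \<in> V \<Longrightarrow> \<phi> i \<in> C"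
    and "weakly_regular J as" "\<And>a. a \<in> set as \<Longrightarrow> \<exists>u. (\<forall>i\<in>V. u i \<in> C) \<and> a = (\<Sum>i\<in>V. u i * \<phi> i)"
    and "k < length as"
    and "\<And>t. set t \<subseteq> V \<Longrightarrow> length t = k \<Longrightarrow> z t \<in> C"
    and "\<And>t. set t \<subseteq> V \<Longrightarrow> length t = Suc k \<Longrightarrow> coboundary \<phi> z t \<in> J"
  shows "\<exists>w. (\<forall>t. w t \<in> C) \<and> (\<forall>t. set t \<subseteq> V \<longrightarrow> length t = k \<longrightarrow> z t - coboundary \<phi> w t \<in> J)"
  using assms(1,4-8)
proof (induction as arbitrary: J k z)
  case (Cons a as)
  note J = is_idealD[OF Cons.prems(1)]
  obtain c where c: "\<And>i. i \<in> V \<Longrightarrow> c i \<in> C" and a: "a = (\<Sum>i\<in>V. c i * \<phi> i)"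
    using Cons.prems(3) by (meson list.set_intros(1))
  have aC: "a \<in> C" unfolding a using c assms(3) by (intro closed) auto
  have reg: "nonzerodivisor_mod a J" "weakly_regular (adjoin J a) as"
    using Cons.prems(2) by (auto simp: weakly_regular_Cons)
  define w where "w t = (\<Sum>i\<in>V. c i * z (i # t))" for t
  have homotopy: "a * z t - coboundary \<phi> w t \<in> J" if t: "set t \<subseteq> V" "length t = k" for t
  proof -
    have "coboundary \<phi> w t = (\<Sum>i\<in>V. c i * coboundary \<phi> (\<lambda>t. z (i # t)) t)"
      unfolding w_def by (simp add: coboundary_sum coboundary_scale)
    then have "a * z t - coboundary \<phi> w t = (\<Sum>i\<in>V. c i * coboundary \<phi> z (i # t))"
      by (simp add: a sum_distrib_right sum_distrib_left sum_subtractf algebra_simps)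
    also have "\<dots> \<in> J"
      using c t Cons.prems(6) by (intro is_ideal_sum Cons.prems(1) J(4)) (auto simp del: coboundary.simps)
    finally show ?thesis .
  qed
  show ?case
  proof (cases k)
    case 0
    have "a * z [] \<in> J" using homotopy[of "[]"] 0 by simp
    then have "z [] \<in> J"
      using reg(1) Cons.prems(5)[of "[]"] 0 by (auto simp: nonzerodivisor_mod_def)
    then show ?thesis using 0 by (intro exI[of _ "\<lambda>_. 0"]) (auto intro: closed)
  next
    case (Suc l)
    have wC: "w t \<in> C" if "set t \<subseteq> V" "length t = l" for t
      unfolding w_def using c that Cons.prems(5) Suc by (intro closed) auto
    have dwJ: "coboundary \<phi> w t \<in> adjoin J a" if t: "set t \<subseteq> V" "length t = Suc l" for t
    proof -
      have "(- (a * z t - coboundary \<phi> w t)) + a * z t \<in> adjoin J a"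
        using homotopy[of t] t Suc Cons.prems(5) by (intro adjoinI J(6)) auto
      then show ?thesis by simp
    qed
    obtain v where v: "\<And>t. v t \<in> C"
      "\<And>t. set t \<subseteq> V \<Longrightarrow> length t = l \<Longrightarrow> w t - coboundary \<phi> v t \<in> adjoin J a"
      using Cons.IH[of "adjoin J a" l w] Cons.prems aC reg Suc wC dwJ
      by (auto simp: is_ideal_adjoin)
    have "\<exists>u\<in>C. set t \<subseteq> V \<longrightarrow> length t = l \<longrightarrow> w t - coboundary \<phi> v t - a * u \<in> J" for t
    proof (cases "set t \<subseteq> V \<and> length t = l")
      case True
      then obtain j u where "w t - coboundary \<phi> v t = j + a * u" "j \<in> J" "u \<in> C"
        using v(2) by (blast elim: adjoinE)
      then show ?thesis by (intro bexI[of _ u]) auto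
    qed (auto intro: closed)
    then obtain u where u: "\<And>t. u t \<in> C"
      "\<And>t. set t \<subseteq> V \<Longrightarrow> length t = l \<Longrightarrow> w t - coboundary \<phi> v t - a * u t \<in> J"
      by metis
    have "z t - coboundary \<phi> u t \<in> J" if t: "set t \<subseteq> V" "length t = k" for t
    proof -
      have "coboundary \<phi> (\<lambda>t. w t - coboundary \<phi> v t - a * u t) t \<in> J"
        using t Suc assms(3) u(2) by (intro coboundary_closed Cons.prems(1)) auto
      then have "coboundary \<phi> w t - a * coboundary \<phi> u t \<in> J"
        by (simp add: coboundary_diff coboundary_scale coboundary_twice)
      from J(3)[OF homotopy[OF t] this] have "a * (z t - coboundary \<phi> u t) \<in> J"
        by (simp add: algebra_simps)
      moreover have "coboundary \<phi> u t \<in> C"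
        using t assms(3) u(1) by (intro coboundary_closed is_ideal_carrier) auto
      ultimately show ?thesis
        using reg(1) Cons.prems(5)[OF t] by (auto simp: nonzerodivisor_mod_def closed)
    qed
    then show ?thesis using u(1) by blast
  qed
qed simp

end

section \<open>Polynomials, monomial primes and substitution\<close>

type_synonym 'k mpoly = "(nat \<Rightarrow>\<^sub>0 nat) \<Rightarrow>\<^sub>0 'k"

abbreviation polys :: "nat \<Rightarrow> 'k::field mpoly set" where
  "polys n \<equiv> carrier (mpoly_ring n)"

lemma mem_polys_iff:
  "f \<in> polys n \<longleftrightarrow> (\<forall>m \<in> keys f. keys m \<subseteq> {1..n})"
  by (simp add: mpoly_ring_def)

lemma keys_add_nat:
  "keys (m + m') = keys m \<union> keys (m' :: 'a \<Rightarrow>\<^sub>0 nat)"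
  by (auto simp: in_keys_iff lookup_add)

lemma keys_multE:
  assumes "m \<in> keys (f * g :: ('a :: monoid_add) \<Rightarrow>\<^sub>0 ('b :: semiring_0))"
  obtains a b where "m = a + b" "a \<in> keys f" "b \<in> keys g"
  using assms keys_mult[of f g] by auto

lemma subring_polys: "subring_of_type (polys n :: 'k::field mpoly set)"
proof
  show "1 \<in> (polys n :: 'k mpoly set)" by (auto simp: mem_polys_iff)
next
  fix x y :: "'k mpoly"
  assume xy: "x \<in> polys n" "y \<in> polys n"
  have "keys (x - y) \<subseteq> keys x \<union> keys y"
    by (auto simp: in_keys_iff lookup_minus)
  then show "x - y \<in> polys n" using xy by (auto simp: mem_polys_iff)
  show "x * y \<in> polys n"
    unfolding mem_polys_iff
  proof
    fix m assume "m \<in> keys (x * y)"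
    then show "keys m \<subseteq> {1..n}"
      using xy by (elim keys_multE) (simp add: mem_polys_iff keys_add_nat)
  qed
qed

global_interpretation polys: subring_of_type "polys n :: 'k::field mpoly set" for n
  by (rule subring_polys)

lemma mpoly_ring_simps [simp]:
  "monoid.mult (mpoly_ring n) = (*)" "monoid.one (mpoly_ring n) = 1"
  "ring.zero (mpoly_ring n) = 0" "ring.add (mpoly_ring n) = (+)"
  by (simp_all add: mpoly_ring_def)

lemma cring_mpoly_ring: "cring (mpoly_ring n :: 'k::field mpoly ring)"
proof (rule cringI)
  show "abelian_group (mpoly_ring n :: 'k::field mpoly ring)"
    by (rule abelian_groupI)
       (auto simp: polys.closed algebra_simps intro!: bexI[of _ "- x" for x] polys.closed)
  show "Group.comm_monoid (mpoly_ring n :: 'k::field mpoly ring)"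
    by (rule comm_monoidI) (auto simp: polys.closed algebra_simps)
qed (auto simp: algebra_simps)

lemma sum_monomials:
  assumes "finite M" "keys f \<subseteq> M"
  shows "f = (\<Sum>m\<in>M. single m (lookup f m))"
proof (rule poly_mapping_eqI)
  fix k
  have "(\<Sum>m\<in>M. lookup (single m (lookup f m)) k) =
      (\<Sum>m\<in>M. if m = k then lookup f k else 0)"
    by (intro sum.cong) (auto simp: lookup_single)
  also have "\<dots> = lookup f k"
    using assms by (auto simp: in_keys_iff)
  finally show "lookup f k =
      lookup (\<Sum>m\<in>M. single m (lookup f m)) k"
    by (simp add: lookup_sum)
qed

lemma lookup_single_mult:
  fixes f :: "('a::{cancel_comm_monoid_add}) \<Rightarrow>\<^sub>0 ('b::semiring_0)"
  shows "lookup (single t c * f) (t + m) = c * lookup f m"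
proof -
  have "lookup (single t c * f) (t + m) =
      (\<Sum>l. lookup (single t c) l *
         (\<Sum>q. lookup f q when t + m = l + q))"
    by (simp add: lookup_mult)
  also have "\<dots> = (\<Sum>l. (c * (\<Sum>q. lookup f q when t + m = l + q)) when t = l)"
    by (intro Sum_any.cong) (auto simp: lookup_single when_def)
  also have "\<dots> = c * (\<Sum>q. lookup f q when m = q)"
    by simp
  finally show ?thesis by simp
qed

lemma lookup_var_mult:
  "lookup (var i * f) m =
     (if i \<in> keys m then lookup f (m - single i 1) else 0)"
proof (cases "i \<in> keys m")
  case True
  then have "m = single i 1 + (m - single i 1)"
    by (intro poly_mapping_eqI) (auto simp: lookup_add lookup_minus lookup_single in_keys_iff when_def)
  then have "lookup (var i * f) m =
      lookup (var i * f) (single i 1 + (m - single i 1))"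
    by simp
  then show ?thesis using True
    unfolding var_def lookup_single_mult by simp
next
  case False
  have "m \<notin> keys (var i * f)"
  proof
    assume "m \<in> keys (var i * f)"
    then obtain b where "m = single i 1 + b"
      by (elim keys_multE) (auto simp: var_def)
    then show False using False by (simp add: keys_add_nat)
  qed
  then show ?thesis using False by (simp add: in_keys_iff)
qed

lemma var_mem_polys: "i \<in> {1..n} \<Longrightarrow> var i \<in> polys n"
  by (auto simp: mem_polys_iff var_def)

lemma single_mem_polys: "keys m \<subseteq> {1..n} \<Longrightarrow> single m c \<in> polys n"
  by (auto simp: mem_polys_iff)

lemma var_mult_single:
  assumes "i \<in> keys m"
  shows "single m c = var i * single (m - single i 1) c"
proof -
  have "m = single i 1 + (m - single i 1)"
    using assms
    by (intro poly_mapping_eqI) (auto simp: lookup_add lookup_minus lookup_single in_keys_iff when_def)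
  then show ?thesis by (simp add: var_def mult_single)
qed

lemma keys_diff_nat: "keys (m - m' :: 'a \<Rightarrow>\<^sub>0 nat) \<subseteq> keys m"
  by (auto simp: in_keys_iff lookup_minus)

text \<open>
  Membership read off from the monomials; by \<open>var_ideal_eq\<close> this is the ideal generated by the
  variables with index in \<open>A\<close>.
\<close>

definition vars_prime :: "nat \<Rightarrow> nat set \<Rightarrow> 'k::field mpoly set" where
  "vars_prime n A = {f \<in> polys n. \<forall>m\<in>keys f. keys m \<inter> A \<noteq> {}}"

lemma is_ideal_vars_prime: "polys.is_ideal n (vars_prime n A :: 'k::field mpoly set)"
  unfolding polys.is_ideal_def
proof (intro conjI ballI)
  fix x c :: "'k mpoly" assume x: "x \<in> vars_prime n A" and c: "c \<in> polys n"
  have "keys m \<inter> A \<noteq> {}" if "m \<in> keys (c * x)" for m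
    using that x by (elim keys_multE) (auto simp: vars_prime_def keys_add_nat)
  then show "c * x \<in> vars_prime n A"
    using x c by (auto simp: vars_prime_def polys.closed)
next
  fix x y :: "'k mpoly" assume "x \<in> vars_prime n A" "y \<in> vars_prime n A"
  then show "x + y \<in> vars_prime n A"
    using Poly_Mapping.keys_add[of x y] by (auto simp: vars_prime_def polys.closed)
qed (auto simp: vars_prime_def polys.closed)

lemma ideal_iff_is_ideal:
  fixes J :: "'k::field mpoly set"
  shows "ideal J (mpoly_ring n) \<longleftrightarrow> polys.is_ideal n J"
proof
  assume "ideal J (mpoly_ring n)"
  then interpret J: ideal J "mpoly_ring n" .
  show "polys.is_ideal n J"
    unfolding polys.is_ideal_def
  proof (intro conjI ballI)
    show "J \<subseteq> polys n" by (rule J.a_subset)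
    show "0 \<in> J" using additive_subgroup.zero_closed[OF J.additive_subgroup_axioms] by simp
  next
    fix x y assume "x \<in> J" "y \<in> J"
    then show "x + y \<in> J" using additive_subgroup.a_closed[OF J.additive_subgroup_axioms, of x y] by simp
  next
    fix x c :: "'k mpoly" assume "x \<in> J" "c \<in> polys n"
    then show "c * x \<in> J" using J.I_l_closed[of x c] by simp
  qed
next
  assume J: "polys.is_ideal n J"
  interpret cring "mpoly_ring n :: 'k mpoly ring" by (rule cring_mpoly_ring)
  have "inv\<^bsub>add_monoid (mpoly_ring n)\<^esub> x = - x" if "x \<in> polys n" for x :: "'k mpoly"
    using minus_equality[of "- x" x] that by (simp add: a_inv_def polys.closed)
  then have "subgroup J (add_monoid (mpoly_ring n))"
    using polys.is_idealD(1-3,6)[OF J] by (intro subgroup.intro) auto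
  then show "ideal J (mpoly_ring n)"
    using polys.is_idealD(4,5)[OF J] by (intro idealI ring_axioms) simp_all
qed

lemma var_ideal_eq:
  assumes "A \<subseteq> {1..n}"
  shows "var_ideal n A = (vars_prime n A :: 'k::field mpoly set)"
proof
  interpret cring "mpoly_ring n :: 'k mpoly ring" by (rule cring_mpoly_ring)
  have sub: "var ` A \<subseteq> (polys n :: 'k mpoly set)" 
    by (intro image_subsetI var_mem_polys) (rule subsetD[OF assms])
  show "var_ideal n A \<subseteq> (vars_prime n A :: 'k mpoly set)"
  proof -
    have "var ` A \<subseteq> (vars_prime n A :: 'k mpoly set)"
      using sub by (auto simp: vars_prime_def var_def)
    then show ?thesis
      unfolding var_ideal_def
      by (intro genideal_minimal) (simp_all add: ideal_iff_is_ideal is_ideal_vars_prime)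
  qed
  have idl: "polys.is_ideal n (var_ideal n A :: 'k mpoly set)"
    unfolding var_ideal_def ideal_iff_is_ideal[symmetric] by (rule genideal_ideal[OF sub])
  have gen: "var ` A \<subseteq> (var_ideal n A :: 'k mpoly set)"
    unfolding var_ideal_def by (rule genideal_self[OF sub])
  show "vars_prime n A \<subseteq> (var_ideal n A :: 'k mpoly set)"
  proof
    fix f :: "'k mpoly" assume f: "f \<in> vars_prime n A"
    have "single m (lookup f m) \<in> var_ideal n A"
      if m: "m \<in> keys f" for m
    proof -
      have "keys m \<inter> A \<noteq> {}" and k: "keys m \<subseteq> {1..n}"
        using f m by (simp_all add: vars_prime_def mem_polys_iff)
      then obtain i where i: "i \<in> keys m" "i \<in> A" by blast
      show ?thesis
        using i k gen keys_diff_nat[of m "single i 1"]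
        by (subst var_mult_single[OF i(1)], intro polys.is_idealD(5)[OF idl] single_mem_polys) auto
    qed
    then have "(\<Sum>m\<in>keys f. single m (lookup f m)) \<in> var_ideal n A"
      by (intro polys.is_ideal_sum[OF idl])
    then show "f \<in> var_ideal n A"
      using sum_monomials[of "keys f" f] by simp
  qed
qed

definition eval_monomial :: "(nat \<Rightarrow> 'a::comm_monoid_mult) \<Rightarrow> (nat \<Rightarrow>\<^sub>0 nat) \<Rightarrow> 'a" where
  "eval_monomial \<sigma> m = (\<Prod>i\<in>keys m. \<sigma> i ^ lookup m i)"

lemma eval_monomial_superset:
  assumes "finite A" "keys m \<subseteq> A"
  shows "eval_monomial \<sigma> m = (\<Prod>i\<in>A. \<sigma> i ^ lookup m i)"
  unfolding eval_monomial_def using assms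
  by (intro prod.mono_neutral_left) (auto simp: in_keys_iff)

lemma eval_monomial_add: "eval_monomial \<sigma> (m + m') = eval_monomial \<sigma> m * eval_monomial \<sigma> m'"
proof -
  let ?A = "keys m \<union> keys m'"
  have "finite ?A" by simp
  then show ?thesis
    by (simp add: eval_monomial_superset[of ?A] keys_add_nat lookup_add power_add prod.distrib)
qed

definition subst :: "(nat \<Rightarrow> 'k::field mpoly) \<Rightarrow> 'k mpoly \<Rightarrow> 'k mpoly" where
  "subst \<sigma> f = (\<Sum>m\<in>keys f. single 0 (lookup f m) * eval_monomial \<sigma> m)"

lemma subst_superset:
  assumes "finite M" "keys f \<subseteq> M"
  shows "subst \<sigma> f = (\<Sum>m\<in>M. single 0 (lookup f m) * eval_monomial \<sigma> m)"
  unfolding subst_def using assms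
  by (intro sum.mono_neutral_left) (auto simp: in_keys_iff)

lemma subst_add: "subst \<sigma> (f + g) = subst \<sigma> f + subst \<sigma> g"
proof -
  let ?M = "keys f \<union> keys g"
  have "finite ?M" "keys (f + g) \<subseteq> ?M"
    using Poly_Mapping.keys_add[of f g] by auto
  then show ?thesis
    by (simp add: subst_superset[of ?M] lookup_add single_add sum.distrib distrib_right)
qed

lemma subst_zero [simp]: "subst \<sigma> 0 = 0"
  by (simp add: subst_def)

lemma subst_sum: "subst \<sigma> (sum f A) = (\<Sum>i\<in>A. subst \<sigma> (f i))"
  by (induction A rule: infinite_finite_induct) (auto simp: subst_add)

lemma subst_single: "subst \<sigma> (single m c) = single 0 c * eval_monomial \<sigma> m"
  by (cases "c = 0") (auto simp: subst_def)

lemma subst_mult: "subst \<sigma> (f * g) = subst \<sigma> f * subst \<sigma> g"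
proof -
  have 1: "subst \<sigma> (single m c * single m' d) =
      subst \<sigma> (single m c) * subst \<sigma> (single m' d)" for m c m' d
    using mult_single[of 0 c 0 d]
    by (simp add: mult_single subst_single eval_monomial_add mult.assoc mult.left_commute)
  have f: "f = (\<Sum>m\<in>keys f. single m (lookup f m))" (is "_ = ?f")
    by (rule sum_monomials) auto
  have g: "g = (\<Sum>m\<in>keys g. single m (lookup g m))" (is "_ = ?g")
    by (rule sum_monomials) auto
  have "subst \<sigma> (?f * ?g) = subst \<sigma> ?f * subst \<sigma> ?g"
    by (simp add: sum_product subst_sum 1)
  then show ?thesis using f g by simp
qed

lemma subst_var [simp]: "subst \<sigma> (var i) = \<sigma> i"
  by (simp add: var_def subst_single eval_monomial_def)

lemma single_eq_eval_monomial: "single m c = single 0 c * eval_monomial var m"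
proof -
  have pw: "var i ^ k = single (single i k) (1::'a)" for i k
    by (induction k) (auto simp: var_def mult_single single_add[symmetric])
  have "eval_monomial var m = (single (\<Sum>i\<in>A. single i (lookup m i)) (1::'a))"
    if "finite A" "keys m \<subseteq> A" for A
  proof -
    have "(\<Prod>i\<in>A. single (single i (lookup m i)) (1::'a)) =
       (single (\<Sum>i\<in>A. single i (lookup m i)) (1::'a))"
      using that(1) by (induction A rule: finite_induct) (auto simp: mult_single)
    then show ?thesis using that by (simp add: eval_monomial_superset pw)
  qed
  from this[of "keys m"] show ?thesis
    using sum_monomials[of "keys m" m] by (simp add: mult_single)
qed

lemma eval_monomial_closed:
  assumes "\<And>i. i \<in> {1..n} \<Longrightarrow> \<sigma> i \<in> polys n" "keys m \<subseteq> {1..n}"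
  shows "eval_monomial \<sigma> m \<in> polys n"
  unfolding eval_monomial_def using assms by (intro polys.closed) auto

lemma subst_closed:
  assumes "\<And>i. i \<in> {1..n} \<Longrightarrow> \<sigma> i \<in> polys n" "f \<in> polys n"
  shows "subst \<sigma> f \<in> polys n"
  unfolding subst_def using assms
  by (intro polys.sum_closed polys.mult_closed eval_monomial_closed single_mem_polys)
     (auto simp: mem_polys_iff)

lemma (in subring_of_type) power_diff_mem:
  assumes J: "is_ideal J" and "x \<in> C" "y \<in> C" "x - y \<in> J"
  shows "x ^ k - y ^ k \<in> J"
proof (induction k)
  case (Suc k)
  have "x ^ Suc k - y ^ Suc k = x * (x ^ k - y ^ k) + (x - y) * y ^ k" by (simp add: algebra_simps)
  moreover have "x * (x ^ k - y ^ k) \<in> J" "(x - y) * y ^ k \<in> J"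
    using assms Suc by (auto intro: is_idealD(4,5)[OF J] closed)
  ultimately show ?case using is_idealD(3)[OF J] by (simp only:)
qed (auto intro: is_idealD[OF J])

lemma (in subring_of_type) prod_diff_mem:
  assumes J: "is_ideal J" and "\<And>i. i \<in> A \<Longrightarrow> f i \<in> C" "\<And>i. i \<in> A \<Longrightarrow> g i \<in> C"
    "\<And>i. i \<in> A \<Longrightarrow> f i - g i \<in> J"
  shows "prod f A - prod g A \<in> J"
  using assms(2-)
proof (induction A rule: infinite_finite_induct)
  case (insert i A)
  have "prod f (insert i A) - prod g (insert i A)
      = f i * (prod f A - prod g A) + (f i - g i) * prod g A"
    using insert by (simp add: algebra_simps)
  moreover have "f i * (prod f A - prod g A) \<in> J"
    using insert by (intro is_idealD(4)[OF J]) auto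
  moreover have "(f i - g i) * prod g A \<in> J"
    using insert by (intro is_idealD(5)[OF J] closed) auto
  ultimately show ?case using is_idealD(3)[OF J] by simp
qed (auto intro: is_idealD[OF J])

text \<open>
  A substitution that moves each variable only within its class modulo \<open>J\<close> induces the identity on
  the quotient. Thus, if it also annihilates \<open>J\<close>, then \<open>J\<close> is its kernel.
\<close>

lemma diff_subst_mem:
  assumes J: "polys.is_ideal n J"
    and \<sigma>: "\<And>i. i \<in> {1..n} \<Longrightarrow> \<sigma> i \<in> polys n" "\<And>i. i \<in> {1..n} \<Longrightarrow> var i - \<sigma> i \<in> J"
    and f: "f \<in> polys n"
  shows "f - subst \<sigma> f \<in> J"
proof -
  have m: "eval_monomial var m - eval_monomial \<sigma> m \<in> J" if "keys m \<subseteq> {1..n}" for m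
    unfolding eval_monomial_def using that \<sigma>
    by (intro polys.prod_diff_mem[OF J] polys.power_diff_mem[OF J] polys.closed var_mem_polys) auto
  have "f - subst \<sigma> f = (\<Sum>m\<in>keys f.
      single 0 (lookup f m) * (eval_monomial var m - eval_monomial \<sigma> m))"
    using sum_monomials[of "keys f" f]
    by (simp add: subst_def right_diff_distrib sum_subtractf single_eq_eval_monomial[symmetric])
  also have "\<dots> \<in> J"
    using f by (intro polys.is_ideal_sum[OF J] polys.is_idealD(4)[OF J] m single_mem_polys)
      (auto simp: mem_polys_iff)
  finally show ?thesis .
qed

section \<open>Depth in terms of ideals; sums of monomial primes\<close>

context
  fixes n :: nat and I :: "'k::field mpoly set"
  assumes ideal_I: "polys.is_ideal n I"
begin

private abbreviation "R \<equiv> mpoly_ring n :: 'k mpoly ring"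

interpretation R: cring R by (rule cring_mpoly_ring)

interpretation I: ideal I R
  using ideal_I by (simp add: ideal_iff_is_ideal)

interpretation Q: ring "R Quot I" by (rule I.quotient_is_ring)

lemma coset_add:
  "a \<in> polys n \<Longrightarrow> b \<in> polys n \<Longrightarrow> (I +>\<^bsub>R\<^esub> a) \<oplus>\<^bsub>R Quot I\<^esub> (I +>\<^bsub>R\<^esub> b) = I +>\<^bsub>R\<^esub> (a + b)"
  using ring_hom_add[OF I.rcos_ring_hom, of a b] by simp

lemma coset_mult:
  "a \<in> polys n \<Longrightarrow> b \<in> polys n \<Longrightarrow> (I +>\<^bsub>R\<^esub> a) \<otimes>\<^bsub>R Quot I\<^esub> (I +>\<^bsub>R\<^esub> b) = I +>\<^bsub>R\<^esub> (a * b)"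
  using ring_hom_mult[OF I.rcos_ring_hom, of a b] by simp

lemma coset_eq_iff:
  assumes "a \<in> polys n" "b \<in> polys n"
  shows "I +>\<^bsub>R\<^esub> a = I +>\<^bsub>R\<^esub> b \<longleftrightarrow> a - b \<in> I"
proof -
  have "\<ominus>\<^bsub>R\<^esub> b = - b"
    using R.minus_equality[of "- b" b] assms by (simp add: polys.closed)
  then have "a \<ominus>\<^bsub>R\<^esub> b = a - b" by (simp add: a_minus_def)
  then show ?thesis
    using R.quotient_eq_iff_same_a_r_cos[OF I.is_ideal assms] by simp
qed

lemma carrier_Quot: "carrier (R Quot I) = (\<lambda>a. I +>\<^bsub>R\<^esub> a) ` polys n"
  by (auto simp: FactRing_def A_RCOSETS_def')

lemma zero_Quot: "\<zero>\<^bsub>R Quot I\<^esub> = I +>\<^bsub>R\<^esub> 0"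
  using R.a_rcos_zero[OF I.is_ideal, of 0] polys.is_idealD(2)[OF ideal_I] by (simp add: FactRing_def)

lemma quot_module_simps:
  "carrier (quot_module R I) = carrier (R Quot I)"
  "ring.zero (quot_module R I) = I +>\<^bsub>R\<^esub> 0"
  "ring.add (quot_module R I) = ring.add (R Quot I)"
  "smult (quot_module R I) a c = (I +>\<^bsub>R\<^esub> a) \<otimes>\<^bsub>R Quot I\<^esub> c"
  by (simp_all add: quot_module_def zero_Quot)

interpretation M: abelian_monoid "quot_module R I"
proof (rule abelian_monoidI)
qed (auto simp: zero_Quot quot_module_simps carrier_Quot coset_add polys.closed add_ac intro!: imageI)

lemma finsum_quot_module:
  fixes k :: nat
  assumes "\<And>i. i < k \<Longrightarrow> a i \<in> polys n" "\<And>i. i < k \<Longrightarrow> g i \<in> polys n"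
  shows "finsum (quot_module R I) (\<lambda>i. a i \<odot>\<^bsub>quot_module R I\<^esub> (I +>\<^bsub>R\<^esub> g i)) {..<k} =
    I +>\<^bsub>R\<^esub> (\<Sum>i<k. a i * g i)"
  using assms
proof (induction k)
  case 0
  then show ?case by (simp add: quot_module_simps)
next
  case (Suc k)
  have mem: "a i \<odot>\<^bsub>quot_module R I\<^esub> (I +>\<^bsub>R\<^esub> g i) = I +>\<^bsub>R\<^esub> (a i * g i)" if "i < Suc k" for i
    using that Suc.prems by (simp add: quot_module_simps coset_mult)
  have "finsum (quot_module R I) (\<lambda>i. a i \<odot>\<^bsub>quot_module R I\<^esub> (I +>\<^bsub>R\<^esub> g i)) (insert k {..<k}) =
     (a k \<odot>\<^bsub>quot_module R I\<^esub> (I +>\<^bsub>R\<^esub> g k)) \<oplus>\<^bsub>quot_module R I\<^esub>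
       finsum (quot_module R I) (\<lambda>i. a i \<odot>\<^bsub>quot_module R I\<^esub> (I +>\<^bsub>R\<^esub> g i)) {..<k}"
    using Suc.prems
    by (intro M.finsum_insert)
       (auto simp: mem quot_module_simps(1) carrier_Quot intro!: imageI polys.closed)
  also have "\<dots> = I +>\<^bsub>R\<^esub> (\<Sum>i<Suc k. a i * g i)"
  proof -
    have "(\<Sum>i<k. a i * g i) \<in> polys n" "a k * g k \<in> polys n"
      using Suc.prems by (auto intro!: polys.closed)
    then show ?thesis
      using Suc mem[of k] by (simp add: quot_module_simps(3) coset_add add.commute)
  qed
  finally show ?case by (simp add: lessThan_Suc)
qed

text \<open>
  The submodule generated by a sequence is defined by finite sums, while regular sequences are handled
  by adjoining one element at a time; this connects the two.
\<close>

lemma foldl_adjoin_eq: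
  fixes as :: "'k mpoly list"
  assumes "set as \<subseteq> polys n"
  shows "foldl (polys.adjoin n) I as =
    {y + (\<Sum>i<length as. as ! i * g i) |y g. y \<in> I \<and> (\<forall>i<length as. g i \<in> polys n)}"
  using assms
proof (induction as rule: rev_induct)
  case (snoc a as)
  let ?S = "\<lambda>as::'k mpoly list. {y + (\<Sum>i<length as. as ! i * g i) |y g. y \<in> I \<and> (\<forall>i<length as. g i \<in> polys n)}"
  have sum_eq: "(\<Sum>i<length (as @ [a]). (as @ [a]) ! i * g i) =
      (\<Sum>i<length as. as ! i * g i) + a * g (length as)" for g :: "nat \<Rightarrow> 'k mpoly"
    by (auto simp: nth_append intro!: sum.cong)
  have "polys.adjoin n (?S as) a = ?S (as @ [a])"
  proof (intro equalityI subsetI)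
    fix x assume "x \<in> polys.adjoin n (?S as) a"
    then obtain y g u where x: "x = y + (\<Sum>i<length as. as ! i * g i) + a * u"
      "y \<in> I" "\<And>i. i < length as \<Longrightarrow> g i \<in> polys n" "u \<in> polys n"
      by (auto simp: polys.adjoin_def)
    have "x = y + (\<Sum>i<length (as @ [a]). (as @ [a]) ! i * (g(length as := u)) i)"
      unfolding sum_eq x(1) by (simp add: add.assoc)
    then show "x \<in> ?S (as @ [a])"
      using x(2-) by (intro CollectI exI[of _ y] exI[of _ "g(length as := u)"]) auto
  next
    fix x assume "x \<in> ?S (as @ [a])"
    then obtain y g where x: "x = y + (\<Sum>i<length (as @ [a]). (as @ [a]) ! i * g i)"
      "y \<in> I" "\<forall>i<length (as @ [a]). g i \<in> polys n"
      by blast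
    then have "x = (y + (\<Sum>i<length as. as ! i * g i)) + a * g (length as)"
      by (simp only: sum_eq add.assoc)
    moreover have "y + (\<Sum>i<length as. as ! i * g i) \<in> ?S as"
      using x(2,3) by (intro CollectI exI[of _ y] exI[of _ g]) auto
    ultimately show "x \<in> polys.adjoin n (?S as) a"
      using x(3) by (auto intro: polys.adjoinI)
  qed
  then show ?case using snoc by simp
qed simp

lemma seq_submodule_quot_module:
  assumes as: "set as \<subseteq> polys n"
  shows "seq_submodule as (quot_module R I) = (\<lambda>x. I +>\<^bsub>R\<^esub> x) ` foldl (polys.adjoin n) I as"
proof (intro equalityI subsetI)
  fix c assume "c \<in> seq_submodule as (quot_module R I)"
  then obtain f where c: "c = finsum (quot_module R I) (\<lambda>i. (as ! i) \<odot>\<^bsub>quot_module R I\<^esub> f i) {..<length as}"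
    and f: "\<forall>i<length as. f i \<in> carrier (quot_module R I)"
    unfolding seq_submodule_def by blast
  then have "\<forall>i<length as. \<exists>g. g \<in> polys n \<and> f i = I +>\<^bsub>R\<^esub> g"
    by (auto simp: quot_module_simps carrier_Quot)
  then obtain g where g: "\<And>i. i < length as \<Longrightarrow> g i \<in> polys n \<and> f i = I +>\<^bsub>R\<^esub> g i" by metis
  have asi: "as ! i \<in> polys n" if "i < length as" for i using as that by auto
  have "c = finsum (quot_module R I) (\<lambda>i. (as ! i) \<odot>\<^bsub>quot_module R I\<^esub> (I +>\<^bsub>R\<^esub> g i)) {..<length as}"
    unfolding c
    by (intro M.finsum_cong')
       (auto simp: g quot_module_simps(1,4) coset_mult carrier_Quot asi polys.closed intro!: imageI)
  also have "\<dots> = I +>\<^bsub>R\<^esub> (\<Sum>i<length as. as ! i * g i)"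
    using g asi by (intro finsum_quot_module) auto
  finally have "c = I +>\<^bsub>R\<^esub> (0 + (\<Sum>i<length as. as ! i * g i))" by simp
  moreover have "0 + (\<Sum>i<length as. as ! i * g i) \<in> foldl (polys.adjoin n) I as"
    unfolding foldl_adjoin_eq[OF as] using g polys.is_idealD(2)[OF ideal_I] by blast
  ultimately show "c \<in> (\<lambda>x. I +>\<^bsub>R\<^esub> x) ` foldl (polys.adjoin n) I as" by blast
next
  fix c assume "c \<in> (\<lambda>x. I +>\<^bsub>R\<^esub> x) ` foldl (polys.adjoin n) I as"
  then obtain y g where c: "c = I +>\<^bsub>R\<^esub> (y + (\<Sum>i<length as. as ! i * g i))"
    and y: "y \<in> I" and g: "\<forall>i<length as. g i \<in> polys n"
    unfolding foldl_adjoin_eq[OF as] by blast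
  have asi: "as ! i \<in> polys n" if "i < length as" for i using as that by auto
  have "c = I +>\<^bsub>R\<^esub> (\<Sum>i<length as. as ! i * g i)"
    unfolding c using y polys.is_idealD(1)[OF ideal_I y] g asi
    by (subst coset_eq_iff) (auto intro!: polys.closed)
  also have "\<dots> = finsum (quot_module R I) (\<lambda>i. (as ! i) \<odot>\<^bsub>quot_module R I\<^esub> (I +>\<^bsub>R\<^esub> g i)) {..<length as}"
    using g asi by (intro finsum_quot_module[symmetric]) auto
  finally show "c \<in> seq_submodule as (quot_module R I)"
    unfolding seq_submodule_def using g
    by (intro CollectI exI[of _ "\<lambda>i. I +>\<^bsub>R\<^esub> g i"]) (auto simp: quot_module_simps carrier_Quot)
qed

lemma mem_seq_submodule_iff:
  assumes as: "set as \<subseteq> polys n" and x: "x \<in> polys n"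
  shows "I +>\<^bsub>R\<^esub> x \<in> seq_submodule as (quot_module R I) \<longleftrightarrow> x \<in> foldl (polys.adjoin n) I as"
proof
  note J = polys.is_ideal_foldl_adjoin[OF ideal_I as]
  assume "I +>\<^bsub>R\<^esub> x \<in> seq_submodule as (quot_module R I)"
  then obtain y where y: "y \<in> foldl (polys.adjoin n) I as" "I +>\<^bsub>R\<^esub> x = I +>\<^bsub>R\<^esub> y"
    by (auto simp: seq_submodule_quot_module[OF as])
  then have "x - y \<in> I" using coset_eq_iff x polys.is_idealD(1)[OF J] by blast
  moreover have "I \<subseteq> foldl (polys.adjoin n) I as" by (rule polys.subset_foldl_adjoin)
  ultimately have "x - y \<in> foldl (polys.adjoin n) I as" by blast
  then show "x \<in> foldl (polys.adjoin n) I as"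
    using polys.is_idealD(3)[OF J _ y(1)] by fastforce
qed (auto simp: seq_submodule_quot_module[OF as])

lemma regular_sequence_quot_module_iff:
  "regular_sequence R (quot_module R I) as \<longleftrightarrow>
     set as \<subseteq> polys n \<and> polys.weakly_regular n I as \<and> foldl (polys.adjoin n) I as \<noteq> polys n"
proof (cases "set as \<subseteq> polys n")
  case True
  have sub: "set (take i as) \<subseteq> polys n" for i using True set_take_subset[of i as] by blast
  have "(\<forall>x\<in>carrier (quot_module R I).
        (as ! i) \<odot>\<^bsub>quot_module R I\<^esub> x \<in> seq_submodule (take i as) (quot_module R I)
         \<longrightarrow> x \<in> seq_submodule (take i as) (quot_module R I)) \<longleftrightarrow>
      polys.nonzerodivisor_mod n (as ! i) (foldl (polys.adjoin n) I (take i as))"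
    if "i < length as" for i
  proof -
    have "as ! i \<in> polys n" using that True by auto
    then show ?thesis
      by (simp add: quot_module_simps carrier_Quot coset_mult mem_seq_submodule_iff sub
          polys.closed polys.nonzerodivisor_mod_def)
  qed
  moreover have "seq_submodule as (quot_module R I) = carrier (quot_module R I) \<longleftrightarrow>
      foldl (polys.adjoin n) I as = polys n"
  proof
    assume eq: "seq_submodule as (quot_module R I) = carrier (quot_module R I)"
    have "x \<in> foldl (polys.adjoin n) I as" if "x \<in> polys n" for x
      using mem_seq_submodule_iff[OF True that] that eq by (simp add: quot_module_simps carrier_Quot)
    then show "foldl (polys.adjoin n) I as = polys n"
      using polys.is_idealD(1)[OF polys.is_ideal_foldl_adjoin[OF ideal_I True]] by blast
  qed (simp add: seq_submodule_quot_module[OF True] quot_module_simps carrier_Quot)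
  ultimately show ?thesis
    using True by (simp add: regular_sequence_def polys.weakly_regular_def)
qed (simp add: regular_sequence_def)

end

lemma foldl_adjoin_subset:
  assumes "polys.is_ideal n J" "I \<subseteq> J" "set as \<subseteq> J"
  shows "foldl (polys.adjoin n) I as \<subseteq> J"
  using assms(2,3)
proof (induction as arbitrary: I)
  case (Cons a as)
  have "polys.adjoin n I a \<subseteq> J"
    using Cons.prems polys.is_idealD[OF assms(1)] by (auto elim!: polys.adjoinE)
  then show ?case using Cons by simp
qed simp

lemma mem_foldl_adjoin:
  assumes "polys.is_ideal n I" "set as \<subseteq> polys n" "a \<in> set as"
  shows "a \<in> foldl (polys.adjoin n) I as"
  using assms(2,3)
proof (induction as rule: rev_induct)
  case (snoc b as)
  have J: "polys.is_ideal n (foldl (polys.adjoin n) I as)"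
    using snoc.prems by (intro polys.is_ideal_foldl_adjoin[OF assms(1)]) auto
  show ?case
    using snoc polys.mem_adjoin[OF J, of b] polys.subset_adjoin[of "foldl (polys.adjoin n) I as" n b]
    by auto
qed simp

lemma one_notin_vars_prime: "1 \<notin> (vars_prime n A :: 'k::field mpoly set)"
  by (auto simp: vars_prime_def)

text \<open>
  Sequences in \<open>\<mm>\<close> generate together with \<open>I\<close> an ideal inside \<open>\<mm>\<close>, so the quotient by the
  whole sequence is nonzero, and only the nonzerodivisor conditions remain.
\<close>

lemma depth_quot_module:
  fixes I :: "'k::field mpoly set"
  assumes I: "polys.is_ideal n I" and sub: "I \<subseteq> vars_prime n {1..n}"
  shows "depth (mpoly_ring n) (vars_prime n {1..n}) (quot_module (mpoly_ring n) I) =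
    Sup {enat (length as) |as. set as \<subseteq> vars_prime n {1..n} \<and> polys.weakly_regular n I as}"
proof -
  have "regular_sequence (mpoly_ring n) (quot_module (mpoly_ring n) I) as \<longleftrightarrow> polys.weakly_regular n I as"
    if as: "set as \<subseteq> vars_prime n {1..n}" for as
  proof -
    have "foldl (polys.adjoin n) I as \<subseteq> vars_prime n {1..n}"
      by (rule foldl_adjoin_subset[OF is_ideal_vars_prime sub as])
    then have "1 \<notin> foldl (polys.adjoin n) I as" using one_notin_vars_prime by blast
    then have "foldl (polys.adjoin n) I as \<noteq> polys n" using polys.one_closed by blast
    moreover have "set as \<subseteq> polys n" using as by (auto simp: vars_prime_def)
    ultimately show ?thesis by (simp add: regular_sequence_quot_module_iff[OF I])
  qed
  then have "{enat (length as) |as. set as \<subseteq> vars_prime n {1..n} \<and>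
       regular_sequence (mpoly_ring n) (quot_module (mpoly_ring n) I) as} =
    {enat (length as) |as. set as \<subseteq> vars_prime n {1..n} \<and> polys.weakly_regular n I as}"
    by blast
  then show ?thesis by (simp add: depth_def)
qed

lemma vars_prime_subset_iff:
  assumes "A \<subseteq> {1..n}"
  shows "vars_prime n A \<subseteq> (vars_prime n B :: 'k::field mpoly set) \<longleftrightarrow> A \<subseteq> B"
proof
  assume sub: "vars_prime n A \<subseteq> (vars_prime n B :: 'k mpoly set)"
  show "A \<subseteq> B"
  proof
    fix i assume "i \<in> A"
    then have "(var i :: 'k mpoly) \<in> vars_prime n A"
      using assms var_mem_polys[of i n] by (auto simp: vars_prime_def var_def)
    then have "(var i :: 'k mpoly) \<in> vars_prime n B" using sub by blast
    then show "i \<in> B" by (auto simp: vars_prime_def var_def)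
  qed
qed (auto simp: vars_prime_def)

lemma vars_prime_eq_iff:
  assumes "A \<subseteq> {1..n}" "B \<subseteq> {1..n}"
  shows "vars_prime n A = (vars_prime n B :: 'k::field mpoly set) \<longleftrightarrow> A = B"
  using vars_prime_subset_iff[OF assms(1), of B] vars_prime_subset_iff[OF assms(2), of A] by blast

text \<open>
  Distributivity for monomial ideals: of an element of the right-hand side, the monomials that
  involve \<open>B\<close> lie in the second summand, and all others must involve every \<open>A i\<close>.
\<close>

lemma ideal_plus_Inter_vars_prime:
  fixes A :: "'i \<Rightarrow> nat set"
  assumes "T \<noteq> {}"
  shows "polys.ideal_plus (\<Inter>i\<in>T. vars_prime n (A i)) (vars_prime n B) =
    ((\<Inter>i\<in>T. vars_prime n (A i \<union> B)) :: 'k::field mpoly set)"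
proof (intro equalityI subsetI)
  fix x :: "'k mpoly" assume "x \<in> polys.ideal_plus (\<Inter>i\<in>T. vars_prime n (A i)) (vars_prime n B)"
  then obtain f g where x: "x = f + g" "\<And>i. i \<in> T \<Longrightarrow> f \<in> vars_prime n (A i)" "g \<in> vars_prime n B"
    unfolding polys.ideal_plus_def by auto
  show "x \<in> (\<Inter>i\<in>T. vars_prime n (A i \<union> B))"
  proof
    fix i assume "i \<in> T"
    then have "f \<in> vars_prime n (A i \<union> B)" "g \<in> vars_prime n (A i \<union> B)"
      using x(2)[of i] x(3) by (auto simp: vars_prime_def)
    then show "x \<in> vars_prime n (A i \<union> B)"
      unfolding x(1) by (rule polys.is_idealD(3)[OF is_ideal_vars_prime])
  qed
next
  fix x :: "'k mpoly" assume x: "x \<in> (\<Inter>i\<in>T. vars_prime n (A i \<union> B))"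
  let ?b = "\<lambda>m. keys m \<inter> B \<noteq> {}"
  let ?g = "\<Sum>m\<in>{m\<in>keys x. ?b m}. single m (lookup x m)"
  let ?f = "\<Sum>m\<in>{m\<in>keys x. \<not> ?b m}. single m (lookup x m)"
  have xC: "x \<in> polys n" using x assms by (auto simp: vars_prime_def)
  have "keys x = {m\<in>keys x. \<not> ?b m} \<union> {m\<in>keys x. ?b m}" by auto
  then have "x = (\<Sum>m\<in>{m\<in>keys x. \<not> ?b m} \<union> {m\<in>keys x. ?b m}.
      single m (lookup x m))"
    using sum_monomials[of "keys x" x] by simp
  also have "\<dots> = ?f + ?g" by (intro sum.union_disjoint) auto
  finally have "x = ?f + ?g" .
  moreover have "?g \<in> vars_prime n B"
    using xC by (intro polys.is_ideal_sum[OF is_ideal_vars_prime])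
      (auto simp: vars_prime_def mem_polys_iff)
  moreover have "?f \<in> vars_prime n (A i)" if "i \<in> T" for i
  proof (rule polys.is_ideal_sum[OF is_ideal_vars_prime])
    fix m assume m: "m \<in> {m\<in>keys x. \<not> ?b m}"
    have "x \<in> vars_prime n (A i \<union> B)" using x that by blast
    then have "keys m \<inter> (A i \<union> B) \<noteq> {}" "keys m \<subseteq> {1..n}"
      using m by (auto simp: vars_prime_def mem_polys_iff)
    then show "single m (lookup x m) \<in> vars_prime n (A i)"
      using m by (auto simp: vars_prime_def mem_polys_iff)
  qed
  ultimately show "x \<in> polys.ideal_plus (\<Inter>i\<in>T. vars_prime n (A i)) (vars_prime n B)"
    unfolding polys.ideal_plus_def by blast
qed

lemma ideal_plus_vars_prime:
  "polys.ideal_plus (vars_prime n A) (vars_prime n B) = (vars_prime n (A \<union> B) :: 'k::field mpoly set)"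
  using ideal_plus_Inter_vars_prime[of "{()}" n "\<lambda>_. A" B] by simp

lemma set_add_eq_ideal_plus: "J <+>\<^bsub>mpoly_ring n\<^esub> L = polys.ideal_plus J L"
  by (auto simp: set_add_defs polys.ideal_plus_def)

lemma ideal_sum_subset:
  assumes "finite T" "\<And>i. i \<in> T \<Longrightarrow> A i \<subseteq> {1..n}"
  shows "ideal_sum (mpoly_ring n) (\<lambda>i. vars_prime n (A i)) T \<subseteq> (vars_prime n (\<Union>i\<in>T. A i) :: 'k::field mpoly set)"
proof
  interpret R: cring "mpoly_ring n :: 'k mpoly ring" by (rule cring_mpoly_ring)
  have finsum_eq: "finsum (mpoly_ring n) f T = sum f T" if "\<And>i. i \<in> T \<Longrightarrow> f i \<in> polys n"
    for f :: "'a \<Rightarrow> 'k mpoly"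
    using assms(1) that
  proof (induction T rule: finite_induct)
    case (insert x F)
    then show ?case using R.finsum_insert[of F x f] by auto
  qed simp
  fix x :: "'k mpoly" assume "x \<in> ideal_sum (mpoly_ring n) (\<lambda>i. vars_prime n (A i)) T"
  then obtain f where x: "x = finsum (mpoly_ring n) f T" and f: "\<And>i. i \<in> T \<Longrightarrow> f i \<in> vars_prime n (A i)"
    by (auto simp: ideal_sum_def)
  have "x = sum f T" unfolding x using f by (intro finsum_eq) (auto simp: vars_prime_def)
  moreover have "f i \<in> vars_prime n (\<Union>i\<in>T. A i)" if "i \<in> T" for i
    using f[OF that] that by (auto simp: vars_prime_def)
  ultimately show "x \<in> vars_prime n (\<Union>i\<in>T. A i)"
    by (auto intro: polys.is_ideal_sum[OF is_ideal_vars_prime])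
qed

text \<open>
  Setting variables to zero is a retraction of the polynomial ring with kernel the monomial prime.
  This gives both primality and representatives free of the variables in \<open>A\<close>.
\<close>

definition restrict_vars :: "nat set \<Rightarrow> 'k::field mpoly \<Rightarrow> 'k mpoly" where
  "restrict_vars A = subst (\<lambda>i. if i \<in> A then 0 else var i)"

lemma restrict_vars_eq_0:
  assumes "f \<in> vars_prime n A"
  shows "restrict_vars A f = 0"
proof -
  have "eval_monomial (\<lambda>i. if i \<in> A then 0 else (var i :: 'a mpoly)) m = 0"
    if "m \<in> keys f" for m
    using assms that by (auto simp: eval_monomial_def vars_prime_def in_keys_iff prod_zero_iff)
  then show ?thesis by (simp add: restrict_vars_def subst_def)
qed

lemma diff_restrict_vars_mem:
  assumes "f \<in> polys n"
  shows "f - restrict_vars A f \<in> vars_prime n A"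
  unfolding restrict_vars_def
proof (rule diff_subst_mem[OF is_ideal_vars_prime _ _ assms])
  fix i assume i: "i \<in> {1..n}"
  show "(if i \<in> A then 0 else var i) \<in> polys n"
    using var_mem_polys[OF i] by (auto intro: polys.closed)
  show "var i - (if i \<in> A then 0 else var i) \<in> vars_prime n A"
    using var_mem_polys[OF i]  polys.is_idealD(2)[OF is_ideal_vars_prime]
    by (auto simp: vars_prime_def var_def)
qed

lemma mem_vars_prime_iff:
  assumes "f \<in> polys n"
  shows "f \<in> vars_prime n A \<longleftrightarrow> restrict_vars A f = 0"
  using restrict_vars_eq_0 diff_restrict_vars_mem[OF assms, of A] by (metis diff_zero)

lemma vars_prime_mult_mem:
  assumes "f \<in> polys n" "g \<in> polys n" "f * g \<in> vars_prime n A"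
  shows "f \<in> vars_prime n A \<or> g \<in> vars_prime n A"
proof -
  have "restrict_vars A f * restrict_vars A g = 0"
    using restrict_vars_eq_0[OF assms(3)] by (simp add: restrict_vars_def subst_mult)
  then show ?thesis using assms(1,2) by (simp add: mem_vars_prime_iff)
qed

lemma restrict_vars_closed:
  fixes f :: "'k::field mpoly"
  assumes "f \<in> polys n"
  shows "restrict_vars A f \<in> polys n"
  unfolding restrict_vars_def
proof (rule subst_closed)
  fix i assume "i \<in> {1..n}"
  then have "(var i :: 'k mpoly) \<in> polys n" by (rule var_mem_polys)
  then show "(if i \<in> A then 0 else var i) \<in> (polys n :: 'k mpoly set)"
    by (simp add: polys.zero_closed)
qed (rule assms)

lemma keys_restrict_vars:
  fixes f :: "'k::field mpoly"
  assumes "m \<in> keys (restrict_vars A f)"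
  shows "keys m \<inter> A = {}"
proof -
  let ?\<sigma> = "\<lambda>i. if i \<in> A then 0 else (var i :: 'k mpoly)"
  have "single 0 (lookup f k) * eval_monomial ?\<sigma> k =
      (if keys k \<inter> A = {} then single k (lookup f k) else 0)" for k
  proof (cases "keys k \<inter> A = {}")
    case True
    then have "eval_monomial ?\<sigma> k = eval_monomial var k"
      unfolding eval_monomial_def by (intro prod.cong) auto
    then show ?thesis using True by (simp flip: single_eq_eval_monomial)
  next
    case False
    then have "eval_monomial ?\<sigma> k = 0" by (auto simp: eval_monomial_def in_keys_iff prod_zero_iff)
    then show ?thesis using False by simp
  qed
  then have "restrict_vars A f = (\<Sum>k\<in>keys f.
      if keys k \<inter> A = {} then single k (lookup f k) else 0)"
    by (simp add: restrict_vars_def subst_def)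
  then have "(\<Sum>k\<in>keys f. lookup
      (if keys k \<inter> A = {} then single k (lookup f k) else 0) m) \<noteq> 0"
    using assms by (simp add: in_keys_iff lookup_sum)
  then obtain k where "lookup
      (if keys k \<inter> A = {} then single k (lookup f k) else 0) m \<noteq> 0"
    by (meson sum.not_neutral_contains_not_neutral)
  then show ?thesis by (auto simp: lookup_single when_def split: if_splits)
qed

section \<open>Krull dimension of a quotient by a monomial prime\<close>

lemma (in vector_space) ex_nontrivial_relation:
  assumes E: "finite E" and S: "finite S" "card S < card E" and span: "\<And>e. e \<in> E \<Longrightarrow> v e \<in> span S"
  obtains c where "\<exists>e\<in>E. c e \<noteq> 0" "(\<Sum>e\<in>E. c e *s v e) = 0"
proof (cases "inj_on v E")
  case True
  have "dependent (v ` E)"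
  proof (rule ccontr)
    assume "independent (v ` E)"
    then have "card (v ` E) \<le> card S"
      using independent_span_bound[of S "v ` E"] S span by auto
    then show False using S card_image[OF True] by simp
  qed
  then obtain u where u: "\<exists>x\<in>v ` E. u x \<noteq> 0" "(\<Sum>x\<in>v ` E. u x *s x) = 0"
    using E by (auto simp: dependent_finite)
  show ?thesis
    using u by (intro that[of "u \<circ> v"]) (auto simp: sum.reindex[OF True])
next
  case False
  then obtain a b where ab: "a \<in> E" "b \<in> E" "a \<noteq> b" "v a = v b" by (auto simp: inj_on_def)
  define c where "c e = (if e = a then 1 else if e = b then - 1 else 0 :: 'a)" for e
  have "(\<Sum>e\<in>E. c e *s v e) = (\<Sum>e\<in>{a, b}. c e *s v e)"
    using E ab by (intro sum.mono_neutral_right) (auto simp: c_def)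
  also have "\<dots> = 0" using ab by (simp add: c_def)
  finally show ?thesis using ab by (intro that[of c]) (auto simp: c_def)
qed

definition exponents_le :: "nat set \<Rightarrow> nat \<Rightarrow> (nat \<Rightarrow>\<^sub>0 nat) set" where
  "exponents_le B d = {m. keys m \<subseteq> B \<and> (\<forall>i. lookup m i \<le> d)}"

lemma finite_exponents_le:
  assumes "finite B"
  shows "finite (exponents_le B d)" and "card (exponents_le B d) \<le> (d + 1) ^ card B"
proof -
  let ?f = "\<lambda>m. restrict (lookup m) B"
  have inj: "inj_on ?f (exponents_le B d)"
  proof
    fix m m' assume m: "m \<in> exponents_le B d" "m' \<in> exponents_le B d" "?f m = ?f m'"
    show "m = m'"
    proof (rule poly_mapping_eqI)
      fix i show "lookup m i = lookup m' i"
      proof (cases "i \<in> B")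
        case True then show ?thesis using fun_cong[OF m(3), of i] by simp
      next
        case False
        then have "i \<notin> keys m" "i \<notin> keys m'"
          using m by (auto simp: exponents_le_def)
        then show ?thesis by (simp add: in_keys_iff)
      qed
    qed
  qed
  have img: "?f ` exponents_le B d \<subseteq> PiE B (\<lambda>_. {0..d})"
    by (auto simp: exponents_le_def)
  have fin: "finite (PiE B (\<lambda>_. {0..d}))" using assms by (intro finite_PiE) auto
  show "finite (exponents_le B d)" by (rule inj_on_finite[OF inj img fin])
  show "card (exponents_le B d) \<le> (d + 1) ^ card B"
    using card_inj_on_le[OF inj img fin] assms by (simp add: card_PiE)
qed

lemma exponents_le_mult:
  assumes "keys f \<subseteq> exponents_le B d" "keys g \<subseteq> exponents_le B e"
  shows "keys (f * g) \<subseteq> exponents_le B (d + e)"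
proof
  fix m assume "m \<in> keys (f * g)"
  then obtain a b where "m = a + b" "a \<in> keys f" "b \<in> keys g"
    by (elim keys_multE)
  then show "m \<in> exponents_le B (d + e)"
    using assms by (auto simp: exponents_le_def keys_add_nat lookup_add subset_iff intro!: add_mono)
qed

lemma exponents_le_power:
  "keys f \<subseteq> exponents_le B d \<Longrightarrow> keys (f ^ k) \<subseteq> exponents_le B (k * d)"
proof (induction k)
  case 0 then show ?case by (auto simp: exponents_le_def)
next
  case (Suc k) then show ?case using exponents_le_mult[of f B d "f ^ k" "k * d"] by simp
qed

lemma exponents_le_prod:
  "(\<And>i. i \<in> A \<Longrightarrow> keys (f i) \<subseteq> exponents_le B (d i)) \<Longrightarrow>
    keys (prod f A) \<subseteq> exponents_le B (sum d A)"
proof (induction A rule: infinite_finite_induct)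
  case (insert x A) then show ?case using exponents_le_mult[of "f x" B "d x" "prod f A" "sum d A"] by simp
qed (auto simp: exponents_le_def)

lemma exponents_le_mono: "d \<le> e \<Longrightarrow> exponents_le B d \<subseteq> exponents_le B e"
  by (auto simp: exponents_le_def intro: order_trans)

text \<open>
  Monomials in \<open>x\<^sub>0, \<dots>, x\<^bsub>l-1\<^esub>\<close> with exponents at most \<open>N\<close> are \<open>(N + 1)\<^sup>l\<close> many, but they lie in the span of
  the monomials in \<open>B\<close> with exponents at most \<open>l N D\<close>, where \<open>D\<close> bounds the exponents in the \<open>x\<^sub>i\<close>. The
  number of the latter grows only with the power \<open>|B| < l\<close> of \<open>N\<close>.
\<close>

lemma ex_algebraic_relation:
  fixes x :: "nat \<Rightarrow> 'k::field mpoly"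
  assumes B: "finite B" and l: "card B < l"
    and x: "\<And>i. i < l \<Longrightarrow> \<forall>m\<in>keys (x i). keys m \<subseteq> B"
  obtains E c where "finite E" "E \<noteq> {}" "inj_on (\<lambda>a. restrict a {0..<l}) E" "\<And>a. a \<in> E \<Longrightarrow> c a \<noteq> 0"
    "(\<Sum>a\<in>E. single 0 (c a) * (\<Prod>i\<in>{0..<l}. x i ^ a i)) = 0"
proof -
  have "\<exists>D. \<forall>i<l. keys (x i) \<subseteq> exponents_le B D"
  proof -
    let ?S = "\<Union>i\<in>{0..<l}. \<Union>m\<in>keys (x i). Poly_Mapping.range m"
    have "finite ?S" by auto
    then obtain D where D: "\<And>k. k \<in> ?S \<Longrightarrow> k \<le> D"
      using finite_nat_set_iff_bounded_le by metis
    have le: "lookup m j \<le> D" if "i < l" "m \<in> keys (x i)" for i m j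
    proof (cases "j \<in> keys m")
      case True
      then have "lookup m j \<in> ?S"
        using that by (intro UN_I[of i] UN_I[of m] in_keys_lookup_in_range) auto
      then show ?thesis by (rule D)
    qed (simp add: in_keys_iff)
    show ?thesis
    proof (intro exI[of _ D] allI impI subsetI)
      fix i m assume "i < l" "m \<in> keys (x i)"
      then show "m \<in> exponents_le B D" using x le by (simp add: exponents_le_def)
    qed
  qed
  then obtain D where D: "\<And>i. i < l \<Longrightarrow> keys (x i) \<subseteq> exponents_le B D" by blast
  \<comment> \<open>Chosen such that \<open>(l N D + 1)\<^bsup>|B|\<^esup> \<le> (N + 1)\<^bsup>|B|\<^esup> (l D + 1)\<^bsup>|B|\<^esup> < (N + 1)\<^bsup>|B| + 1\<^esup>\<close>.\<close>
  define N where "N = (l * D + 1) ^ card B"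
  define M where "M = exponents_le B (l * (N * D))"
  define F where "F = PiE {0..<l} (\<lambda>_. {0..N})"
  define v where "v a = (\<Prod>i\<in>{0..<l}. x i ^ a i)" for a
  interpret vector_space "\<lambda>(c::'k) (f :: 'k mpoly). single 0 c * f"
    by unfold_locales (auto simp: algebra_simps single_add mult_single)
  have finF: "finite F" unfolding F_def by (intro finite_PiE) auto
  have "card M \<le> (l * (N * D) + 1) ^ card B"
    unfolding M_def by (rule finite_exponents_le(2)[OF B])
  also have "\<dots> \<le> ((N + 1) * (l * D + 1)) ^ card B"
    by (intro power_mono) (auto simp: algebra_simps)
  also have "\<dots> = (N + 1) ^ card B * N" by (simp only: power_mult_distrib N_def[symmetric])
  also have "\<dots> < (N + 1) ^ card B * (N + 1)" by simp
  also have "\<dots> = (N + 1) ^ Suc (card B)" by simp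
  also have "\<dots> \<le> (N + 1) ^ l" using l by (intro power_increasing) auto
  also have "\<dots> = card F" by (simp add: F_def card_PiE)
  finally have card: "card M < card F" .
  have finM: "finite M" unfolding M_def by (rule finite_exponents_le(1)[OF B])
  have card': "card ((\<lambda>m. single m (1::'k)) ` M) < card F"
    using card card_image_le[OF finM] by (rule le_less_trans[rotated])
  have sp: "v a \<in> span ((\<lambda>m. single m (1::'k)) ` M)" if a: "a \<in> F" for a
  proof -
    have "keys (v a) \<subseteq> exponents_le B (\<Sum>i\<in>{0..<l}. a i * D)"
      unfolding v_def using D by (intro exponents_le_prod exponents_le_power) auto
    moreover have "(\<Sum>i\<in>{0..<l}. a i * D) \<le> (\<Sum>i\<in>{0..<l}. N * D)"
      using a by (intro sum_mono mult_right_mono) (auto simp: F_def PiE_iff)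
    then have "(\<Sum>i\<in>{0..<l}. a i * D) \<le> l * (N * D)" by simp
    ultimately have "keys (v a) \<subseteq> M"
      unfolding M_def using exponents_le_mono by blast
    then have "v a = (\<Sum>m\<in>M. single m (lookup (v a) m))"
      by (rule sum_monomials[OF finM])
    also have "\<dots> = (\<Sum>m\<in>M. single 0 (lookup (v a) m) * single m 1)"
      by (simp add: mult_single)
    also have "\<dots> \<in> span ((\<lambda>m. single m (1::'k)) ` M)"
      by (intro span_sum span_scale span_base) auto
    finally show ?thesis .
  qed
  obtain c where c: "\<exists>e\<in>F. c e \<noteq> 0" "(\<Sum>e\<in>F. single 0 (c e) * v e) = 0"
    by (rule ex_nontrivial_relation[OF finF finite_imageI[OF finM] card']) (erule sp, rule that)
  show thesis
  proof (rule that[of "{a\<in>F. c a \<noteq> 0}" c])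
    show "inj_on (\<lambda>a. restrict a {0..<l}) {a \<in> F. c a \<noteq> 0}"
      by (auto simp: F_def inj_on_def PiE_restrict)
    have "(\<Sum>a\<in>{a\<in>F. c a \<noteq> 0}. single 0 (c a) * v a) = (\<Sum>e\<in>F. single 0 (c e) * v e)"
      using finF by (intro sum.mono_neutral_left) auto
    then show "(\<Sum>a\<in>{a\<in>F. c a \<noteq> 0}. single 0 (c a) * (\<Prod>i\<in>{0..<l}. x i ^ a i)) = 0"
      using c(2) by (simp add: v_def)
  qed (use finF c in auto)
qed

lemma const_mem_polys: "single 0 c \<in> polys n"
  by (rule single_mem_polys) simp

definition is_prime :: "nat \<Rightarrow> 'k::field mpoly set \<Rightarrow> bool" where
  "is_prime n Q \<longleftrightarrow> polys.is_ideal n Q \<and> 1 \<notin> Q \<and>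
     (\<forall>f\<in>polys n. \<forall>g\<in>polys n. f * g \<in> Q \<longrightarrow> f \<in> Q \<or> g \<in> Q)"

text \<open>
  Suppose a relation holds modulo \<open>P\<^sub>k\<close>. The highest power of \<open>x\<^sub>k\<close> dividing all terms can be
  cancelled, as \<open>x\<^sub>k\<close> is not in the prime \<open>P\<^sub>k\<close>. Modulo \<open>P\<^bsub>k+1\<^esub>\<close>, which contains \<open>x\<^sub>k\<close>, only the terms with the
  minimal exponent survive, and they form a nontrivial relation between the remaining elements. At the end
  of the chain this is a nonzero constant.
\<close>

lemma no_relation_along_prime_chain:
  fixes x :: "nat \<Rightarrow> 'k::field mpoly"
  assumes P: "\<And>i. i \<le> l \<Longrightarrow> is_prime n (P i)" and sub: "\<And>i. i < l \<Longrightarrow> P i \<subseteq> P (Suc i)"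
    and x: "\<And>i. i < l \<Longrightarrow> x i \<in> P (Suc i) - P i"
    and "k \<le> l" "finite E" "E \<noteq> {}" "inj_on (\<lambda>a. restrict a {k..<l}) E" "\<And>a. a \<in> E \<Longrightarrow> c a \<noteq> 0"
  shows "(\<Sum>a\<in>E. single 0 (c a) * (\<Prod>i\<in>{k..<l}. x i ^ a i)) \<notin> P k"
  using assms(4-)
proof (induction "l - k" arbitrary: k E)
  case 0
  then have k: "k = l" by simp
  have "a = b" if "a \<in> E" "b \<in> E" for a b
    using 0(5) that by (auto simp: k inj_on_def restrict_def)
  then obtain a where E: "E = {a}" using 0 by blast
  note Q = P[unfolded is_prime_def, OF order_refl]
  have "single 0 (c a) \<notin> P l"
  proof
    assume "single 0 (c a) \<in> P l"
    then have "single 0 (inverse (c a)) * single 0 (c a) \<in> P l"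
      using Q const_mem_polys by (blast intro: polys.is_idealD(4))
    moreover have "c a \<noteq> 0" using 0 E by simp
    ultimately have "1 \<in> P l" by (simp add: mult_single)
    then show False using Q by blast
  qed
  then show ?case by (simp add: E k)
next
  case (Suc d)
  then have k: "k < l" by simp
  then have split: "{k..<l} = insert k {Suc k..<l}" by auto
  note Pk = P[OF less_imp_le[OF k], unfolded is_prime_def] and Pk' = P[OF Suc_leI[OF k], unfolded is_prime_def]
  note id' = polys.is_idealD[OF conjunct1[OF Pk']]
  have xC: "x i \<in> polys n" if "i < l" for i
    using x[OF that] P[of "Suc i"] that polys.is_idealD(1)[of n "P (Suc i)" "x i"]
    by (auto simp: is_prime_def)
  define m where "m = Min ((\<lambda>a. a k) ` E)"
  have m: "m \<le> a k" if "a \<in> E" for a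
    using that Suc.prems by (auto simp: m_def)
  have "m \<in> (\<lambda>a. a k) ` E" unfolding m_def using Suc.prems by (intro Min_in) auto
  then obtain a0 where a0: "a0 \<in> E" "a0 k = m" by auto
  define y where "y a = single 0 (c a) * (\<Prod>i\<in>{Suc k..<l}. x i ^ a i)" for a
  have yC: "y a \<in> polys n" for a
    unfolding y_def using xC by (intro polys.closed const_mem_polys) auto
  define E0 where "E0 = {a\<in>E. a k = m}"
  show ?case
  proof
    assume "(\<Sum>a\<in>E. single 0 (c a) * (\<Prod>i\<in>{k..<l}. x i ^ a i)) \<in> P k"
    also have "(\<Sum>a\<in>E. single 0 (c a) * (\<Prod>i\<in>{k..<l}. x i ^ a i)) =
        (\<Sum>a\<in>E. x k ^ m * (x k ^ (a k - m) * y a))"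
    proof (intro sum.cong refl)
      fix a assume "a \<in> E"
      then have "x k ^ a k = x k ^ m * x k ^ (a k - m)"
        using m by (simp flip: power_add)
      then show "single 0 (c a) * (\<Prod>i\<in>{k..<l}. x i ^ a i) = x k ^ m * (x k ^ (a k - m) * y a)"
        unfolding split y_def by (simp add: mult_ac)
    qed
    also have "\<dots> = x k ^ m * (\<Sum>a\<in>E. x k ^ (a k - m) * y a)"
      by (simp add: sum_distrib_left)
    finally have "x k ^ m * (\<Sum>a\<in>E. x k ^ (a k - m) * y a) \<in> P k" .
    moreover have "f \<in> P k" if "x k ^ j * f \<in> P k" "f \<in> polys n" for f j
      using that
    proof (induction j)
      case (Suc j)
      have "x k * (x k ^ j * f) \<in> P k" using Suc.prems by (simp add: mult.assoc)
      moreover have "x k ^ j * f \<in> polys n" using Suc.prems xC[OF k] by (intro polys.closed)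
      ultimately have "x k ^ j * f \<in> P k" using Pk x[OF k] xC[OF k] by blast
      then show ?case using Suc by blast
    qed simp
    moreover have "(\<Sum>a\<in>E. x k ^ (a k - m) * y a) \<in> polys n"
      using yC xC[OF k] by (intro polys.closed)
    ultimately have "(\<Sum>a\<in>E. x k ^ (a k - m) * y a) \<in> P k" by blast
    then have 1: "(\<Sum>a\<in>E. x k ^ (a k - m) * y a) \<in> P (Suc k)" using sub[OF k] by blast
    have "E0 \<subseteq> E" by (auto simp: E0_def)
    then have "(\<Sum>a\<in>E. x k ^ (a k - m) * y a) =
        (\<Sum>a\<in>E0. x k ^ (a k - m) * y a) + (\<Sum>a\<in>E - E0. x k ^ (a k - m) * y a)"
      using sum.subset_diff[of E0 E "\<lambda>a. x k ^ (a k - m) * y a"] Suc.prems(2)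
      by (simp only: add.commute)
    moreover have "(\<Sum>a\<in>E0. x k ^ (a k - m) * y a) = (\<Sum>a\<in>E0. y a)"
      by (intro sum.cong) (auto simp: E0_def)
    moreover have "(\<Sum>a\<in>E - E0. x k ^ (a k - m) * y a) \<in> P (Suc k)"
    proof (intro polys.is_ideal_sum[OF conjunct1[OF Pk']] id'(5)[OF _ yC])
      fix a assume "a \<in> E - E0"
      then have "m < a k" using m[of a] by (auto simp: E0_def)
      then obtain j where j: "a k - m = Suc j" using Suc_diff_Suc by metis
      have "x k * x k ^ j \<in> P (Suc k)"
        using x[OF k] xC[OF k] by (intro id'(5) polys.closed) auto
      then show "x k ^ (a k - m) \<in> P (Suc k)" by (simp add: j)
    qed
    ultimately have "(\<Sum>a\<in>E0. y a) \<in> P (Suc k)" using id'(7)[OF 1] by fastforce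
    moreover have "(\<Sum>a\<in>E0. y a) \<notin> P (Suc k)"
      unfolding y_def
    proof (rule Suc.hyps(1))
      show "inj_on (\<lambda>a. restrict a {Suc k..<l}) E0"
      proof
        fix a b assume ab: "a \<in> E0" "b \<in> E0" "restrict a {Suc k..<l} = restrict b {Suc k..<l}"
        have "restrict a {k..<l} i = restrict b {k..<l} i" for i
        proof (cases "Suc k \<le> i \<and> i < l")
          case True
          then show ?thesis using fun_cong[OF ab(3), of i] by simp
        next
          case False
          then show ?thesis using ab(1,2) by (cases "i = k") (auto simp: E0_def restrict_def)
        qed
        then have eq: "restrict a {k..<l} = restrict b {k..<l}" by blast
        show "a = b" 
          by (rule inj_onD[OF Suc.prems(4), of a b]) (use ab(1,2) eq in \<open>auto simp: E0_def\<close>)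
      qed
    qed (use Suc k a0 in \<open>auto simp: E0_def\<close>)
    ultimately show False by blast
  qed
qed

text \<open>
  Reducing the chosen elements modulo the variables in \<open>A\<close> leaves polynomials in
  \<open>|{1..n} - A|\<close> variables.
\<close>

lemma card_le_of_prime_chain:
  fixes P :: "nat \<Rightarrow> 'k::field mpoly set"
  assumes P: "\<And>i. i \<le> l \<Longrightarrow> is_prime n (P i)" and sub: "\<And>i. i < l \<Longrightarrow> P i \<subset> P (Suc i)"
    and A: "\<And>i. i \<le> l \<Longrightarrow> vars_prime n A \<subseteq> P i"
  shows "l \<le> card ({1..n} - A)"
proof (rule ccontr)
  assume "\<not> l \<le> card ({1..n} - A)"
  then have l: "card ({1..n} - A) < l" by simp
  have fin: "finite ({1..n} - A)" by simp
  have "\<exists>x. x \<in> P (Suc i) - P i \<and> x \<in> polys n \<and> (\<forall>m\<in>keys x. keys m \<subseteq> {1..n} - A)"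
    if i: "i < l" for i
  proof -
    note id0 = polys.is_idealD[OF conjunct1[OF P[OF less_imp_le[OF i], unfolded is_prime_def]]]
    note id1 = polys.is_idealD[OF conjunct1[OF P[OF Suc_leI[OF i], unfolded is_prime_def]]]
    obtain y where y: "y \<in> P (Suc i)" "y \<notin> P i" using sub[OF i] by blast
    have yC: "y \<in> polys n" by (rule id1(1)[OF y(1)])
    let ?x = "restrict_vars A y"
    have d: "y - ?x \<in> vars_prime n A" by (rule diff_restrict_vars_mem[OF yC])
    have "y - ?x \<in> P (Suc i)" using d A[of "Suc i"] i by auto
    then have "y - (y - ?x) \<in> P (Suc i)" by (rule id1(7)[OF y(1)])
    then have "?x \<in> P (Suc i)" by simp
    moreover have "?x \<notin> P i"
    proof
      assume "?x \<in> P i"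
      then have "(y - ?x) + ?x \<in> P i" using d A[of i] i by (intro id0(3)) auto
      then show False using y by simp
    qed
    moreover have "keys m \<subseteq> {1..n} - A" if m: "m \<in> keys ?x" for m
      using m restrict_vars_closed[OF yC, of A] keys_restrict_vars[OF m] by (auto simp: mem_polys_iff)
    ultimately show ?thesis using restrict_vars_closed[OF yC, of A] by auto
  qed
  then obtain x where x: "\<And>i. i < l \<Longrightarrow> x i \<in> P (Suc i) - P i"
    "\<And>i. i < l \<Longrightarrow> \<forall>m\<in>keys (x i). keys m \<subseteq> {1..n} - A"
    by metis
  obtain E c where "finite E" "E \<noteq> {}" "inj_on (\<lambda>a. restrict a {0..<l}) E" "\<And>a. a \<in> E \<Longrightarrow> c a \<noteq> 0"
    and rel: "(\<Sum>a\<in>E. single 0 (c a) * (\<Prod>i\<in>{0..<l}. x i ^ a i)) = 0"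
    by (rule ex_algebraic_relation[of "{1..n} - A" l x, OF fin l]) (erule x(2), rule that)
  then have "(\<Sum>a\<in>E. single 0 (c a) * (\<Prod>i\<in>{0..<l}. x i ^ a i)) \<notin> P 0"
    using no_relation_along_prime_chain[of l n P x 0 E c] P sub x(1) by blast
  moreover have "0 \<in> P 0" using P[of 0] polys.is_idealD(2)[of n "P 0"] by (simp add: is_prime_def)
  ultimately show False using rel by simp
qed

lemma primeideal_imp_is_prime:
  fixes Q :: "'k::field mpoly set"
  assumes "primeideal Q (mpoly_ring n)"
  shows "is_prime n Q"
proof -
  interpret Q: primeideal Q "mpoly_ring n" by fact
  have "polys.is_ideal n Q" using Q.is_ideal by (simp add: ideal_iff_is_ideal)
  moreover have "1 \<notin> Q" using Q.I_notcarr Q.one_imp_carrier by auto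
  moreover have "f \<in> Q \<or> g \<in> Q" if "f \<in> polys n" "g \<in> polys n" "f * g \<in> Q" for f g
    using Q.I_prime[of f g] that by simp
  ultimately show ?thesis by (auto simp: is_prime_def)
qed

lemma krull_dim_le:
  assumes "A \<subseteq> {1..n}"
  shows "krull_dim (mpoly_ring n Quot (vars_prime n A :: 'k::field mpoly set)) \<le> enat (card ({1..n} - A))"
  unfolding krull_dim_def
proof (rule Sup_least, clarify)
  let ?J = "vars_prime n A :: 'k mpoly set"
  interpret R: cring "mpoly_ring n :: 'k mpoly ring" by (rule cring_mpoly_ring)
  interpret J: ideal ?J "mpoly_ring n"
    using is_ideal_vars_prime by (simp add: ideal_iff_is_ideal)
  interpret h: ring_hom_ring "mpoly_ring n" "mpoly_ring n Quot ?J" "(+>\<^bsub>mpoly_ring n\<^esub>) ?J"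
    by (rule J.rcos_ring_hom_ring)
  fix l p
  assume p: "\<forall>i\<le>l. primeideal (p i) (mpoly_ring n Quot ?J)" and chain: "\<forall>i<l. p i \<subset> p (Suc i)"
  define P where "P i = {r \<in> carrier (mpoly_ring n). ?J +>\<^bsub>mpoly_ring n\<^esub> r \<in> p i}" for i
  have "l \<le> card ({1..n} - A)"
  proof (rule card_le_of_prime_chain[of l n P A])
    fix i assume i: "i \<le> l"
    then show "is_prime n (P i)"
      unfolding P_def using p by (intro primeideal_imp_is_prime h.primeideal_vimage R.is_cring) auto
    show "vars_prime n A \<subseteq> P i"
    proof
      fix x assume x: "x \<in> ?J"
      interpret p: primeideal "p i" "mpoly_ring n Quot ?J" using p i by blast
      have "?J +>\<^bsub>mpoly_ring n\<^esub> x = \<zero>\<^bsub>mpoly_ring n Quot ?J\<^esub>"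
        using R.a_rcos_zero[OF J.is_ideal x] by (simp add: FactRing_def)
      then have "?J +>\<^bsub>mpoly_ring n\<^esub> x \<in> p i"
        using additive_subgroup.zero_closed[OF p.additive_subgroup_axioms] by simp
      with polys.is_idealD(1)[OF is_ideal_vars_prime x] show "x \<in> P i"
        unfolding P_def by blast
    qed
  next
    fix i assume i: "i < l"
    then obtain c where c: "c \<in> p (Suc i)" "c \<notin> p i" using chain by blast
    interpret p: primeideal "p (Suc i)" "mpoly_ring n Quot ?J" using p i by auto
    have "c \<in> carrier (mpoly_ring n Quot ?J)" using c(1) p.a_subset by blast
    then obtain x where "x \<in> polys n" "c = ?J +>\<^bsub>mpoly_ring n\<^esub> x"
      by (auto simp: carrier_Quot[OF is_ideal_vars_prime])
    then have "x \<in> P (Suc i) - P i" using c by (simp add: P_def)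
    moreover have "P i \<subseteq> P (Suc i)" using chain i by (auto simp: P_def)
    ultimately show "P i \<subset> P (Suc i)" by blast
  qed
  then show "enat l \<le> enat (card ({1..n} - A))" by simp
qed

lemma vars_prime_mono: "A \<subseteq> B \<Longrightarrow> vars_prime n A \<subseteq> vars_prime n B"
  by (auto simp: vars_prime_def)

lemma primeideal_image_vars_prime:
  assumes "A \<subseteq> B"
  shows "primeideal ((+>\<^bsub>mpoly_ring n\<^esub>) (vars_prime n A) ` vars_prime n B)
    (mpoly_ring n Quot (vars_prime n A :: 'k::field mpoly set))" (is "primeideal ?p ?Q")
    and "\<And>x. x \<in> polys n \<Longrightarrow> vars_prime n A +>\<^bsub>mpoly_ring n\<^esub> x \<in>
      (+>\<^bsub>mpoly_ring n\<^esub>) (vars_prime n A) ` vars_prime n B \<longleftrightarrow> x \<in> (vars_prime n B :: 'k mpoly set)"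
proof -
  let ?J = "vars_prime n A :: 'k mpoly set" and ?P = "vars_prime n B :: 'k mpoly set"
  interpret R: cring "mpoly_ring n :: 'k mpoly ring" by (rule cring_mpoly_ring)
  have J: "ideal ?J (mpoly_ring n)" and P: "ideal ?P (mpoly_ring n)"
    using is_ideal_vars_prime by (auto simp: ideal_iff_is_ideal)
  interpret J: ideal ?J "mpoly_ring n" by (rule J)
  have sub: "?J \<subseteq> ?P" by (rule vars_prime_mono[OF assms])
  show mem: "?J +>\<^bsub>mpoly_ring n\<^esub> x \<in> (+>\<^bsub>mpoly_ring n\<^esub>) ?J ` ?P \<longleftrightarrow> x \<in> ?P" if x: "x \<in> polys n" for x
  proof
    assume "?J +>\<^bsub>mpoly_ring n\<^esub> x \<in> (+>\<^bsub>mpoly_ring n\<^esub>) ?J ` ?P"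
    then obtain y where y: "y \<in> ?P" "?J +>\<^bsub>mpoly_ring n\<^esub> x = ?J +>\<^bsub>mpoly_ring n\<^esub> y" by blast
    then have "x - y \<in> ?J"
      using coset_eq_iff[OF is_ideal_vars_prime x, of y A]
        polys.is_idealD(1)[OF is_ideal_vars_prime y(1)] by blast
    then have "(x - y) + y \<in> ?P"
      using sub y by (intro polys.is_idealD(3)[OF is_ideal_vars_prime]) blast+
    then show "x \<in> ?P" by simp
  qed blast
  show "primeideal ?p ?Q"
  proof (rule primeidealI)
    show "ideal ?p ?Q" by (rule R.ring_ideal_imp_quot_ideal[OF J P])
    show "cring ?Q" by (rule J.quotient_is_cring[OF R.is_cring])
    have "?J +>\<^bsub>mpoly_ring n\<^esub> 1 \<notin> ?p" using mem[of 1] one_notin_vars_prime polys.one_closed by blast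
    then show "carrier ?Q \<noteq> ?p"
      using carrier_Quot[OF is_ideal_vars_prime, of n A] polys.one_closed by blast
  next
    fix a b assume ab: "a \<in> carrier ?Q" "b \<in> carrier ?Q" "a \<otimes>\<^bsub>?Q\<^esub> b \<in> ?p"
    then obtain x y where x: "x \<in> polys n" "a = ?J +>\<^bsub>mpoly_ring n\<^esub> x"
      and y: "y \<in> polys n" "b = ?J +>\<^bsub>mpoly_ring n\<^esub> y"
      by (auto simp: carrier_Quot[OF is_ideal_vars_prime])
    have "x * y \<in> ?P"
      using ab(3) x y mem[of "x * y"] by (simp add: coset_mult[OF is_ideal_vars_prime] polys.closed)
    then show "a \<in> ?p \<or> b \<in> ?p"
      using vars_prime_mult_mem[OF x(1) y(1)] x(2) y(2) by blast
  qed
qed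

lemma krull_dim_ge:
  assumes "A \<subseteq> {1..n}"
  shows "enat (card ({1..n} - A)) \<le> krull_dim (mpoly_ring n Quot (vars_prime n A :: 'k::field mpoly set))"
proof -
  let ?J = "vars_prime n A :: 'k mpoly set" and ?l = "card ({1..n} - A)"
  obtain b where b: "bij_betw b {0..<?l} ({1..n} - A)"
    using ex_bij_betw_nat_finite[of "{1..n} - A"] by auto
  define B where "B i = A \<union> b ` {0..<i}" for i
  define p where "p i = (+>\<^bsub>mpoly_ring n\<^esub>) ?J ` vars_prime n (B i)" for i
  have "primeideal (p i) (mpoly_ring n Quot ?J)" for i
    unfolding p_def by (rule primeideal_image_vars_prime) (simp add: B_def)
  moreover have "p i \<subset> p (Suc i)" if i: "i < ?l" for i
  proof -
    have bi: "b i \<in> {1..n} - A" using bspec[OF bij_betwE[OF b], of i] i by simp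
    have "b j \<noteq> b i" if "j < i" for j
      using inj_onD[OF bij_betw_imp_inj_on[OF b], of j i] that i by auto
    then have "b i \<notin> B i" using bi by (force simp: B_def)
    then have v: "(var (b i) :: 'k mpoly) \<notin> vars_prime n (B i)" by (auto simp: vars_prime_def var_def)
    have vC: "(var (b i) :: 'k mpoly) \<in> polys n" by (rule var_mem_polys[OF DiffD1[OF bi]])
    then have v': "(var (b i) :: 'k mpoly) \<in> vars_prime n (B (Suc i))"
      by (auto simp: vars_prime_def var_def B_def)
    have "?J +>\<^bsub>mpoly_ring n\<^esub> var (b i) \<notin> p i"
      unfolding p_def using primeideal_image_vars_prime(2)[OF _ vC, of A "B i"] v by (simp add: B_def)
    moreover have "?J +>\<^bsub>mpoly_ring n\<^esub> var (b i) \<in> p (Suc i)" unfolding p_def using v' by blast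
    moreover have "(vars_prime n (B i) :: 'k mpoly set) \<subseteq> vars_prime n (B (Suc i))"
      by (rule vars_prime_mono) (auto simp: B_def)
    then have "p i \<subseteq> p (Suc i)" unfolding p_def by blast
    ultimately show ?thesis by blast
  qed
  ultimately show ?thesis
    unfolding krull_dim_def by (intro Sup_upper) blast
qed

lemma krull_dim_vars_prime:
  assumes "A \<subseteq> {1..n}"
  shows "krull_dim (mpoly_ring n Quot (vars_prime n A :: 'k::field mpoly set)) = enat (card ({1..n} - A))"
  using krull_dim_le[OF assms] krull_dim_ge[OF assms] by (rule antisym)

section \<open>Upper bounds on the length of regular sequences\<close>

context subring_of_type
begin

lemma coboundary_eq_0: "(\<And>i. i \<in> set t \<Longrightarrow> \<phi> i = 0) \<Longrightarrow> coboundary \<phi> z t = 0"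
  by (induction t arbitrary: z) auto

lemma coboundary_eq_0': "(\<And>u. length t = Suc (length u) \<Longrightarrow> z u = 0) \<Longrightarrow> coboundary \<phi> z t = 0"
  by (induction t arbitrary: z) auto

lemma coboundary_add_left: "coboundary (\<lambda>i. \<phi> i + \<psi> i) z t = coboundary \<phi> z t + coboundary \<psi> z t"
  by (induction t arbitrary: z) (auto simp: algebra_simps)

lemma coboundary_sum_left: "coboundary (\<lambda>i. \<Sum>g\<in>G. c g * \<phi> g i) z t = (\<Sum>g\<in>G. c g * coboundary (\<phi> g) z t)"
  by (induction t arbitrary: z)
     (auto simp: sum_subtractf right_diff_distrib sum_distrib_left sum_distrib_right mult_ac)

text \<open>
  The cochain dual to the generator \<open>g\<close>.
\<close>

definition delta :: "'i \<Rightarrow> 'i \<Rightarrow> 'a" where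
  "delta g i = (if i = g then 1 else 0)"

text \<open>
  The analogue of the exterior product with the dual generators \<open>g\<close> in \<open>gs\<close>: wedging with a dual
  generator is the differential for \<open>\<phi> = delta g\<close>, so the sign rules are instances of
  \<open>coboundary_anticommute\<close>.
\<close>

definition wedge :: "'i list \<Rightarrow> ('i list \<Rightarrow> 'a) \<Rightarrow> ('i list \<Rightarrow> 'a)" where
  "wedge gs z = foldr (\<lambda>g. coboundary (delta g)) gs z"

lemma wedge_simps [simp]: "wedge [] z = z" "wedge (g # gs) z = coboundary (delta g) (wedge gs z)"
  by (simp_all add: wedge_def)

lemma wedge_closed:
  assumes "is_ideal J" "\<And>t. set t \<subseteq> V \<Longrightarrow> z t \<in> J" "set t \<subseteq> V"
  shows "wedge gs z t \<in> J"
  using assms(3)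
proof (induction gs arbitrary: t)
  case (Cons g gs)
  have "coboundary (delta g) (wedge gs z) t \<in> J"
  proof (rule coboundary_closed[OF assms(1)])
    fix u assume "set u \<subseteq> set t"
    then show "wedge gs z u \<in> J" using Cons.prems by (intro Cons.IH) blast
  qed (simp add: delta_def closed)
  then show ?case by simp
qed (use assms(2) in simp)

lemma wedge_add: "wedge gs (\<lambda>t. z t + w t) t = wedge gs z t + wedge gs w t"
proof (induction gs arbitrary: t)
  case (Cons g gs)
  then have "wedge gs (\<lambda>t. z t + w t) = (\<lambda>t. wedge gs z t + wedge gs w t)" by blast
  then show ?case by (simp add: coboundary_add)
qed simp

lemma wedge_zero: "wedge gs (\<lambda>_. 0) = (\<lambda>_. 0)"
proof (induction gs)
  case (Cons g gs)
  have "coboundary (delta g) (\<lambda>_. 0) t = 0" for t by (rule coboundary_zero)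
  then show ?case using Cons by auto
qed simp

lemma wedge_scale: "wedge gs (\<lambda>t. c * z t) t = c * wedge gs z t"
proof (induction gs arbitrary: t)
  case (Cons g gs)
  then have "wedge gs (\<lambda>t. c * z t) = (\<lambda>t. c * wedge gs z t)" by blast
  then show ?case by (simp add: coboundary_scale)
qed simp

lemma wedge_sum: "wedge gs (\<lambda>t. \<Sum>i\<in>A. z i t) t = (\<Sum>i\<in>A. wedge gs (z i) t)"
  by (induction A rule: infinite_finite_induct) (auto simp: wedge_add wedge_zero)

lemma coboundary_wedge: "coboundary \<phi> (wedge gs z) t = (- 1) ^ length gs * wedge gs (coboundary \<phi> z) t"
proof (induction gs arbitrary: t)
  case (Cons g gs)
  have "coboundary \<phi> (wedge gs z) = (\<lambda>t. (- 1) ^ length gs * wedge gs (coboundary \<phi> z) t)"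
    using Cons by blast
  moreover have "coboundary \<phi> (coboundary (delta g) (wedge gs z)) t = - coboundary (delta g) (coboundary \<phi> (wedge gs z)) t"
    by (rule coboundary_anticommute)
  ultimately show ?case by (simp add: coboundary_scale)
qed simp

lemma wedge_coboundary: "wedge gs (coboundary \<phi> z) t = (- 1) ^ length gs * coboundary \<phi> (wedge gs z) t"
proof -
  have "(- 1) ^ length gs * (- 1) ^ length gs = (1 :: 'a)"
    by (simp flip: power_mult_distrib)
  then show ?thesis by (simp add: coboundary_wedge mult.assoc[symmetric])
qed

lemma wedge_coboundary_delta_eq_0:
  assumes "g \<in> set gs"
  shows "wedge gs (coboundary (delta g) z) t = 0"
  using assms
proof (induction gs arbitrary: t)
  case (Cons h gs)
  show ?case
  proof (cases "g = h")
    case True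
    have "wedge (h # gs) (coboundary (delta g) z) t =
        (- 1) ^ length (h # gs) * coboundary (delta g) (coboundary (delta g) (wedge gs z)) t"
      unfolding wedge_coboundary by (simp add: True)
    then show ?thesis by (simp add: coboundary_twice del: wedge_simps)
  next
    case False
    then have "wedge gs (coboundary (delta g) z) = (\<lambda>_. 0)" using Cons by auto
    then show ?thesis by simp
  qed
qed simp

text \<open>
  The part of \<open>\<phi>\<close> along \<open>gs\<close> is wedged away, because \<open>wedge gs\<close> kills products with its own factors.
\<close>

lemma wedge_coboundary_cong:
  assumes "\<And>i. i \<notin> set gs \<Longrightarrow> \<phi> i = \<psi> i"
  shows "wedge gs (coboundary \<phi> z) t = wedge gs (coboundary \<psi> z) t"
proof -
  have "\<phi> = (\<lambda>i. \<psi> i + (\<Sum>g\<in>set gs. (\<phi> g - \<psi> g) * delta g i))"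
  proof
    fix i
    have "(\<Sum>g\<in>set gs. (\<phi> g - \<psi> g) * delta g i) = (\<Sum>g\<in>set gs. if g = i then \<phi> i - \<psi> i else 0)"
      by (intro sum.cong) (auto simp: delta_def)
    also have "\<dots> = \<phi> i - \<psi> i" using assms[of i] by simp
    finally show "\<phi> i = \<psi> i + (\<Sum>g\<in>set gs. (\<phi> g - \<psi> g) * delta g i)" by simp
  qed
  then have "coboundary \<phi> z = (\<lambda>t. coboundary \<psi> z t + (\<Sum>g\<in>set gs. (\<phi> g - \<psi> g) * coboundary (delta g) z t))"
    by (metis coboundary_add_left coboundary_sum_left)
  then show ?thesis by (simp add: wedge_add wedge_sum wedge_scale wedge_coboundary_delta_eq_0)
qed

text \<open>
  Only the term that deletes exactly \<open>gs\<close> survives. This is what makes wedged cochains detectable.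
\<close>

lemma wedge_append:
  "distinct gs \<Longrightarrow> set gs \<inter> set t = {} \<Longrightarrow> wedge gs z (gs @ t) = z t"
proof (induction gs)
  case (Cons g gs)
  have "coboundary (delta g) (\<lambda>u. wedge gs z (g # u)) (gs @ t) = 0"
    using Cons.prems by (intro coboundary_eq_0) (auto simp: delta_def)
  then show ?case using Cons by (simp add: delta_def)
qed simp

end

lemma mem_vars_primeE:
  fixes a :: "'k::field mpoly"
  assumes a: "a \<in> vars_prime n A" and A: "A \<subseteq> {1..n}"
  obtains u where "\<And>i. i \<in> A \<Longrightarrow> u i \<in> polys n" "a = (\<Sum>i\<in>A. u i * var i)"
proof -
  define ch where "ch m = (SOME i. i \<in> keys m \<inter> A)" for m :: "nat \<Rightarrow>\<^sub>0 nat"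
  have ch: "ch m \<in> keys m" "ch m \<in> A" "keys m \<subseteq> {1..n}"
    if "m \<in> keys a" for m
  proof -
    have "keys m \<inter> A \<noteq> {}" using a that by (simp add: vars_prime_def)
    then have "ch m \<in> keys m \<inter> A" unfolding ch_def some_in_eq .
    then show "ch m \<in> keys m" "ch m \<in> A" by auto
    show "keys m \<subseteq> {1..n}" using a that by (simp add: vars_prime_def mem_polys_iff)
  qed
  define h where "h m = single (m - single (ch m) 1) (lookup a m)" for m
  define u where "u i = (\<Sum>m\<in>{m \<in> keys a. ch m = i}. h m)" for i
  have hC: "h m \<in> polys n" if "m \<in> keys a" for m
    unfolding h_def by (rule single_mem_polys[OF subset_trans[OF keys_diff_nat ch(3)[OF that]]])
  have "a = (\<Sum>m\<in>keys a. single m (lookup a m))"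
    by (rule sum_monomials) auto
  also have "\<dots> = (\<Sum>m\<in>keys a. h m * var (ch m))"
    unfolding h_def by (intro sum.cong refl) (subst var_mult_single[OF ch(1)], auto simp: mult.commute)
  also have "\<dots> = (\<Sum>i\<in>A. \<Sum>m\<in>{m \<in> keys a. ch m = i}. h m * var (ch m))"
    using ch(2) finite_subset[OF A] by (intro sum.group[symmetric]) auto
  also have "\<dots> = (\<Sum>i\<in>A. u i * var i)"
    unfolding u_def by (simp add: sum_distrib_right)
  finally have "a = (\<Sum>i\<in>A. u i * var i)" .
  moreover have "u i \<in> polys n" for i unfolding u_def using hC by (intro polys.closed) auto
  ultimately show thesis by (intro that)
qed

text \<open>
  The form in which the vanishing theorem is applied: the cochain complex of all variables, and
  sequences in the ideal generated by them.
\<close>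

lemma cocycle_imp_coboundary_var:
  fixes z :: "nat list \<Rightarrow> 'k::field mpoly"
  assumes "polys.is_ideal n I" "set as \<subseteq> vars_prime n {1..n}" "polys.weakly_regular n I as"
    and "k < length as"
    and "\<And>t. set t \<subseteq> {1..n} \<Longrightarrow> length t = k \<Longrightarrow> z t \<in> polys n"
    and "\<And>t. set t \<subseteq> {1..n} \<Longrightarrow> length t = Suc k \<Longrightarrow> polys.coboundary var z t \<in> I"
  obtains w where "\<And>t. set t \<subseteq> {1..n} \<Longrightarrow> length t = k \<Longrightarrow> z t - polys.coboundary var w t \<in> I"
proof -
  have "\<exists>u. (\<forall>i\<in>{1..n}. u i \<in> polys n) \<and> a = (\<Sum>i\<in>{1..n}. u i * var i)" if "a \<in> set as" for a
    using mem_vars_primeE[of a n "{1..n}"] that assms(2) by blast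
  then have "\<exists>w. (\<forall>t. w t \<in> polys n) \<and>
      (\<forall>t. set t \<subseteq> {1..n} \<longrightarrow> length t = k \<longrightarrow> z t - polys.coboundary var w t \<in> I)"
    by (intro polys.cocycle_imp_coboundary[of n I "{1..n}" var as k z] assms var_mem_polys
        finite_atLeastAtMost)
  then show thesis using that by blast
qed

lemma lookup_mem_Inter_vars_prime:
  assumes "f \<in> (\<Inter>i\<in>T. vars_prime n (A i))" "i \<in> T" "keys m \<inter> A i = {}"
  shows "lookup f m = 0"
proof (rule ccontr)
  assume "lookup f m \<noteq> 0"
  then have "m \<in> keys f" by (simp add: in_keys_iff)
  moreover have "f \<in> vars_prime n (A i)" using assms by blast
  ultimately show False using assms(3) by (auto simp: vars_prime_def)
qed

lemma is_ideal_Inter_vars_prime: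
  assumes "T \<noteq> {}"
  shows "polys.is_ideal n (\<Inter>i\<in>T. vars_prime n (A i) :: 'k::field mpoly set)"
  unfolding polys.is_ideal_def
proof (intro conjI ballI INT_I)
  show "(\<Inter>i\<in>T. vars_prime n (A i) :: 'k mpoly set) \<subseteq> polys n"
    using assms by (auto simp: vars_prime_def)
  show "0 \<in> (vars_prime n (A i) :: 'k mpoly set)" for i
    by (rule polys.is_idealD(2)[OF is_ideal_vars_prime])
next
  fix x y :: "'k mpoly" and i
  assume "x \<in> (\<Inter>i\<in>T. vars_prime n (A i))" "y \<in> (\<Inter>i\<in>T. vars_prime n (A i))" "i \<in> T"
  then show "x + y \<in> vars_prime n (A i)"
    by (intro polys.is_idealD(3)[OF is_ideal_vars_prime]) blast+
next
  fix x c :: "'k mpoly" and i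
  assume "x \<in> (\<Inter>i\<in>T. vars_prime n (A i))" "c \<in> polys n" "i \<in> T"
  then show "c * x \<in> vars_prime n (A i)"
    by (intro polys.is_idealD(4)[OF is_ideal_vars_prime]) blast+
qed

text \<open>
  All terms but the last are multiples of a variable other than \<open>i\<close>.
\<close>

lemma lookup_coboundary_var:
  assumes "i \<notin> set gs"
  shows "lookup (polys.coboundary var w (gs @ [i])) (single i 1) =
    (- 1) ^ length gs * lookup (w gs :: 'k::field mpoly) 0"
  using assms
  by (induction gs arbitrary: w) (auto simp: lookup_minus lookup_var_mult)

text \<open>
  Removing \<open>G\<close> from the complex leaves no face that joins \<open>V\<close> to the remaining vertices. Let \<open>\<eta>\<close> be
  \<open>x\<^sub>i\<close> on \<open>V\<close> and zero elsewhere. Off \<open>G\<close> it is a cocycle modulo \<open>I\<close>, because \<open>x\<^sub>a x\<^sub>b \<in> I\<close> for \<open>a\<close> in \<open>V\<close>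
  and \<open>b\<close> on the other side; wedging with \<open>G\<close> makes it a cocycle of degree \<open>|G| + 1\<close>. If it were the
  coboundary of \<open>w\<close>, then comparing the coefficient of \<open>x\<^sub>i\<close> at the list \<open>gs @ [i]\<close> would show that, up to
  sign, the constant coefficient of \<open>w gs\<close> is 1 for a vertex \<open>i\<close> in \<open>V\<close> and 0 for one outside.
\<close>

lemma length_le_of_cut:
  fixes A :: "nat \<Rightarrow> nat set" and as :: "'k::field mpoly list" and T :: "nat set" and n :: nat
  defines "I \<equiv> (\<Inter>i\<in>T. vars_prime n (A i))"
  assumes G: "G \<subseteq> {1..n}" and V: "V \<subseteq> {1..n} - G"
    and sep: "\<And>i u w. i \<in> T \<Longrightarrow> u \<in> V \<Longrightarrow> w \<in> {1..n} - G - V \<Longrightarrow> u \<in> A i \<or> w \<in> A i"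
    and u0: "u0 \<in> V" "i \<in> T" "u0 \<notin> A i"
    and w0: "w0 \<in> {1..n} - G - V" "j \<in> T" "w0 \<notin> A j"
    and as: "set as \<subseteq> vars_prime n {1..n}" "polys.weakly_regular n I as"
  shows "length as \<le> Suc (card G)"
proof (rule ccontr)
  assume "\<not> length as \<le> Suc (card G)"
  then have len: "Suc (card G) < length as" by simp
  have I: "polys.is_ideal n I" unfolding I_def using u0 by (intro is_ideal_Inter_vars_prime) auto
  note [simp del] = One_nat_def
  have var_I: "(var a * var b :: 'k mpoly) \<in> I"
    if "a \<in> {1..n}" "b \<in> {1..n}" "\<And>i. i \<in> T \<Longrightarrow> a \<in> A i \<or> b \<in> A i" for a b
    unfolding I_def using that by (auto simp: vars_prime_def var_def mult_single mem_polys_iff keys_add_nat)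
  obtain gs where gs: "set gs = G" "distinct gs"
    using finite_distinct_list[of G] finite_subset[OF G] by auto
  have len_gs: "length gs = card G" using gs distinct_card by force
  define \<eta> :: "nat \<Rightarrow> 'k mpoly" where "\<eta> i = (if i \<in> V then var i else 0)" for i
  \<comment> \<open>Wedging with \<open>G\<close> does not see the difference between \<open>\<xi>\<close> and the variables.\<close>
  define \<xi> :: "nat \<Rightarrow> 'k mpoly" where "\<xi> i = (if i \<in> G then 0 else var i)" for i
  define one :: "nat list \<Rightarrow> 'k mpoly" where "one t = (if t = [] then 1 else 0)" for t
  define y where "y = polys.coboundary \<eta> one"
  define z where "z = polys.wedge gs y"
  have \<eta>C: "\<eta> i \<in> polys n" if "i \<in> {1..n}" for i
  proof -
    have "(var i :: 'k mpoly) \<in> polys n" by (rule var_mem_polys[OF that])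
    then show ?thesis by (simp add: \<eta>_def polys.zero_closed)
  qed
  have yC: "y t \<in> polys n" if "set t \<subseteq> {1..n}" for t
    unfolding y_def using that \<eta>C
    by (intro polys.coboundary_closed[OF polys.is_ideal_carrier]) (auto simp: one_def polys.closed)
  have zC: "z t \<in> polys n" if "set t \<subseteq> {1..n}" for t
    unfolding z_def using that yC by (intro polys.wedge_closed[OF polys.is_ideal_carrier, of "{1..n}"]) auto
  have y0: "y t = 0" if "length t \<noteq> 1" for t
    unfolding y_def using that by (intro polys.coboundary_eq_0') (auto simp: one_def One_nat_def)
  have y1: "y [i] = \<eta> i" for i by (simp add: y_def one_def)
  have dy: "polys.coboundary \<xi> y t \<in> I" if t: "set t \<subseteq> {1..n}" for t
  proof (cases "length t = 2")
    case True
    then obtain a b where ab: "t = [a, b]" by (auto simp: length_Suc_conv numeral_2_eq_2)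
    have eq: "polys.coboundary \<xi> y t = \<xi> a * \<eta> b - \<xi> b * \<eta> a" by (simp add: ab y1)
    have *: "\<xi> a * \<eta> b \<in> I" if "a \<notin> V" "a \<in> {1..n}" for a b
    proof (cases "a \<in> G \<or> b \<notin> V")
      case True then show ?thesis by (auto simp: \<xi>_def \<eta>_def polys.is_idealD(2)[OF I])
    next
      case False
      then have "(var a * var b :: 'k mpoly) \<in> I" using that V sep by (intro var_I) blast+
      then show ?thesis using False by (simp add: \<xi>_def \<eta>_def)
    qed
    show ?thesis
    proof (cases "a \<in> V \<and> b \<in> V")
      case True
      then have "polys.coboundary \<xi> y t = 0" unfolding eq using V by (auto simp: \<xi>_def \<eta>_def)
      then show ?thesis by (simp add: polys.is_idealD(2)[OF I])
    next
      case False
      have "\<xi> a * \<eta> b \<in> I"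
      proof (cases "a \<in> V")
        case True then show ?thesis using False by (simp add: \<eta>_def polys.is_idealD(2)[OF I])
      qed (use t ab in \<open>intro *, auto\<close>)
      moreover have "\<xi> b * \<eta> a \<in> I"
      proof (cases "b \<in> V")
        case True then show ?thesis using False by (simp add: \<eta>_def polys.is_idealD(2)[OF I])
      qed (use t ab in \<open>intro *, auto\<close>)
      ultimately show ?thesis unfolding eq by (rule polys.is_idealD(7)[OF I])
    qed
  next
    case False
    then have "polys.coboundary \<xi> y t = 0" by (intro polys.coboundary_eq_0' y0) (auto simp: One_nat_def)
    then show ?thesis by (simp add: polys.is_idealD(2)[OF I])
  qed
  have dz: "polys.coboundary var z t \<in> I" if "set t \<subseteq> {1..n}" for t
  proof -
    have "polys.coboundary var z t = (- 1) ^ length gs * polys.wedge gs (polys.coboundary \<xi> y) t"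
      unfolding z_def polys.coboundary_wedge using gs(1)
      by (subst polys.wedge_coboundary_cong[of gs var \<xi>]) (auto simp: \<xi>_def)
    moreover have "polys.wedge gs (polys.coboundary \<xi> y) t \<in> I"
      using that dy by (intro polys.wedge_closed[OF I, of "{1..n}"]) auto
    ultimately show ?thesis by (auto intro: polys.is_idealD(4)[OF I] polys.closed)
  qed
  obtain w where w: "\<And>t. set t \<subseteq> {1..n} \<Longrightarrow> length t = Suc (card G) \<Longrightarrow> z t - polys.coboundary var w t \<in> I"
    by (rule cocycle_imp_coboundary_var[OF I as len zC dz]) (assumption | rule that)+
  have coeff: "lookup (\<eta> a) (single a 1) =
      (- 1) ^ length gs * lookup (w gs) 0"
    if a: "a \<in> {1..n} - G" "k \<in> T" "a \<notin> A k" for a k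
  proof -
    have "z (gs @ [a]) = \<eta> a" unfolding z_def y1[symmetric] using gs a by (intro polys.wedge_append) auto
    moreover have "z (gs @ [a]) - polys.coboundary var w (gs @ [a]) \<in> I"
      using gs a G len_gs by (intro w) auto
    ultimately have "lookup (\<eta> a - polys.coboundary var w (gs @ [a])) (single a 1) = 0"
      unfolding I_def using a by (intro lookup_mem_Inter_vars_prime[where T = T and n = n and A = A and i = k]) auto
    then show ?thesis using gs a by (simp add: lookup_minus lookup_coboundary_var)
  qed
  have "lookup (\<eta> u0) (single u0 1) = lookup (\<eta> w0) (single w0 1)"
    using coeff[of u0 i] coeff[of w0 j] u0 w0 V by auto
  then show False using u0 w0 by (simp add: \<eta>_def var_def)
qed

lemma single_mem_Inter_vars_prime:
  fixes c :: "'k::field"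
  assumes "keys m \<subseteq> {1..n}" "\<And>i. i \<in> T \<Longrightarrow> keys m \<inter> A i \<noteq> {}"
  shows "single m c \<in> (\<Inter>i\<in>T. vars_prime n (A i))"
proof (cases "c = 0")
  case True
  then show ?thesis by (auto intro: polys.is_idealD(2)[OF is_ideal_vars_prime])
next
  case False
  then show ?thesis using assms by (simp add: vars_prime_def mem_polys_iff)
qed

text \<open>
  The facet of index \<open>k\<close> meets each other facet either inside \<open>B\<close> or outside \<open>B\<close>. Hence the function
  on edges of that facet that counts the change of the indicator of \<open>B\<close>, extended by zero to all other
  edges, is a simplicial 1-cocycle \<open>c\<close>. Its sum along the triangle \<open>p, u, v\<close> is not zero, so it is not a
  coboundary; the 2-cochain \<open>c\<^sub>s\<^sub>r x\<^sub>s x\<^sub>r\<close> inherits both properties.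
\<close>

lemma length_le_of_cycle:
  fixes A :: "nat \<Rightarrow> nat set" and as :: "'k::field mpoly list" and T :: "nat set" and n :: nat
  defines "I \<equiv> (\<Inter>i\<in>T. vars_prime n (A i))"
  assumes k: "k \<in> T"
    and sep: "\<And>i u w. i \<in> T \<Longrightarrow> i \<noteq> k \<Longrightarrow> u \<in> B \<Longrightarrow> w \<notin> B \<Longrightarrow>
      u \<in> {1..n} - A i - A k \<Longrightarrow> w \<in> {1..n} - A i - A k \<Longrightarrow> False"
    and p: "p \<in> {1..n} \<inter> A k" and u: "u \<in> B" "u \<in> {1..n} - A k" and v: "v \<notin> B" "v \<in> {1..n} - A k"
    and pu: "a \<in> T" "p \<notin> A a" "u \<notin> A a" and pv: "b \<in> T" "p \<notin> A b" "v \<notin> A b"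
    and as: "set as \<subseteq> vars_prime n {1..n}" "polys.weakly_regular n I as"
  shows "length as \<le> 2"
proof (rule ccontr)
  assume "\<not> length as \<le> 2"
  then have len: "2 < length as" by simp
  have I: "polys.is_ideal n I" unfolding I_def using k by (intro is_ideal_Inter_vars_prime) auto
  define e :: "nat \<Rightarrow> nat \<Rightarrow>\<^sub>0 nat" where "e i = single i 1" for i
  have var_e: "var i = single (e i) (1::'k)" for i by (simp add: var_def e_def)
  have keys_e: "keys (e i) = {i}" for i by (simp add: e_def)
  define c :: "nat \<Rightarrow> nat \<Rightarrow> 'k" where
    "c s r = (if s \<in> A k \<or> r \<in> A k then 0 else (if r \<in> B then 1 else 0) - (if s \<in> B then 1 else 0))" for s r
  define z :: "nat list \<Rightarrow> 'k mpoly" where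
    "z t = (case t of [s, r] \<Rightarrow> single (e s + e r) (c s r) | _ \<Rightarrow> 0)" for t
  have z2: "z [s, r] = single (e s + e r) (c s r)" for s r by (simp add: z_def)
  have zC: "z t \<in> polys n" if t: "set t \<subseteq> {1..n}" "length t = 2" for t
  proof -
    obtain s r where sr: "t = [s, r]" using t(2) by (auto simp: length_Suc_conv numeral_2_eq_2)
    then show ?thesis using t(1) unfolding sr z2 by (intro single_mem_polys) (auto simp: keys_add_nat keys_e)
  qed
  have dz: "polys.coboundary var z t \<in> I" if t: "set t \<subseteq> {1..n}" "length t = Suc 2" for t
  proof -
    obtain s r q where t_eq: "t = [s, r, q]" using t(2) by (auto simp: length_Suc_conv numeral_2_eq_2)
    have srq: "s \<in> {1..n}" "r \<in> {1..n}" "q \<in> {1..n}" using t(1) unfolding t_eq by simp_all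
    have "polys.coboundary var z t = var s * z [r, q] - (var r * z [s, q] - var q * z [s, r])"
      by (simp add: t_eq)
    also have "\<dots> = single (e s + e r + e q) (c r q - c s q + c s r)"
      by (simp add: z2 var_e mult_single single_diff single_add algebra_simps)
    finally have eq: "polys.coboundary var z t = single (e s + e r + e q) (c r q - c s q + c s r)" .
    show ?thesis
    proof (cases "\<exists>i\<in>T. s \<notin> A i \<and> r \<notin> A i \<and> q \<notin> A i")
      case True
      then obtain i where i: "i \<in> T" "s \<notin> A i" "r \<notin> A i" "q \<notin> A i" by blast
      have "c r q - c s q + c s r = 0"
      proof (cases "i = k")
        case True then show ?thesis using i by (simp add: c_def)
      next
        case False
        have "c a b = 0" if "a \<in> {1..n}" "b \<in> {1..n}" "a \<notin> A i" "b \<notin> A i" for a b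
          using sep[OF i(1) False, of a b] sep[OF i(1) False, of b a] that by (simp only: c_def) force
        then show ?thesis using i srq by simp
      qed
      then show ?thesis unfolding eq by (simp add: polys.is_idealD(2)[OF I])
    next
      case False
      then show ?thesis unfolding eq I_def using srq
        by (intro single_mem_Inter_vars_prime) (auto simp: keys_add_nat keys_e)
    qed
  qed
  obtain w where w: "\<And>t. set t \<subseteq> {1..n} \<Longrightarrow> length t = 2 \<Longrightarrow> z t - polys.coboundary var w t \<in> I"
    by (rule cocycle_imp_coboundary_var[OF I as len zC dz]) (assumption | rule that)+
  define \<beta> where "\<beta> i = lookup (w [i]) (e i)" for i
  have edge: "c s r = \<beta> r - \<beta> s"
    if "s \<noteq> r" "s \<in> {1..n}" "r \<in> {1..n}" "i \<in> T" "s \<notin> A i" "r \<notin> A i" for s r i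
  proof -
    have d: "e s + e r - single s (Suc 0) = e r"
      "e s + e r - single r (Suc 0) = e s"
      by (simp_all add: e_def)
    have "z [s, r] - polys.coboundary var w [s, r] \<in> I" using that by (intro w) auto
    then have "lookup (z [s, r] - polys.coboundary var w [s, r]) (e s + e r) = 0"
      unfolding I_def using that
      by (intro lookup_mem_Inter_vars_prime[where T = T and n = n and A = A and i = i])
         (auto simp: keys_add_nat keys_e)
    then show ?thesis
      using that d by (simp add: z2 \<beta>_def lookup_minus lookup_var_mult keys_add_nat keys_e)
  qed
  have ne: "p \<noteq> u" "p \<noteq> v" "u \<noteq> v" using p u v by auto
  have "c p u = \<beta> u - \<beta> p" using p u pu by (intro edge[OF ne(1)]) auto
  moreover have "c p v = \<beta> v - \<beta> p" using p v pv by (intro edge[OF ne(2)]) auto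
  moreover have "c u v = \<beta> v - \<beta> u" using u v k by (intro edge[OF ne(3), of k]) auto
  ultimately show False using p u v by (simp add: c_def)
qed

section \<open>Regular sequences of colour sums\<close>

lemma subst_eq_0:
  assumes "f \<in> vars_prime n A" "\<And>i. i \<in> A \<Longrightarrow> \<sigma> i = 0"
  shows "subst \<sigma> f = 0"
proof -
  have "eval_monomial \<sigma> m = 0" if m: "m \<in> keys f" for m
  proof -
    obtain i where "i \<in> keys m" "i \<in> A"
      using assms(1) m by (auto simp: vars_prime_def)
    then show ?thesis
      using assms(2) by (auto simp: eval_monomial_def in_keys_iff prod_zero_iff intro!: bexI[of _ i])
  qed
  then show ?thesis by (simp add: subst_def)
qed

definition kernel :: "nat \<Rightarrow> (nat \<Rightarrow> 'k::field mpoly) \<Rightarrow> 'k mpoly set" where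
  "kernel n \<sigma> = {f \<in> polys n. subst \<sigma> f = 0}"

lemma is_ideal_kernel: "polys.is_ideal n (kernel n \<sigma>)"
  by (auto simp: polys.is_ideal_def kernel_def subst_add subst_mult polys.closed)

text \<open>
  Ideals generated by variables and linear forms are recognised as kernels of substitutions. As the
  target is a domain, every element with nonzero image is a nonzerodivisor modulo such an ideal.
\<close>

lemma eq_kernelI:
  assumes "polys.is_ideal n J" "J \<subseteq> kernel n \<sigma>"
    and "\<And>i. i \<in> {1..n} \<Longrightarrow> \<sigma> i \<in> polys n" "\<And>i. i \<in> {1..n} \<Longrightarrow> var i - \<sigma> i \<in> J"
  shows "J = kernel n \<sigma>"
proof
  show "kernel n \<sigma> \<subseteq> J"
  proof
    fix f assume "f \<in> kernel n \<sigma>"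
    then show "f \<in> J" using diff_subst_mem[OF assms(1,3,4), of f] by (simp add: kernel_def)
  qed
qed (rule assms(2))

lemma nonzerodivisor_mod_kernel:
  assumes "subst \<sigma> a \<noteq> 0"
  shows "polys.nonzerodivisor_mod n a (kernel n \<sigma>)"
  using assms by (auto simp: polys.nonzerodivisor_mod_def kernel_def subst_mult)

definition colour_sum :: "nat \<Rightarrow> (nat \<Rightarrow> nat) \<Rightarrow> nat \<Rightarrow> 'k::field mpoly" where
  "colour_sum n \<kappa> c = (\<Sum>i\<in>{i\<in>{1..n}. \<kappa> i = c}. var i)"

text \<open>
  The two kinds of variables enter with different degrees. A sum of distinct variables would
  not do: if the facets are the three edges of a triangle, it restricts on some facet to zero or to the sum
  of all variables of that facet.
\<close>

definition mixed_form :: "nat set \<Rightarrow> nat set \<Rightarrow> 'k::field mpoly" where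
  "mixed_form D E = (\<Sum>i\<in>D. var i) + (\<Sum>i\<in>E. var i * var i)"

lemma colour_sum_closed: "colour_sum n \<kappa> c \<in> polys n"
  unfolding colour_sum_def by (intro polys.closed var_mem_polys) simp

lemma lookup_var: "lookup (var i) m = (if m = single i 1 then 1 else 0)"
  by (auto simp: var_def lookup_single when_def)

lemma single_one_eq_iff [simp]:
  "single i (Suc 0) = single j (Suc 0) \<longleftrightarrow> i = j"
proof
  assume "single i (Suc 0) = single j (Suc 0)"
  from arg_cong[OF this, of keys] show "i = j" by simp
qed simp

lemma lookup_sum_var:
  assumes "finite B"
  shows "lookup (\<Sum>i\<in>B. var i) (single j 1) = (if j \<in> B then 1 else 0)"
  using assms by (simp add: lookup_sum lookup_var)

lemma keys_sum_var: "keys (\<Sum>i\<in>B. var i :: 'k::field mpoly) \<subseteq> (\<lambda>i. single i 1) ` B"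
proof
  fix m assume "m \<in> keys (\<Sum>i\<in>B. var i :: 'k mpoly)"
  then have "(\<Sum>i\<in>B. lookup (var i :: 'k mpoly) m) \<noteq> 0" by (simp add: in_keys_iff lookup_sum)
  then obtain i where "i \<in> B" "lookup (var i :: 'k mpoly) m \<noteq> 0"
    by (meson sum.not_neutral_contains_not_neutral)
  then show "m \<in> (\<lambda>i. single i 1) ` B" by (auto simp: lookup_var split: if_splits)
qed

text \<open>
  A polynomial ring in the variables outside \<open>A\<close>, seen as a quotient by the prime of \<open>A\<close>. The colouring \<open>\<kappa>\<close>
  is defined on all variables, and \<open>v c\<close> is a remaining variable of colour \<open>c\<close>, to be eliminated by means of
  the sum of that colour.
\<close>

context
  fixes n k :: nat and \<kappa> :: "nat \<Rightarrow> nat" and A :: "nat set" and v :: "nat \<Rightarrow> nat"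
  assumes A: "A \<subseteq> {1..n}" and v: "\<And>c. c < k \<Longrightarrow> v c \<in> {1..n} - A \<and> \<kappa> (v c) = c"
begin

text \<open>
  Modulo the variables in \<open>A\<close> and the first \<open>j\<close> colour sums, the chosen variable \<open>v c\<close> of each colour
  \<open>c < j\<close> is minus the sum of the other remaining variables of its colour. This substitution carries
  that out.
\<close>

private definition eliminate :: "nat \<Rightarrow> nat \<Rightarrow> 'k::field mpoly" where
  "eliminate j i = (if i \<in> A then 0
     else if \<kappa> i < j \<and> i = v (\<kappa> i) then - (\<Sum>l\<in>{l\<in>{1..n} - A. \<kappa> l = \<kappa> i \<and> l \<noteq> i}. var l)
     else var i)"

private lemma eliminate_closed:
  assumes "i \<in> {1..n}"
  shows "eliminate j i \<in> (polys n :: 'k::field mpoly set)"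
proof -
  have "(var i :: 'k mpoly) \<in> polys n" by (rule var_mem_polys[OF assms])
  moreover have "(\<Sum>l\<in>{l\<in>{1..n} - A. \<kappa> l = \<kappa> i \<and> l \<noteq> i}. var l :: 'k mpoly) \<in> polys n"
    by (intro polys.closed var_mem_polys) auto
  ultimately show ?thesis by (simp add: eliminate_def polys.zero_closed polys.uminus_closed)
qed

private lemma eliminate_sum_colour:
  assumes "c < j" "j \<le> k"
  shows "(\<Sum>i\<in>{i\<in>{1..n}. \<kappa> i = c}. eliminate j i) = (0 :: 'k::field mpoly)"
proof -
  have vc: "v c \<in> {1..n}" "v c \<notin> A" "\<kappa> (v c) = c" using v[of c] assms by auto
  have "(\<Sum>i\<in>{i\<in>{1..n}. \<kappa> i = c}. eliminate j i :: 'k mpoly) = (\<Sum>i\<in>{i\<in>{1..n} - A. \<kappa> i = c}. eliminate j i)"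
    by (intro sum.mono_neutral_right) (auto simp: eliminate_def)
  also have "{i\<in>{1..n} - A. \<kappa> i = c} = insert (v c) {l\<in>{1..n} - A. \<kappa> l = c \<and> l \<noteq> v c}"
    using vc by auto
  also have "(\<Sum>i\<in>insert (v c) {l\<in>{1..n} - A. \<kappa> l = c \<and> l \<noteq> v c}. eliminate j i :: 'k mpoly) =
      eliminate j (v c) + (\<Sum>i\<in>{l\<in>{1..n} - A. \<kappa> l = c \<and> l \<noteq> v c}. eliminate j i)"
    by (subst sum.insert) auto
  also have "(\<Sum>i\<in>{l\<in>{1..n} - A. \<kappa> l = c \<and> l \<noteq> v c}. eliminate j i :: 'k mpoly) =
      (\<Sum>i\<in>{l\<in>{1..n} - A. \<kappa> l = c \<and> l \<noteq> v c}. var i)"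
    by (intro sum.cong) (auto simp: eliminate_def)
  also have "eliminate j (v c) = - (\<Sum>i\<in>{l\<in>{1..n} - A. \<kappa> l = c \<and> l \<noteq> v c}. var i :: 'k mpoly)"
    using vc assms by (simp add: eliminate_def)
  finally show ?thesis by simp
qed

text \<open>
  The ideals along the sequence of colour sums are kernels, so the next entry is a nonzerodivisor as
  soon as the substitution does not annihilate it.
\<close>

private lemma foldl_adjoin_colour_sums:
  assumes "j \<le> k"
  shows "foldl (polys.adjoin n) (vars_prime n A) (map (colour_sum n \<kappa>) [0..<j]) =
    kernel n (eliminate j :: nat \<Rightarrow> 'k::field mpoly)" (is "?J = _")
proof (rule eq_kernelI)
  let ?as = "map (colour_sum n \<kappa>) [0..<j] :: 'k mpoly list"
  have as: "set ?as \<subseteq> polys n" by (auto intro: colour_sum_closed)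
  show J: "polys.is_ideal n ?J"
    by (rule polys.is_ideal_foldl_adjoin[OF is_ideal_vars_prime as])
  show "?J \<subseteq> kernel n (eliminate j)"
  proof (rule foldl_adjoin_subset[OF is_ideal_kernel])
    show "vars_prime n A \<subseteq> kernel n (eliminate j :: nat \<Rightarrow> 'k mpoly)"
      using subst_eq_0[of _ n A "eliminate j :: nat \<Rightarrow> 'k mpoly"]
      by (auto simp: kernel_def eliminate_def vars_prime_def)
    show "set ?as \<subseteq> kernel n (eliminate j)"
    proof
      fix a assume "a \<in> set ?as"
      then obtain c where c: "c < j" "a = colour_sum n \<kappa> c" by auto
      have "subst (eliminate j) a = 0"
        unfolding c(2) colour_sum_def subst_sum subst_var using c(1) assms by (rule eliminate_sum_colour)
      then show "a \<in> kernel n (eliminate j)" by (simp add: kernel_def c(2) colour_sum_closed)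
    qed
  qed
  fix i assume i: "i \<in> {1..n}"
  show "eliminate j i \<in> polys n" by (rule eliminate_closed[OF i])
  have sub: "vars_prime n A \<subseteq> ?J" by (rule polys.subset_foldl_adjoin)
  have varA: "var l \<in> ?J" if "l \<in> A" for l
  proof -
    have "var l \<in> polys n" using that A by (intro var_mem_polys) auto
    then have "(var l :: 'k mpoly) \<in> vars_prime n A" using that by (simp add: vars_prime_def var_def)
    then show ?thesis using sub by blast
  qed
  show "var i - eliminate j i \<in> ?J"
  proof (cases "i \<in> A")
    case True
    then show ?thesis using varA by (simp add: eliminate_def)
  next
    case notA: False
    show ?thesis
    proof (cases "\<kappa> i < j \<and> i = v (\<kappa> i)")
      case True
      let ?c = "\<kappa> i"
      have "colour_sum n \<kappa> ?c \<in> set ?as" using True by simp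
      then have "colour_sum n \<kappa> ?c \<in> ?J"
        using mem_foldl_adjoin[OF is_ideal_vars_prime] as by blast
      moreover have "(\<Sum>l\<in>{l\<in>A. \<kappa> l = ?c}. var l) \<in> ?J"
        using varA by (intro polys.is_ideal_sum[OF J]) auto
      moreover have "(var i - eliminate j i :: 'k mpoly) = colour_sum n \<kappa> ?c - (\<Sum>l\<in>{l\<in>A. \<kappa> l = ?c}. var l)"
      proof -
        let ?R = "{l\<in>{1..n} - A. \<kappa> l = ?c \<and> l \<noteq> i}"
        have "{l\<in>{1..n}. \<kappa> l = ?c} = insert i ?R \<union> {l\<in>A. \<kappa> l = ?c}" using i notA A by auto
        then have "colour_sum n \<kappa> ?c = (\<Sum>l\<in>insert i ?R \<union> {l\<in>A. \<kappa> l = ?c}. var l :: 'k mpoly)"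
          by (simp only: colour_sum_def)
        also have "\<dots> = (\<Sum>l\<in>insert i ?R. var l) + (\<Sum>l\<in>{l\<in>A. \<kappa> l = ?c}. var l)"
          using finite_subset[OF A] notA by (intro sum.union_disjoint) auto
        also have "(\<Sum>l\<in>insert i ?R. var l :: 'k mpoly) = var i + (\<Sum>l\<in>?R. var l)"
          by (rule sum.insert) auto
        finally show ?thesis using True notA by (simp add: eliminate_def algebra_simps)
      qed
      ultimately show ?thesis using polys.is_idealD(7)[OF J] by simp
    next
      case False
      have "(eliminate j i :: 'k mpoly) = var i" unfolding eliminate_def using False notA by (simp only: if_False)
      then show ?thesis using polys.is_idealD(2)[OF J] by simp
    qed
  qed
qed

text \<open>
  The variable \<open>v j\<close> is not yet eliminated at stage \<open>j\<close> and occurs with coefficient 1.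
\<close>

private lemma nonzerodivisor_colour_sum:
  assumes "j < k"
  shows "polys.nonzerodivisor_mod n (colour_sum n \<kappa> j :: 'k::field mpoly) (kernel n (eliminate j))"
proof (rule nonzerodivisor_mod_kernel)
  have "subst (eliminate j) (colour_sum n \<kappa> j :: 'k mpoly) = (\<Sum>i\<in>{i\<in>{1..n}. \<kappa> i = j}. eliminate j i)"
    by (simp add: colour_sum_def subst_sum)
  also have "\<dots> = (\<Sum>i\<in>{i\<in>{1..n} - A. \<kappa> i = j}. var i)"
    by (intro sum.mono_neutral_cong_right) (auto simp: eliminate_def)
  finally have "lookup (subst (eliminate j) (colour_sum n \<kappa> j :: 'k mpoly)) (single (v j) 1) = 1"
    using v[OF assms] by (simp only: lookup_sum_var) (subst lookup_sum_var, auto)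
  then show "subst (eliminate j) (colour_sum n \<kappa> j :: 'k mpoly) \<noteq> 0" by auto
qed

lemma weakly_regular_colour_sums:
  "polys.weakly_regular n (vars_prime n A :: 'k::field mpoly set) (map (colour_sum n \<kappa>) [0..<k])"
  unfolding polys.weakly_regular_def
proof (intro allI impI)
  fix i assume "i < length (map (colour_sum n \<kappa> :: nat \<Rightarrow> 'k mpoly) [0..<k])"
  then have i: "i < k" by simp
  show "polys.nonzerodivisor_mod n (map (colour_sum n \<kappa>) [0..<k] ! i)
     (foldl (polys.adjoin n) (vars_prime n A :: 'k mpoly set) (take i (map (colour_sum n \<kappa>) [0..<k])))"
    using i nonzerodivisor_colour_sum[OF i] by (simp add: take_map foldl_adjoin_colour_sums)
qed

private lemma keys_eliminate: "keys (eliminate j i :: 'k::field mpoly) \<subseteq> range (\<lambda>l. single l 1)"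
  using keys_sum_var[of "{l\<in>{1..n} - A. \<kappa> l = \<kappa> i \<and> l \<noteq> i}", where 'k = 'k]
  by (auto simp: eliminate_def var_def)

private lemma lookup_eliminate_mult_single:
  "lookup (eliminate j i * eliminate j i :: 'k::field mpoly) (single u 1) = 0"
proof (rule ccontr)
  assume "lookup (eliminate j i * eliminate j i :: 'k mpoly) (single u 1) \<noteq> 0"
  then have "single u 1 \<in> keys (eliminate j i * eliminate j i :: 'k mpoly)"
    by (simp add: in_keys_iff)
  then obtain a b where ab: "single u 1 = a + b"
    "a \<in> keys (eliminate j i :: 'k mpoly)" "b \<in> keys (eliminate j i :: 'k mpoly)"
    by (elim keys_multE)
  obtain l l' where "a = single l 1" "b = single l' 1"
    using keys_eliminate ab(2,3) by blast
  then have *: "single u (1::nat) = single l 1 + single l' 1" using ab by simp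
  have "lookup (single l (1::nat) + single l' 1) l \<le> lookup (single u 1) l"
    unfolding * by simp
  moreover have "l \<in> {u}" "l' \<in> {u}"
    using arg_cong[OF *, of keys] by (auto simp: keys_add_nat)
  ultimately show False by (simp add: lookup_add)
qed

private lemma keys_eliminate_avoid:
  assumes "u \<notin> A" "i \<noteq> u" "\<kappa> i = \<kappa> u \<Longrightarrow> i \<noteq> v (\<kappa> i)"
    and "m \<in> keys (eliminate j i :: 'k::field mpoly)"
  shows "u \<notin> keys m"
  using assms keys_sum_var[of "{l\<in>{1..n} - A. \<kappa> l = \<kappa> i \<and> l \<noteq> i}", where 'k = 'k]
  by (auto simp: eliminate_def var_def split: if_splits)

text \<open>
  It remains to see that the mixed form survives the elimination of one variable of each colour. If
  \<open>w\<close> is the variable eliminated in its colour and \<open>u\<close> is another variable of that colour, then \<open>x\<^sub>u\<close> can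
  only be produced from \<open>x\<^sub>u\<close> or \<open>x\<^sub>w\<close>. So if \<open>u\<close> occurs in the form and \<open>w\<close> does not interfere, the
  coefficient of \<open>x\<^sub>u\<close>, or of its square, is still 1.
\<close>

lemma weakly_regular_colour_sums_mixed_form:
  fixes D E :: "nat set"
  assumes DE: "finite D" "finite E" "D \<inter> E = {}"
    and uw: "u \<in> {1..n} - A" "w \<in> {1..n} - A" "\<kappa> u = \<kappa> w" "\<kappa> u < k" "v (\<kappa> w) = w"
    and crit: "u \<in> D \<and> w \<notin> D \<or> u \<in> E \<and> w \<notin> D \<union> E"
  shows "polys.weakly_regular n (vars_prime n A :: 'k::field mpoly set)
    (map (colour_sum n \<kappa>) [0..<k] @ [mixed_form D E])"
proof -
  let ?b = "mixed_form D E :: 'k mpoly" and ?\<sigma> = "eliminate k :: nat \<Rightarrow> 'k mpoly"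
  have sb: "subst ?\<sigma> ?b = (\<Sum>i\<in>D. ?\<sigma> i) + (\<Sum>i\<in>E. ?\<sigma> i * ?\<sigma> i)"
    by (simp add: mixed_form_def subst_add subst_sum subst_mult)
  have "w \<noteq> u" using crit by auto
  then have \<sigma>u: "?\<sigma> u = var u" using uw by (auto simp: eliminate_def)
  have avoid: "u \<notin> keys m" if "i \<noteq> u" "i \<noteq> w" "m \<in> keys (?\<sigma> i)" for i m
    using that uw by (intro keys_eliminate_avoid[of u i]) auto
  have "subst ?\<sigma> ?b \<noteq> 0"
    using crit
  proof
    assume u: "u \<in> D \<and> w \<notin> D"
    have "lookup (?\<sigma> i) (single u 1) = (if i = u then 1 else 0)" if "i \<in> D" for i
    proof (cases "i = u")
      case True
      then show ?thesis using \<sigma>u u by (auto simp: lookup_var)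
    next
      case False
      then have "single u 1 \<notin> keys (?\<sigma> i)" using avoid[of i] that u by fastforce
      then show ?thesis using False by (simp add: in_keys_iff)
    qed
    then have "(\<Sum>i\<in>D. lookup (?\<sigma> i) (single u 1)) = 1"
      using u DE by simp
    then have "lookup (subst ?\<sigma> ?b) (single u 1) = 1"
      unfolding sb lookup_add lookup_sum lookup_eliminate_mult_single by simp
    then show ?thesis by auto
  next
    assume u: "u \<in> E \<and> w \<notin> D \<union> E"
    have "lookup (?\<sigma> i) (single u 2) = 0" for i
    proof (rule ccontr)
      assume "lookup (?\<sigma> i) (single u 2) \<noteq> 0"
      then have "single u 2 \<in> keys (?\<sigma> i)" by (simp add: in_keys_iff)
      then obtain l where l: "single u (2::nat) = single l 1" using keys_eliminate by blast
      have "l = u" using arg_cong[OF l, of keys] by simp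
      then show False using arg_cong[OF l, of "\<lambda>m. lookup m u"] by simp
    qed
    moreover have "lookup (?\<sigma> i * ?\<sigma> i) (single u 2) = (if i = u then 1 else 0)"
      if "i \<in> E" for i
    proof (cases "i = u")
      case True
      have "single u (1::nat) + single u 1 = single u 2"
        by (simp add: numeral_2_eq_2 flip: single_add)
      then show ?thesis using True \<sigma>u u by (auto simp: var_def mult_single)
    next
      case False
      have "single u 2 \<notin> keys (?\<sigma> i * ?\<sigma> i)"
      proof
        assume "single u 2 \<in> keys (?\<sigma> i * ?\<sigma> i)"
        then obtain a b where ab: "single u 2 = a + b" "a \<in> keys (?\<sigma> i)" "b \<in> keys (?\<sigma> i)"
          by (elim keys_multE)
        then have "u \<notin> keys (a + b)"
          using avoid[of i] False u that by (auto simp: keys_add_nat)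
        then show False by (simp flip: ab(1))
      qed
      then show ?thesis using False by (simp add: in_keys_iff)
    qed
    then have "(\<Sum>i\<in>E. lookup (?\<sigma> i * ?\<sigma> i) (single u 2)) = 1"
      using u DE by simp
    ultimately have "lookup (subst ?\<sigma> ?b) (single u 2) = 1"
      unfolding sb lookup_add lookup_sum by simp
    then show ?thesis by auto
  qed
  then have "polys.nonzerodivisor_mod n ?b
      (foldl (polys.adjoin n) (vars_prime n A) (map (colour_sum n \<kappa>) [0..<k]))"
    by (simp add: foldl_adjoin_colour_sums nonzerodivisor_mod_kernel)
  then show ?thesis
    using weakly_regular_colour_sums by (simp add: polys.weakly_regular_snoc)
qed

end

text \<open>
  Gluing the facets one by one. The ideal of the intersection of a facet with the union of
  the earlier ones is given by \<open>ideal_plus_Inter_vars_prime\<close>.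
\<close>

lemma weakly_regular_Inter_vars_prime:
  fixes A :: "nat \<Rightarrow> nat set" and as :: "'k::field mpoly list"
  assumes "set as \<subseteq> polys n" "b \<in> polys n" "1 \<le> s"
    and "\<And>i. i \<in> {1..s} \<Longrightarrow> polys.weakly_regular n (vars_prime n (A i)) (as @ [b])"
    and "\<And>t. t \<in> {1..<s} \<Longrightarrow> polys.weakly_regular n (\<Inter>i\<in>{1..t}. vars_prime n (A i \<union> A (Suc t))) as"
  shows "polys.weakly_regular n (\<Inter>i\<in>{1..s}. vars_prime n (A i)) (as @ [b])"
  using assms(3-)
proof (induction s rule: dec_induct)
  case base
  then show ?case by simp
next
  case (step s)
  have ne: "{1..s} \<noteq> {}" using step.hyps by simp
  have eq: "(\<Inter>i\<in>{1..Suc s}. vars_prime n (A i)) = (\<Inter>i\<in>{1..s}. vars_prime n (A i)) \<inter> vars_prime n (A (Suc s))"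
    using step.hyps by (auto simp: atLeastAtMostSuc_conv)
  show ?case
    unfolding eq
  proof (rule polys.weakly_regular_Int)
    show "polys.weakly_regular n (polys.ideal_plus (\<Inter>i\<in>{1..s}. vars_prime n (A i)) (vars_prime n (A (Suc s)))) as"
      unfolding ideal_plus_Inter_vars_prime[OF ne] using step.prems(2)[of s] step.hyps by simp
  qed (use step assms(1,2) ne in \<open>auto intro: is_ideal_Inter_vars_prime is_ideal_vars_prime\<close>)
qed

section \<open>The depth of the intersection\<close>

lemma ex_surjective_colouring:
  fixes k :: nat
  assumes k: "1 \<le> k" and M: "\<And>M. M \<in> \<G> \<Longrightarrow> finite M \<and> k \<le> card M"
    and disj: "\<And>M N. M \<in> \<G> \<Longrightarrow> N \<in> \<G> \<Longrightarrow> M \<noteq> N \<Longrightarrow> M \<inter> N = {}"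
  obtains \<kappa> :: "'a \<Rightarrow> nat" where "\<And>i. \<kappa> i < k" "\<And>M c. M \<in> \<G> \<Longrightarrow> c < k \<Longrightarrow> \<exists>i\<in>M. \<kappa> i = c"
proof -
  have "\<exists>h :: 'a \<Rightarrow> nat. \<forall>c<k. \<exists>i\<in>M. h i = c" if M': "M \<in> \<G>" for M
  proof -
    obtain h where h: "bij_betw h M {0..<card M}" using ex_bij_betw_finite_nat M[OF M'] by blast
    have "\<exists>i\<in>M. h i = c" if "c < k" for c
    proof -
      have "c \<in> h ` M" using h that M[OF M'] by (simp add: bij_betw_def)
      then show ?thesis by blast
    qed
    then show ?thesis by blast
  qed
  then obtain h :: "'a set \<Rightarrow> 'a \<Rightarrow> nat" where h: "\<And>M c. M \<in> \<G> \<Longrightarrow> c < k \<Longrightarrow> \<exists>i\<in>M. h M i = c" by metis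
  \<comment> \<open>The inner value is arbitrary outside the members of \<open>\<G>\<close> and may be too large inside; it is reset to stay below \<open>k\<close>.\<close>
  define \<kappa> where "\<kappa> i = (let c = h (THE M. M \<in> \<G> \<and> i \<in> M) i in if c < k then c else 0)" for i
  show thesis
  proof (rule that[of \<kappa>])
    show "\<kappa> i < k" for i using k by (simp add: \<kappa>_def Let_def)
    fix M c assume M: "M \<in> \<G>" and c: "c < k"
    then obtain i where i: "i \<in> M" "h M i = c" using h by blast
    have "(THE M. M \<in> \<G> \<and> i \<in> M) = M" using M i disj by (intro the_equality) auto
    then show "\<exists>i\<in>M. \<kappa> i = c" using i c by (intro bexI[of _ i]) (simp_all add: \<kappa>_def)
  qed
qed

lemma (in subring_of_type) nonzerodivisor_mod_INT:
  "(\<And>i. i \<in> T \<Longrightarrow> nonzerodivisor_mod a (J i)) \<Longrightarrow> nonzerodivisor_mod a (\<Inter>i\<in>T. J i)"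
  unfolding nonzerodivisor_mod_def by blast

text \<open>
  Splitting the facets into two groups cuts the complex along the intersections between the groups.
\<close>

lemma length_le_of_facet_cut:
  fixes A :: "nat \<Rightarrow> nat set" and as :: "'k::field mpoly list"
  assumes L: "L \<subseteq> T" and G: "G \<subseteq> {1..n}"
    and cut: "\<And>i j. i \<in> L \<Longrightarrow> j \<in> T - L \<Longrightarrow> {1..n} - A i - A j \<subseteq> G"
    and a: "a \<in> L" "\<not> {1..n} - A a \<subseteq> G" and b: "b \<in> T - L" "\<not> {1..n} - A b \<subseteq> G"
    and as: "set as \<subseteq> vars_prime n {1..n}"
      "polys.weakly_regular n (\<Inter>i\<in>T. vars_prime n (A i)) as"
  shows "length as \<le> Suc (card G)"
proof -
  obtain u where u: "u \<in> {1..n} - A a" "u \<notin> G" using a(2) by blast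
  obtain w where w: "w \<in> {1..n} - A b" "w \<notin> G" using b(2) by blast
  let ?V = "(\<Union>i\<in>L. {1..n} - A i) - G"
  show ?thesis
  proof (rule length_le_of_cut[where V = ?V and ?u0.0 = u and i = a and ?w0.0 = w and j = b])
    show "w \<in> {1..n} - G - ?V" using w cut b by blast
    fix i x y assume "i \<in> T" and x: "x \<in> ?V" and y: "y \<in> {1..n} - G - ?V"
    show "x \<in> A i \<or> y \<in> A i"
    proof (cases "i \<in> L")
      case True then show ?thesis using y by blast
    next
      case False then show ?thesis using x cut \<open>i \<in> T\<close> by blast
    qed
  qed (use assms u w in blast)+
qed

text \<open>
  The combinatorial form of the hypotheses. For the complements \<open>F i\<close> they say: no facet contains
  another, no three facets meet, the first two meet, and all later ones are pairwise disjoint.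
\<close>

context
  fixes n s :: nat and A :: "nat \<Rightarrow> nat set"
  assumes A: "\<And>i. i \<in> {1..s} \<Longrightarrow> A i \<subseteq> {1..n}" and s: "3 \<le> s"
    and antichain: "\<And>i j. i \<in> {1..s} \<Longrightarrow> j \<in> {1..s} \<Longrightarrow> i \<noteq> j \<Longrightarrow> \<not> A i \<subseteq> A j"
    and triple: "\<And>i j k. i \<in> {1..s} \<Longrightarrow> j \<in> {1..s} \<Longrightarrow> k \<in> {1..s} \<Longrightarrow> i \<noteq> j \<Longrightarrow> i \<noteq> k \<Longrightarrow> j \<noteq> k \<Longrightarrow>
      A i \<union> A j \<union> A k = {1..n}"
    and edge12: "A 1 \<union> A 2 \<noteq> {1..n}"
    and leaves: "\<And>j k. j \<in> {3..s} \<Longrightarrow> k \<in> {3..s} \<Longrightarrow> j \<noteq> k \<Longrightarrow> A j \<union> A k = {1..n}"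
begin

private definition F :: "nat \<Rightarrow> nat set" where "F i = {1..n} - A i"

private abbreviation I :: "'k::field mpoly set" where
  "I \<equiv> (\<Inter>i\<in>{1..s}. vars_prime n (A i))"

private lemma F_Int_empty_iff:
  assumes "i \<in> {1..s}" "j \<in> {1..s}"
  shows "F i \<inter> F j = {} \<longleftrightarrow> A i \<union> A j = {1..n}"
  using A[OF assms(1)] A[OF assms(2)] unfolding F_def by blast

private lemma F_triple:
  "i \<in> {1..s} \<Longrightarrow> j \<in> {1..s} \<Longrightarrow> k \<in> {1..s} \<Longrightarrow> i \<noteq> j \<Longrightarrow> i \<noteq> k \<Longrightarrow> j \<noteq> k \<Longrightarrow>
    x \<in> F i \<Longrightarrow> x \<in> F j \<Longrightarrow> x \<notin> F k"
  using triple[of i j k] unfolding F_def by blast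

private lemma F_antichain: "i \<in> {1..s} \<Longrightarrow> j \<in> {1..s} \<Longrightarrow> i \<noteq> j \<Longrightarrow> \<exists>x. x \<in> F i \<and> x \<notin> F j"
  using antichain[of j i] A[of j] unfolding F_def by blast

private lemma one_two: "1 \<in> {1..s}" "2 \<in> {1..s}" using s by auto

private lemma leaf_in: "j \<in> {3..s} \<Longrightarrow> j \<in> {1..s}" "j \<in> {3..s} \<Longrightarrow> j \<noteq> 1" "j \<in> {3..s} \<Longrightarrow> j \<noteq> 2" by auto

private lemma F12: "F 1 \<inter> F 2 \<noteq> {}"
  using edge12 F_Int_empty_iff[OF one_two] by blast

private lemma index_cases:
  assumes "i \<in> {1..s}"
  obtains "i = 1" | "i = 2" | "i \<in> {3..s}"
  using assms by fastforce

private lemma F_nonempty: "i \<in> {1..s} \<Longrightarrow> F i \<noteq> {}"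
  using F_antichain[of i 1] F_antichain[of i 2] one_two by (cases "i = 1") auto

text \<open>
  A facet that meets no other facet is a connected component: cut along the empty set.
\<close>

lemma length_le_disconnected:
  fixes as :: "'k::field mpoly list"
  assumes j: "j \<in> {3..s}" "A 1 \<union> A j = {1..n}" "A 2 \<union> A j = {1..n}"
    and as: "set as \<subseteq> vars_prime n {1..n}" "polys.weakly_regular n I as"
  shows "length as \<le> 1"
proof -
  have "length as \<le> Suc (card ({} :: nat set))"
  proof (rule length_le_of_facet_cut[where L = "{j}" and a = j and b = 1, OF _ _ _ _ _ _ _ as])
    fix i k assume i: "i \<in> {j}" and k: "k \<in> {1..s} - {j}"
    then have "k \<in> {1..s}" by blast
    then have "A j \<union> A k = {1..n}"
      using j k leaves[of j k] by (elim index_cases) auto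
    then show "{1..n} - A i - A k \<subseteq> {}" using i by blast
  qed (use j one_two F_nonempty[of j] F_nonempty[of 1] leaf_in[OF j(1)] in \<open>auto simp: F_def\<close>)
  then show ?thesis by simp
qed

text \<open>
  The facets 1, 2 and \<open>k\<close> meet pairwise but not all three, so a triangle runs around them. The other
  facets do not interfere: they are disjoint from the facet \<open>k\<close>.
\<close>

lemma length_le_cycle:
  fixes as :: "'k::field mpoly list"
  assumes k: "k \<in> {3..s}" "A 1 \<union> A k \<noteq> {1..n}" "A 2 \<union> A k \<noteq> {1..n}"
    and as: "set as \<subseteq> vars_prime n {1..n}" "polys.weakly_regular n I as"
  shows "length as \<le> 2"
proof -
  note ks = leaf_in[OF k(1)]
  obtain p where p: "p \<in> F 1" "p \<in> F 2" using F12 by blast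
  obtain u where u: "u \<in> F 1" "u \<in> F k" using F_Int_empty_iff[OF one_two(1) ks(1)] k by blast
  obtain v where v: "v \<in> F 2" "v \<in> F k" using F_Int_empty_iff[OF one_two(2) ks(1)] k by blast
  have pk: "p \<notin> F k" by (rule F_triple[of 1 2 k]) (use p one_two ks in auto)
  have v1: "v \<notin> F 1" by (rule F_triple[of 2 k 1]) (use v one_two ks in auto)
  show ?thesis
  proof (rule length_le_of_cycle[where k = k and B = "F 1" and p = p and u = u and v = v and a = 1 and b = 2,
        OF _ _ _ _ _ _ _ _ _ _ _ _ _ as])
    fix i x y assume i: "i \<in> {1..s}" "i \<noteq> k" and x: "x \<in> F 1" "x \<in> {1..n} - A i - A k"
      and y: "y \<notin> F 1" "y \<in> {1..n} - A i - A k"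
    have "i \<noteq> 1" using y by (auto simp: F_def)
    then show False using F_triple[of 1 i k x] i x one_two ks by (auto simp: F_def)
  qed (use p u v pk v1 one_two ks in \<open>auto simp: F_def\<close>)
qed

text \<open>
  The graph of meeting facets has no cycle, so at each edge the facets can be split into two groups that
  meet only in the intersection belonging to that edge.
\<close>

lemma length_le_tree:
  fixes as :: "'k::field mpoly list"
  assumes tree: "\<And>j. j \<in> {3..s} \<Longrightarrow> A 1 \<union> A j = {1..n} \<or> A 2 \<union> A j = {1..n}"
    and ij: "i \<in> {1..s}" "j \<in> {1..s}" "i \<noteq> j" "A i \<union> A j \<noteq> {1..n}"
    and as: "set as \<subseteq> vars_prime n {1..n}" "polys.weakly_regular n I as"
  shows "length as \<le> Suc (card ({1..n} - A i - A j))"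
proof -
  have cut: "length as \<le> Suc (card (F a \<inter> F b))"
    if L: "L \<subseteq> {1..s}" "a \<in> L" "b \<in> {1..s} - L"
      and sep: "\<And>i j. i \<in> L \<Longrightarrow> j \<in> {1..s} - L \<Longrightarrow> i \<noteq> a \<or> j \<noteq> b \<Longrightarrow> A i \<union> A j = {1..n}" for L a b
  proof (rule length_le_of_facet_cut[where L = L and a = a and b = b, OF L(1) _ _ L(2) _ L(3) _ as])
    fix i j assume "i \<in> L" "j \<in> {1..s} - L"
    then show "{1..n} - A i - A j \<subseteq> F a \<inter> F b"
      using sep[of i j] by (cases "i = a \<and> j = b") (auto simp: F_def)
  next
    obtain x where "x \<in> F a" "x \<notin> F b" using F_antichain[of a b] L by blast
    then show "\<not> {1..n} - A a \<subseteq> F a \<inter> F b" by (auto simp: F_def)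
    obtain x where "x \<in> F b" "x \<notin> F a" using F_antichain[of b a] L by blast
    then show "\<not> {1..n} - A b \<subseteq> F a \<inter> F b" by (auto simp: F_def)
  qed (auto simp: F_def)
  have leaf: "length as \<le> Suc (card (F k \<inter> F b))"
    if k: "k \<in> {3..s}" and b: "b = 1 \<or> b = 2" and kb: "A b \<union> A k \<noteq> {1..n}" for k b
  proof (rule cut[of "{k}"])
    fix i j assume i: "i \<in> {k}" and j: "j \<in> {1..s} - {k}" and ne: "i \<noteq> k \<or> j \<noteq> b"
    have "j \<in> {1..s}" using j by blast
    then show "A i \<union> A j = {1..n}"
    proof (cases rule: index_cases)
      case 1 then show ?thesis using tree[OF k] b kb i j ne by (auto simp: Un_commute)
    next
      case 2 then show ?thesis using tree[OF k] b kb i j ne by (auto simp: Un_commute)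
    next
      case 3 then show ?thesis using leaves[of k j] k i j by auto
    qed
  qed (use k b one_two leaf_in[OF k] in auto)
  have mid: "length as \<le> Suc (card (F 1 \<inter> F 2))"
  proof (rule cut[of "{1} \<union> {k\<in>{3..s}. A 1 \<union> A k \<noteq> {1..n}}"])
    fix i j assume i: "i \<in> {1} \<union> {k\<in>{3..s}. A 1 \<union> A k \<noteq> {1..n}}"
      and j: "j \<in> {1..s} - ({1} \<union> {k\<in>{3..s}. A 1 \<union> A k \<noteq> {1..n}})" and ne: "i \<noteq> 1 \<or> j \<noteq> 2"
    have "j \<in> {1..s}" using j by blast
    then show "A i \<union> A j = {1..n}"
    proof (cases rule: index_cases)
      case 1 then show ?thesis using j by blast
    next
      case 2 then show ?thesis using i ne tree[of i] by (auto simp: Un_commute)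
    next
      case 3
      show ?thesis
      proof (cases "i = 1")
        case True then show ?thesis using j 3 by blast
      next
        case False
        then have "i \<in> {3..s}" "i \<noteq> j" using i j by auto
        then show ?thesis using leaves 3 by blast
      qed
    qed
  qed (use one_two in auto)
  have "length as \<le> Suc (card (F i \<inter> F j))"
    using ij(1)
  proof (cases rule: index_cases)
    case i: 1
    show ?thesis using ij(2)
    proof (cases rule: index_cases)
      case 1 then show ?thesis using i ij by simp
    next
      case 2 then show ?thesis using i mid by simp
    next
      case 3 then show ?thesis using i leaf[OF 3, of 1] ij by (simp add: Int_commute Un_commute)
    qed
  next
    case i: 2
    show ?thesis using ij(2)
    proof (cases rule: index_cases)
      case 1 then show ?thesis using i mid by (simp add: Int_commute)
    next
      case 2 then show ?thesis using i ij by simp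
    next
      case 3 then show ?thesis using i leaf[OF 3, of 2] ij by (simp add: Int_commute Un_commute)
    qed
  next
    case i: 3
    show ?thesis using ij(2)
    proof (cases rule: index_cases)
      case 1 then show ?thesis using leaf[OF i, of 1] ij by (simp add: Un_commute)
    next
      case 2 then show ?thesis using leaf[OF i, of 2] ij by (simp add: Un_commute)
    next
      case 3 then show ?thesis using leaves[OF i 3] ij by simp
    qed
  qed
  moreover have "{1..n} - A i - A j = F i \<inter> F j" by (auto simp: F_def)
  ultimately show ?thesis by simp
qed

private lemma var_mem_max: "i \<in> {1..n} \<Longrightarrow> (var i :: 'k::field mpoly) \<in> vars_prime n {1..n}"
  using var_mem_polys[of i n, where 'a = 'k] by (auto simp: vars_prime_def var_def)

private lemma colour_sum_mem_max: "(colour_sum n \<kappa> c :: 'k::field mpoly) \<in> vars_prime n {1..n}"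
  unfolding colour_sum_def by (intro polys.is_ideal_sum[OF is_ideal_vars_prime] var_mem_max) simp

private lemma colours_on_prime:
  fixes k :: nat
  assumes B: "B \<subseteq> {1..n}" and col: "\<And>c. c < k \<Longrightarrow> \<exists>i\<in>{1..n} - B. \<kappa> i = c"
  shows "polys.weakly_regular n (vars_prime n B :: 'k::field mpoly set) (map (colour_sum n \<kappa>) [0..<k])"
proof -
  obtain v where "\<And>c. c < k \<Longrightarrow> v c \<in> {1..n} - B \<and> \<kappa> (v c) = c" using col by metis
  then show ?thesis by (intro weakly_regular_colour_sums[OF B, of k v]) auto
qed

text \<open>
  The sum of all variables lies in none of the primes.
\<close>

lemma ex_regular_one:
  "\<exists>a. a \<in> vars_prime n {1..n} \<and> polys.weakly_regular n (I :: 'k::field mpoly set) [a]"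
proof (intro exI conjI)
  let ?a = "colour_sum n (\<lambda>_. 0) 0 :: 'k mpoly"
  show "?a \<in> vars_prime n {1..n}" by (rule colour_sum_mem_max)
  have "polys.nonzerodivisor_mod n ?a (vars_prime n (A i))" if i: "i \<in> {1..s}" for i
  proof -
    obtain x where "x \<in> {1..n} - A i" using F_nonempty[OF i] unfolding F_def by blast
    then have "polys.weakly_regular n (vars_prime n (A i)) (map (colour_sum n (\<lambda>_. 0)) [0..<1] :: 'k mpoly list)"
      by (intro colours_on_prime[OF A[OF i]]) auto
    then show ?thesis by (simp add: polys.weakly_regular_Cons)
  qed
  then show "polys.weakly_regular n I [?a]"
    unfolding polys.weakly_regular_Cons by (intro conjI polys.nonzerodivisor_mod_INT) auto
qed

text \<open>
  Each facet contains an intersection with a neighbour, hence all colours. For the last entry, facet 1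
  is handled by a variable \<open>u\<close> outside \<open>F\<^sub>2\<close> and a variable \<open>w\<close> of the same colour in \<open>F\<^sub>1 \<inter> F\<^sub>2\<close>, and facet 2
  symmetrically. A facet \<open>j > 2\<close> that is not covered by \<open>F\<^sub>1\<close> and \<open>F\<^sub>2\<close> offers \<open>w\<close> outside both and \<open>u\<close> in its
  intersection with a neighbour. If it is covered, it meets both, so there is only one colour, and \<open>u\<close>
  in \<open>F\<^sub>1\<close> and \<open>w\<close> in \<open>F\<^sub>2\<close> serve.

  On the gluing locus only the colour sums have to be regular. In a tree this locus is a single
  simplex. With one colour it may be a union of two simplices, but then there is a single entry,
  which has to avoid each of the two primes.
\<close>

lemma ex_regular_colours:
  fixes \<kappa> :: "nat \<Rightarrow> nat" and k :: nat
  assumes k: "1 \<le> k" and \<kappa>: "\<And>i. \<kappa> i < k"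
    and colours: "\<And>i j c. i \<in> {1..s} \<Longrightarrow> j \<in> {1..s} \<Longrightarrow> i \<noteq> j \<Longrightarrow> A i \<union> A j \<noteq> {1..n} \<Longrightarrow> c < k \<Longrightarrow>
      \<exists>x\<in>{1..n} - A i - A j. \<kappa> x = c"
    and conn: "\<And>j. j \<in> {3..s} \<Longrightarrow> A 1 \<union> A j \<noteq> {1..n} \<or> A 2 \<union> A j \<noteq> {1..n}"
    and tree: "k = 1 \<or> (\<forall>j\<in>{3..s}. A 1 \<union> A j = {1..n} \<or> A 2 \<union> A j = {1..n})"
  shows "\<exists>as :: 'k::field mpoly list. length as = Suc k \<and> set as \<subseteq> vars_prime n {1..n} \<and>
    polys.weakly_regular n I as"
proof -
  let ?cs = "map (colour_sum n \<kappa>) [0..<k] :: 'k mpoly list"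
  let ?D = "F 1 - F 2" and ?E = "F 2 - F 1"
  let ?b = "mixed_form ?D ?E :: 'k mpoly"
  have col: "\<exists>x\<in>F i \<inter> F j. \<kappa> x = c"
    if "i \<in> {1..s}" "j \<in> {1..s}" "i \<noteq> j" "F i \<inter> F j \<noteq> {}" "c < k" for i j c
    using colours[of i j c] that F_Int_empty_iff[of i j] by (auto simp: F_def)
  have nbr: "\<exists>j\<in>{1..s}. i \<noteq> j \<and> F i \<inter> F j \<noteq> {}" if i: "i \<in> {1..s}" for i
    using i
  proof (cases rule: index_cases)
    case 1 then show ?thesis using F12 one_two by (intro bexI[of _ 2]) auto
  next
    case 2 then show ?thesis using F12 one_two by (intro bexI[of _ 1]) auto
  next
    case 3
    then show ?thesis
      using conn[OF 3] F_Int_empty_iff[OF one_two(1) i] F_Int_empty_iff[OF one_two(2) i] one_two leaf_in[OF 3]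
      by (metis Int_commute)
  qed
  have witness: "\<exists>u w. u \<in> F i \<and> w \<in> F i \<and> \<kappa> u = \<kappa> w \<and> (u \<in> ?D \<and> w \<notin> ?D \<or> u \<in> ?E \<and> w \<notin> ?D \<union> ?E)"
    if i: "i \<in> {1..s}" for i
    using i
  proof (cases rule: index_cases)
    case 1
    obtain u where u: "u \<in> F 1" "u \<notin> F 2" using F_antichain[OF one_two] by auto
    obtain w where w: "w \<in> F 1 \<inter> F 2" "\<kappa> w = \<kappa> u" using col[OF one_two _ F12 \<kappa>] by auto
    show ?thesis using 1 u w by (intro exI[of _ u] exI[of _ w]) auto
  next
    case 2
    obtain u where u: "u \<in> F 2" "u \<notin> F 1" using F_antichain[OF one_two(2,1)] by auto
    obtain w where w: "w \<in> F 1 \<inter> F 2" "\<kappa> w = \<kappa> u" using col[OF one_two _ F12 \<kappa>] by auto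
    show ?thesis using 2 u w by (intro exI[of _ u] exI[of _ w]) auto
  next
    case 3
    note ne = leaf_in[OF 3]
    have not_both: "x \<notin> F 2" if "x \<in> F i" "x \<in> F 1" for x
      using F_triple[of i 1 2 x] that ne one_two by auto
    show ?thesis
    proof (cases "\<exists>w\<in>F i. w \<notin> F 1 \<and> w \<notin> F 2")
      case True
      then obtain w where w: "w \<in> F i" "w \<notin> F 1" "w \<notin> F 2" by blast
      consider "F i \<inter> F 1 \<noteq> {}" | "F i \<inter> F 2 \<noteq> {}"
        using conn[OF 3] F_Int_empty_iff[OF one_two(1) i] F_Int_empty_iff[OF one_two(2) i]
        by (metis Int_commute)
      then show ?thesis
      proof cases
        case 1
        then obtain u where u: "u \<in> F i \<inter> F 1" "\<kappa> u = \<kappa> w" using col[OF i one_two(1) ne(2) 1 \<kappa>] by auto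
        then show ?thesis using w not_both[of u] by (intro exI[of _ u] exI[of _ w]) auto
      next
        case 2
        then obtain u where u: "u \<in> F i \<inter> F 2" "\<kappa> u = \<kappa> w" using col[OF i one_two(2) ne(3) 2 \<kappa>] by auto
        then show ?thesis using w not_both[of u] by (intro exI[of _ u] exI[of _ w]) auto
      qed
    next
      case False
      obtain u where u: "u \<in> F i" "u \<notin> F 2" using F_antichain[OF i one_two(2) ne(3)] by auto
      obtain w where w: "w \<in> F i" "w \<notin> F 1" using F_antichain[OF i one_two(1) ne(2)] by auto
      have "u \<in> F 1" "w \<in> F 2" using False u w by auto
      then have "F 1 \<inter> F i \<noteq> {}" "F 2 \<inter> F i \<noteq> {}" using u w by auto
      then have "k = 1"
        using tree 3 F_Int_empty_iff[OF one_two(1) i] F_Int_empty_iff[OF one_two(2) i] by blast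
      then have "\<kappa> u = \<kappa> w" using \<kappa>[of u] \<kappa>[of w] by simp
      then show ?thesis using u w \<open>u \<in> F 1\<close> by (intro exI[of _ u] exI[of _ w]) auto
    qed
  qed
  have facet: "polys.weakly_regular n (vars_prime n (A i)) (?cs @ [?b])" if i: "i \<in> {1..s}" for i
  proof -
    obtain u w where uw: "u \<in> F i" "w \<in> F i" "\<kappa> u = \<kappa> w"
      "u \<in> ?D \<and> w \<notin> ?D \<or> u \<in> ?E \<and> w \<notin> ?D \<union> ?E"
      using witness[OF i] by blast
    obtain j where "j \<in> {1..s}" "i \<noteq> j" "F i \<inter> F j \<noteq> {}" using nbr[OF i] by blast
    then have "\<exists>x. x \<in> F i \<and> \<kappa> x = c" if "c < k" for c using col[OF i] that by blast
    then obtain v0 where v0: "\<And>c. c < k \<Longrightarrow> v0 c \<in> F i \<and> \<kappa> (v0 c) = c" by metis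
    \<comment> \<open>In the colour of \<open>w\<close>, the variable \<open>w\<close> itself is eliminated.\<close>
    define v where "v = v0(\<kappa> w := w)"
    show ?thesis
    proof (rule weakly_regular_colour_sums_mixed_form[OF A[OF i], where k = k and v = v and
          D = ?D and E = ?E and u = u and w = w])
      show "v c \<in> {1..n} - A i \<and> \<kappa> (v c) = c" if "c < k" for c
        using v0[OF that] uw by (auto simp: v_def F_def)
    qed (use uw \<kappa> in \<open>auto simp: v_def F_def\<close>)
  qed
  have glue: "polys.weakly_regular n (\<Inter>i\<in>{1..t}. vars_prime n (A i \<union> A (Suc t))) ?cs"
    if t: "t \<in> {1..<s}" for t
  proof -
    let ?T = "{i\<in>{1..t}. A i \<union> A (Suc t) \<noteq> {1..n}}"
    have ts: "Suc t \<in> {1..s}" using t by auto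
    have sub: "A i \<union> A (Suc t) \<subseteq> {1..n}" if "i \<in> {1..t}" for i
      using A[of i] A[OF ts] that t by auto
    have ne: "?T \<noteq> {}"
    proof (cases "t = 1")
      case True then show ?thesis using edge12 by (auto simp: numeral_2_eq_2)
    next
      case False
      then have "Suc t \<in> {3..s}" "1 \<in> {1..t}" "2 \<in> {1..t}" using t by auto
      then show ?thesis using conn[of "Suc t"] by blast
    qed
    have eq: "(\<Inter>i\<in>{1..t}. vars_prime n (A i \<union> A (Suc t))) = (\<Inter>i\<in>?T. vars_prime n (A i \<union> A (Suc t)) :: 'k mpoly set)"
    proof (intro equalityI subsetI INT_I)
      fix x :: "'k mpoly" and i
      assume x: "x \<in> (\<Inter>i\<in>?T. vars_prime n (A i \<union> A (Suc t)))" and i: "i \<in> {1..t}"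
      show "x \<in> vars_prime n (A i \<union> A (Suc t))"
      proof (cases "A i \<union> A (Suc t) = {1..n}")
        case True
        obtain i' where i': "i' \<in> ?T" using ne by blast
        then have "x \<in> vars_prime n (A i' \<union> A (Suc t))" using x by blast
        moreover have "A i' \<union> A (Suc t) \<subseteq> A i \<union> A (Suc t)" using sub[of i'] i' True by blast
        ultimately show ?thesis using vars_prime_mono by blast
      qed (use x i in blast)
    qed blast
    have each: "polys.weakly_regular n (vars_prime n (A i \<union> A (Suc t))) ?cs" if i: "i \<in> ?T" for i
    proof (rule colours_on_prime)
      show "A i \<union> A (Suc t) \<subseteq> {1..n}" using sub i by blast
      fix c assume "c < k"
      then have "\<exists>x\<in>{1..n} - A i - A (Suc t). \<kappa> x = c" using i t ts by (intro colours) auto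
      then show "\<exists>x\<in>{1..n} - (A i \<union> A (Suc t)). \<kappa> x = c" by auto
    qed
    show ?thesis
    proof (cases "k = 1")
      case True
      then have "?cs = [colour_sum n \<kappa> 0]" by simp
      then show ?thesis
        unfolding eq using each
        by (simp only: polys.weakly_regular_Cons) (intro conjI polys.nonzerodivisor_mod_INT, auto)
    next
      case False
      have "i = i'" if "i \<in> ?T" "i' \<in> ?T" for i i'
      proof -
        have *: "i = 1 \<or> i = 2 \<and> 2 \<le> t \<and> A 1 \<union> A (Suc t) = {1..n}" if i: "i \<in> ?T" for i
        proof -
          have "i \<in> {1..s}" "i \<noteq> Suc t" using i t by auto
          then show ?thesis
          proof (cases rule: index_cases)
            case 2
            then have "Suc t \<in> {3..s}" "2 \<le> t" using i t by auto
            moreover have "A 2 \<union> A (Suc t) \<noteq> {1..n}" using i 2 by blast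
            ultimately have "A 1 \<union> A (Suc t) = {1..n}" using tree False by blast
            then show ?thesis using 2 \<open>2 \<le> t\<close> by blast
          next
            case 3
            then have "Suc t \<in> {3..s}" "i \<noteq> Suc t" using i t by auto
            then show ?thesis using leaves[OF 3] i by auto
          qed simp
        qed
        show ?thesis using *[OF that(1)] *[OF that(2)] that by auto
      qed
      then obtain i where "?T = {i}" using ne by blast
      then show ?thesis unfolding eq using each[of i] by simp
    qed
  qed
  have bm: "?b \<in> vars_prime n {1..n}"
  proof -
    have "var i \<in> vars_prime n {1..n}" if "i \<in> ?D \<union> ?E" for i
      using that by (intro var_mem_max) (auto simp: F_def)
    then show ?thesis
      unfolding mixed_form_def
      by (intro polys.is_idealD(3)[OF is_ideal_vars_prime] polys.is_ideal_sum[OF is_ideal_vars_prime]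
          polys.is_idealD(5)[OF is_ideal_vars_prime] polys.is_idealD(1)[OF is_ideal_vars_prime]) blast+
  qed
  show ?thesis
  proof (intro exI[of _ "?cs @ [?b]"] conjI)
    show "set (?cs @ [?b]) \<subseteq> vars_prime n {1..n}" using bm colour_sum_mem_max by auto
    show "polys.weakly_regular n I (?cs @ [?b])"
      using facet glue polys.is_idealD(1)[OF is_ideal_vars_prime bm] s
      by (intro weakly_regular_Inter_vars_prime) (auto intro: colour_sum_closed)
  qed simp
qed

text \<open>
  One colour: the sum of all variables, followed by the mixed form.
\<close>

lemma ex_regular_two:
  assumes conn: "\<And>j. j \<in> {3..s} \<Longrightarrow> A 1 \<union> A j \<noteq> {1..n} \<or> A 2 \<union> A j \<noteq> {1..n}"
  shows "\<exists>as :: 'k::field mpoly list. length as = Suc 1 \<and> set as \<subseteq> vars_prime n {1..n} \<and>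
    polys.weakly_regular n I as"
proof (rule ex_regular_colours[of 1 "\<lambda>_. 0"])
  show "\<exists>x\<in>{1..n} - A i - A j. (0::nat) = c"
    if "i \<in> {1..s}" "j \<in> {1..s}" "A i \<union> A j \<noteq> {1..n}" "c < 1" for i j c
    using that A[of i] A[of j] by auto
qed (use conn in auto)

text \<open>
  Distinct intersections of two facets are disjoint because no three facets meet, so the colourings
  that show all \<open>q\<close> colours on each of them can be chosen independently.
\<close>

lemma ex_regular_tree:
  assumes conn: "\<And>j. j \<in> {3..s} \<Longrightarrow> A 1 \<union> A j \<noteq> {1..n} \<or> A 2 \<union> A j \<noteq> {1..n}"
    and tree: "\<And>j. j \<in> {3..s} \<Longrightarrow> A 1 \<union> A j = {1..n} \<or> A 2 \<union> A j = {1..n}"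
    and q: "1 \<le> q" "\<And>i j. i \<in> {1..s} \<Longrightarrow> j \<in> {1..s} \<Longrightarrow> i \<noteq> j \<Longrightarrow> A i \<union> A j \<noteq> {1..n} \<Longrightarrow>
      q \<le> card ({1..n} - A i - A j)"
  shows "\<exists>as :: 'k::field mpoly list. length as = Suc q \<and> set as \<subseteq> vars_prime n {1..n} \<and>
    polys.weakly_regular n I as"
proof -
  let ?G = "{{1..n} - A i - A j |i j. i \<in> {1..s} \<and> j \<in> {1..s} \<and> i \<noteq> j \<and> A i \<union> A j \<noteq> {1..n}}"
  have "\<exists>\<kappa> :: nat \<Rightarrow> nat. (\<forall>i. \<kappa> i < q) \<and> (\<forall>M\<in>?G. \<forall>c<q. \<exists>i\<in>M. \<kappa> i = c)"
  proof (rule ex_surjective_colouring[OF q(1), of ?G])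
    fix M assume "M \<in> ?G"
    then show "finite M \<and> q \<le> card M" using q(2) by auto
  next
    fix M N assume "M \<in> ?G" "N \<in> ?G" and ne: "M \<noteq> N"
    then obtain i j i' j' where M: "M = {1..n} - A i - A j" "i \<in> {1..s}" "j \<in> {1..s}" "i \<noteq> j"
      and N: "N = {1..n} - A i' - A j'" "i' \<in> {1..s}" "j' \<in> {1..s}" "i' \<noteq> j'" by blast
    show "M \<inter> N = {}"
    proof (rule ccontr)
      assume "M \<inter> N \<noteq> {}"
      then obtain x where "x \<in> M" "x \<in> N" by blast
      then have x: "x \<in> F i" "x \<in> F j" "x \<in> F i'" "x \<in> F j'" using M N by (auto simp: F_def)
      have "i' \<in> {i, j}" using F_triple[of i j i' x] x M N by blast
      moreover have "j' \<in> {i, j}" using F_triple[of i j j' x] x M N by blast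
      ultimately have "M = N" using M N by blast
      then show False using ne by blast
    qed
  qed blast
  then obtain \<kappa> :: "nat \<Rightarrow> nat" where \<kappa>1: "\<forall>i. \<kappa> i < q" and \<kappa>2: "\<forall>M\<in>?G. \<forall>c<q. \<exists>i\<in>M. \<kappa> i = c"
    by (elim exE conjE)
  show ?thesis
  proof (rule ex_regular_colours[of q \<kappa>])
    fix i j c assume ij: "i \<in> {1..s}" "j \<in> {1..s}" "i \<noteq> j" "A i \<union> A j \<noteq> {1..n}" and c: "c < q"
    have "{1..n} - A i - A j \<in> ?G" using ij by blast
    then show "\<exists>x\<in>{1..n} - A i - A j. \<kappa> x = c" using \<kappa>2 c by blast
  qed (use q(1) \<kappa>1 conn tree in auto)
qed

lemma I_subset_max: "(I :: 'k::field mpoly set) \<subseteq> vars_prime n {1..n}"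
proof -
  have "(I :: 'k mpoly set) \<subseteq> vars_prime n (A 1)" using one_two by blast
  then show ?thesis using vars_prime_mono[OF A[OF one_two(1)]] by blast
qed

private abbreviation D :: "'k::field itself \<Rightarrow> enat" where
  "D TYPE('k) \<equiv> depth (mpoly_ring n) (vars_prime n {1..n}) (quot_module (mpoly_ring n) (I :: 'k mpoly set))"

private lemma depth_eqI:
  assumes "\<exists>as :: 'k::field mpoly list. length as = d \<and> set as \<subseteq> vars_prime n {1..n} \<and> polys.weakly_regular n I as"
    and "\<And>as :: 'k mpoly list. set as \<subseteq> vars_prime n {1..n} \<Longrightarrow> polys.weakly_regular n I as \<Longrightarrow> length as \<le> d"
  shows "D TYPE('k) = enat d"
proof -
  have "polys.is_ideal n (I :: 'k mpoly set)" using one_two by (intro is_ideal_Inter_vars_prime) auto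
  then have "D TYPE('k) = Sup {enat (length as) |as. set as \<subseteq> vars_prime n {1..n} \<and>
      polys.weakly_regular n (I :: 'k mpoly set) as}"
    by (rule depth_quot_module[OF _ I_subset_max])
  also have "\<dots> = enat d"
  proof (rule antisym)
    show "Sup {enat (length as) |as. set as \<subseteq> vars_prime n {1..n} \<and>
      polys.weakly_regular n (I :: 'k mpoly set) as} \<le> enat d"
      using assms(2) by (intro Sup_least) auto
    show "enat d \<le> Sup {enat (length as) |as. set as \<subseteq> vars_prime n {1..n} \<and>
      polys.weakly_regular n (I :: 'k mpoly set) as}"
      using assms(1) by (intro Sup_upper) blast
  qed
  finally show ?thesis .
qed

lemma depth_disconnected:
  assumes "\<exists>j\<in>{3..s}. A 1 \<union> A j = {1..n} \<and> A 2 \<union> A j = {1..n}"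
  shows "D TYPE('k::field) = enat 1"
proof (rule depth_eqI)
  obtain a where "a \<in> vars_prime n {1..n}" "polys.weakly_regular n (I :: 'k mpoly set) [a]"
    using ex_regular_one by blast
  then show "\<exists>as :: 'k mpoly list. length as = 1 \<and> set as \<subseteq> vars_prime n {1..n} \<and> polys.weakly_regular n I as"
    by (intro exI[of _ "[a]"]) simp
qed (use assms length_le_disconnected in blast)

lemma depth_cycle:
  assumes "\<And>j. j \<in> {3..s} \<Longrightarrow> A 1 \<union> A j \<noteq> {1..n} \<or> A 2 \<union> A j \<noteq> {1..n}"
    and "\<exists>j\<in>{3..s}. A 1 \<union> A j \<noteq> {1..n} \<and> A 2 \<union> A j \<noteq> {1..n}"
  shows "D TYPE('k::field) = enat 2"
proof (rule depth_eqI)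
  have "\<exists>as :: 'k mpoly list. length as = Suc 1 \<and> set as \<subseteq> vars_prime n {1..n} \<and> polys.weakly_regular n I as"
    by (rule ex_regular_two) (rule assms(1))
  then show "\<exists>as :: 'k mpoly list. length as = 2 \<and> set as \<subseteq> vars_prime n {1..n} \<and> polys.weakly_regular n I as"
    by (simp only: Suc_1)
qed (use assms(2) length_le_cycle in blast)

lemma depth_tree:
  assumes "\<And>j. j \<in> {3..s} \<Longrightarrow> A 1 \<union> A j \<noteq> {1..n} \<or> A 2 \<union> A j \<noteq> {1..n}"
    and "\<And>j. j \<in> {3..s} \<Longrightarrow> A 1 \<union> A j = {1..n} \<or> A 2 \<union> A j = {1..n}"
    and q: "\<And>i j. i \<in> {1..s} \<Longrightarrow> j \<in> {1..s} \<Longrightarrow> i \<noteq> j \<Longrightarrow> A i \<union> A j \<noteq> {1..n} \<Longrightarrow>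
      q \<le> card ({1..n} - A i - A j)"
    and q': "i \<in> {1..s}" "j \<in> {1..s}" "i \<noteq> j" "A i \<union> A j \<noteq> {1..n}" "q = card ({1..n} - A i - A j)"
  shows "D TYPE('k::field) = enat (Suc q)"
proof (rule depth_eqI)
  have "{1..n} - A i - A j \<noteq> {}" using A[OF q'(1)] A[OF q'(2)] q'(4) by blast
  then have "1 \<le> q" using q'(5) by (simp add: card_gt_0_iff Suc_le_eq)
  then show "\<exists>as :: 'k mpoly list. length as = Suc q \<and> set as \<subseteq> vars_prime n {1..n} \<and> polys.weakly_regular n I as"
    using assms(1-3) by (intro ex_regular_tree) auto
next
  fix as :: "'k mpoly list"
  assume "set as \<subseteq> vars_prime n {1..n}" "polys.weakly_regular n I as"
  then show "length as \<le> Suc q"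
    unfolding q'(5) by (intro length_le_tree assms(2) q'(1-4))
qed

end

text \<open>
  Irredundance says that the sets \<open>A\<^sub>i\<close> form an antichain, and big size two implies that any three of them
  contain all variables; \<open>q\<close> is the least cardinality of a nonempty intersection of two facets.
\<close>

theorem lemma3p2:
  fixes n s r :: nat
    and S :: "((nat \<Rightarrow>\<^sub>0 nat) \<Rightarrow>\<^sub>0 'k::field) ring"
    and \<mm> I :: "((nat \<Rightarrow>\<^sub>0 nat) \<Rightarrow>\<^sub>0 'k) set"
    and P :: "nat \<Rightarrow> ((nat \<Rightarrow>\<^sub>0 nat) \<Rightarrow>\<^sub>0 'k) set"
    and q :: enat
  defines "S \<equiv> mpoly_ring n"
    and "\<mm> \<equiv> var_ideal n {1..n}"
    and "I \<equiv> (\<Inter>i\<in>{1..s}. P i)"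
    and "q \<equiv> Min {krull_dim (S Quot (P i <+>\<^bsub>S\<^esub> P j)) |i j.
                    i \<in> {1..s} \<and> j \<in> {1..s} \<and> i \<noteq> j \<and> P i <+>\<^bsub>S\<^esub> P j \<noteq> \<mm>}"
  assumes "s \<ge> 3"
    and "\<forall>i\<in>{1..s}. monomial_prime n (P i)"
    and "\<forall>k\<in>{1..s}. (\<Inter>i\<in>{1..s} - {k}. P i) \<noteq> I"
    and "ideal_sum S P {1..s} = \<mm>"
    and "big_size S \<mm> P s = 2"
    and "r < n"
    and "P 1 <+>\<^bsub>S\<^esub> P 2 = var_ideal n {1..r}"
    and "\<forall>k\<in>{3..s}. \<forall>e\<in>{3..s}. k \<noteq> e \<longrightarrow> P k <+>\<^bsub>S\<^esub> P e = \<mm>"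
  shows "depth S \<mm> (quot_module S I) \<in> {1, 2, 1 + q}
    \<and> (depth S \<mm> (quot_module S I) = 1 \<longleftrightarrow>
         (\<exists>j\<in>{3..s}. P 1 <+>\<^bsub>S\<^esub> P j = \<mm> \<and> \<mm> = P 2 <+>\<^bsub>S\<^esub> P j))
    \<and> (depth S \<mm> (quot_module S I) > 2 \<longleftrightarrow>
         q > 1 \<and>
         (\<forall>j\<in>{3..s}. (P 1 <+>\<^bsub>S\<^esub> P j \<noteq> \<mm> \<and> \<mm> = P 2 <+>\<^bsub>S\<^esub> P j) \<or>
                     (P 2 <+>\<^bsub>S\<^esub> P j \<noteq> \<mm> \<and> \<mm> = P 1 <+>\<^bsub>S\<^esub> P j)))
    \<and> (depth S \<mm> (quot_module S I) = 2 \<longleftrightarrow>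
         (\<forall>j\<in>{3..s}. P 1 <+>\<^bsub>S\<^esub> P j \<noteq> \<mm> \<or> P 2 <+>\<^bsub>S\<^esub> P j \<noteq> \<mm>) \<and>
         (q = 1 \<or> (\<exists>k\<in>{3..s}. P 1 <+>\<^bsub>S\<^esub> P k \<noteq> \<mm> \<and> \<mm> \<noteq> P 2 <+>\<^bsub>S\<^esub> P k)))"
proof -
  have "\<exists>A. \<forall>i\<in>{1..s}. A i \<subseteq> {1..n} \<and> P i = var_ideal n (A i)"
    using assms(6) by (intro bchoice) (simp only: monomial_prime_def)
  then obtain A where A: "\<And>i. i \<in> {1..s} \<Longrightarrow> A i \<subseteq> {1..n}"
    and P': "\<And>i. i \<in> {1..s} \<Longrightarrow> P i = var_ideal n (A i)" by blast
  have P: "P i = vars_prime n (A i)" if "i \<in> {1..s}" for i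
    using P'[OF that] var_ideal_eq[OF A[OF that]] by simp
  have m: "\<mm> = vars_prime n {1..n}" unfolding assms(2) by (rule var_ideal_eq) simp
  have I: "I = (\<Inter>i\<in>{1..s}. vars_prime n (A i))" unfolding assms(3) using P by simp
  have one_two: "1 \<in> {1..s}" "2 \<in> {1..s}" using assms(5) by auto
  have sum: "P i <+>\<^bsub>S\<^esub> P j = vars_prime n (A i \<union> A j)" if "i \<in> {1..s}" "j \<in> {1..s}" for i j
    unfolding assms(1) using that by (simp only: P set_add_eq_ideal_plus ideal_plus_vars_prime)
  have max_iff: "P i <+>\<^bsub>S\<^esub> P j = \<mm> \<longleftrightarrow> A i \<union> A j = {1..n}" if "i \<in> {1..s}" "j \<in> {1..s}" for i j
    unfolding sum[OF that] m using A[OF that(1)] A[OF that(2)] by (intro vars_prime_eq_iff) auto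
  have antichain: "\<not> A i \<subseteq> A j" if "i \<in> {1..s}" "j \<in> {1..s}" "i \<noteq> j" for i j
  proof
    assume "A i \<subseteq> A j"
    then have "P i \<subseteq> P j" using that by (simp only: P vars_prime_mono)
    then have "(\<Inter>i\<in>{1..s} - {j}. P i) = I" unfolding assms(3) using that by blast
    then show False using assms(7) that by blast
  qed
  have triple: "A i \<union> A j \<union> A k = {1..n}"
    if ijk: "i \<in> {1..s}" "j \<in> {1..s}" "k \<in> {1..s}" and ne: "i \<noteq> j" "i \<noteq> k" "j \<noteq> k" for i j k
  proof -
    \<comment> \<open>Some \<open>t\<close> satisfies the condition that defines the big size, namely \<open>s - 1\<close>; so the least one does.\<close>
    let ?Q = "\<lambda>t. t < s \<and> (\<forall>T\<subseteq>{1..s}. card T = t + 1 \<longrightarrow> ideal_sum S P T = \<mm>)"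
    have "ideal_sum S P T = \<mm>" if "T \<subseteq> {1..s}" "card T = s - 1 + 1" for T
    proof -
      have "T = {1..s}" using that assms(5) by (intro card_subset_eq) auto
      then show ?thesis using assms(8) by simp
    qed
    then have "?Q (s - 1)" using assms(5) by simp
    then have least: "?Q (LEAST t. ?Q t)" by (rule LeastI)
    have eq: "(LEAST t. ?Q t) = 2" using assms(9) by (simp only: big_size_def)
    from least have "?Q 2" unfolding eq .
    moreover have "{i, j, k} \<subseteq> {1..s}" "card {i, j, k} = 2 + 1" using ijk ne by simp_all
    ultimately have "ideal_sum S P {i, j, k} = \<mm>" by blast
    moreover have "ideal_sum S P {i, j, k} = ideal_sum S (\<lambda>i. vars_prime n (A i)) {i, j, k}"
      using ijk by (simp add: ideal_sum_def P)
    moreover have "ideal_sum S (\<lambda>i. vars_prime n (A i)) {i, j, k} \<subseteq> vars_prime n (\<Union>i\<in>{i, j, k}. A i)"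
      unfolding assms(1) using ijk A by (intro ideal_sum_subset) auto
    ultimately have "(vars_prime n {1..n} :: 'k mpoly set) \<subseteq> vars_prime n (A i \<union> A j \<union> A k)"
      by (simp add: m Un_assoc)
    then have "{1..n} \<subseteq> A i \<union> A j \<union> A k" by (simp only: vars_prime_subset_iff[OF order_refl])
    then show ?thesis using A[OF ijk(1)] A[OF ijk(2)] A[OF ijk(3)] by blast
  qed
  have edge12: "A 1 \<union> A 2 \<noteq> {1..n}"
  proof
    assume "A 1 \<union> A 2 = {1..n}"
    then have "(vars_prime n {1..n} :: 'k mpoly set) = vars_prime n {1..r}"
      using assms(10,11) sum[OF one_two] var_ideal_eq[of "{1..r}" n, where 'k = 'k] by simp
    then have "{1..n} = {1..r}" using assms(10) by (subst (asm) vars_prime_eq_iff) auto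
    then show False using assms(10) by (metis card_atLeastAtMost diff_Suc_1 less_irrefl)
  qed
  have leaf: "j \<in> {1..s}" if "j \<in> {3..s}" for j using that by auto
  have leaves: "A j \<union> A k = {1..n}" if "j \<in> {3..s}" "k \<in> {3..s}" "j \<noteq> k" for j k
    using assms(12) that max_iff[OF leaf leaf] by blast
  let ?E = "{(i, j). i \<in> {1..s} \<and> j \<in> {1..s} \<and> i \<noteq> j \<and> A i \<union> A j \<noteq> {1..n}}"
  let ?q = "\<lambda>(i, j). enat (card ({1..n} - A i - A j))"
  have "{krull_dim (S Quot (P i <+>\<^bsub>S\<^esub> P j)) |i j.
      i \<in> {1..s} \<and> j \<in> {1..s} \<and> i \<noteq> j \<and> P i <+>\<^bsub>S\<^esub> P j \<noteq> \<mm>} = ?q ` ?E" (is "?K = _")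
  proof -
    have dim: "krull_dim (S Quot (P i <+>\<^bsub>S\<^esub> P j)) = ?q (i, j)" if "i \<in> {1..s}" "j \<in> {1..s}" for i j
    proof -
      have sub: "A i \<union> A j \<subseteq> {1..n}" using A[OF that(1)] A[OF that(2)] by blast
      have diff: "{1..n} - (A i \<union> A j) = {1..n} - A i - A j" by blast
      have "krull_dim (S Quot (P i <+>\<^bsub>S\<^esub> P j)) =
          krull_dim (mpoly_ring n Quot (vars_prime n (A i \<union> A j) :: 'k mpoly set))"
        unfolding sum[OF that] by (simp only: assms(1))
      also have "\<dots> = enat (card ({1..n} - (A i \<union> A j)))" by (rule krull_dim_vars_prime[OF sub])
      finally show ?thesis by (simp only: diff prod.case)
    qed
    show ?thesis
    proof (intro equalityI subsetI)
      fix x assume "x \<in> ?K"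
      then obtain i j where "x = krull_dim (S Quot (P i <+>\<^bsub>S\<^esub> P j))" "i \<in> {1..s}" "j \<in> {1..s}" "i \<noteq> j"
        "P i <+>\<^bsub>S\<^esub> P j \<noteq> \<mm>" by blast
      then show "x \<in> ?q ` ?E" using dim max_iff by (intro image_eqI[of _ _ "(i, j)"]) simp_all
    next
      fix x assume "x \<in> ?q ` ?E"
      then obtain i j where x: "x = ?q (i, j)"
        and ij: "i \<in> {1..s}" "j \<in> {1..s}" "i \<noteq> j" "A i \<union> A j \<noteq> {1..n}" by auto
      have "P i <+>\<^bsub>S\<^esub> P j \<noteq> \<mm>" using max_iff[OF ij(1,2)] ij(4) by simp
      then show "x \<in> ?K"
        unfolding x dim[OF ij(1,2), symmetric] using ij(1-3) by blast
    qed
  qed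
  then have q: "q = Min (?q ` ?E)" unfolding assms(4) by simp
  have "finite ?E" by (rule finite_subset[of _ "{1..s} \<times> {1..s}"]) auto
  moreover have "(1, 2) \<in> ?E" using one_two edge12 by simp
  ultimately have "q \<in> ?q ` ?E" and q_le: "\<And>e. e \<in> ?E \<Longrightarrow> q \<le> ?q e"
    unfolding q by (blast intro: Min_in, auto intro!: Min_le)
  then obtain i j where ij: "i \<in> {1..s}" "j \<in> {1..s}" "i \<noteq> j" "A i \<union> A j \<noteq> {1..n}"
    and q_eq: "q = enat (card ({1..n} - A i - A j))" by auto
  define d where "d = card ({1..n} - A i - A j)"
  have d_le: "d \<le> card ({1..n} - A i' - A j')"
    if "i' \<in> {1..s}" "j' \<in> {1..s}" "i' \<noteq> j'" "A i' \<union> A j' \<noteq> {1..n}" for i' j'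
    using q_le[of "(i', j')"] that by (simp add: q_eq d_def)
  have "{1..n} - A i - A j \<noteq> {}" using A[OF ij(1)] A[OF ij(2)] ij(4) by blast
  then have d1: "1 \<le> d" by (simp add: d_def card_gt_0_iff Suc_le_eq)
  have qd: "q = enat d" by (simp add: q_eq d_def)
  let ?D = "depth S \<mm> (quot_module S I)"
  let ?c1 = "\<lambda>j. A 1 \<union> A j = {1..n}" and ?c2 = "\<lambda>j. A 2 \<union> A j = {1..n}"
  note setting = A assms(5) antichain triple edge12 leaves
  have depth_1: "?D = enat 1" if "\<exists>j\<in>{3..s}. ?c1 j \<and> ?c2 j"
    unfolding I m assms(1) using that by (intro depth_disconnected setting)
  have depth_2: "?D = enat 2" if "\<forall>j\<in>{3..s}. \<not> (?c1 j \<and> ?c2 j)" "\<exists>j\<in>{3..s}. \<not> ?c1 j \<and> \<not> ?c2 j"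
    unfolding I m assms(1) using that by (intro depth_cycle setting) blast+
  have depth_d: "?D = enat (Suc d)" if "\<forall>j\<in>{3..s}. \<not> (?c1 j \<and> ?c2 j)" "\<forall>j\<in>{3..s}. ?c1 j \<or> ?c2 j"
    unfolding I m assms(1)
    by (intro depth_tree[where i = i and j = j] setting d_le ij d_def) (use that in \<open>blast+\<close>)
  have c1: "P 1 <+>\<^bsub>S\<^esub> P j = \<mm> \<longleftrightarrow> ?c1 j" "\<mm> = P 1 <+>\<^bsub>S\<^esub> P j \<longleftrightarrow> ?c1 j"
    and c2: "P 2 <+>\<^bsub>S\<^esub> P j = \<mm> \<longleftrightarrow> ?c2 j" "\<mm> = P 2 <+>\<^bsub>S\<^esub> P j \<longleftrightarrow> ?c2 j"
    if "j \<in> {3..s}" for j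
    using max_iff[OF one_two(1) leaf[OF that]] max_iff[OF one_two(2) leaf[OF that]] by auto
  have num: "(1 :: enat) = enat 1" "(2 :: enat) = enat 2" "1 + q = enat (Suc d)"
    by (simp_all add: one_enat_def numeral_eq_enat qd plus_enat_simps)
  let ?X = "\<exists>j\<in>{3..s}. ?c1 j \<and> ?c2 j"
  let ?Y = "\<forall>j\<in>{3..s}. \<not> ?c1 j \<and> ?c2 j \<or> \<not> ?c2 j \<and> ?c1 j"
  let ?Z = "\<forall>j\<in>{3..s}. \<not> ?c1 j \<or> \<not> ?c2 j"
  let ?W = "\<exists>j\<in>{3..s}. \<not> ?c1 j \<and> \<not> ?c2 j"
  have e: "(\<exists>j\<in>{3..s}. P 1 <+>\<^bsub>S\<^esub> P j = \<mm> \<and> \<mm> = P 2 <+>\<^bsub>S\<^esub> P j) \<longleftrightarrow> ?X"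
    "(\<forall>j\<in>{3..s}. (P 1 <+>\<^bsub>S\<^esub> P j \<noteq> \<mm> \<and> \<mm> = P 2 <+>\<^bsub>S\<^esub> P j) \<or>
       (P 2 <+>\<^bsub>S\<^esub> P j \<noteq> \<mm> \<and> \<mm> = P 1 <+>\<^bsub>S\<^esub> P j)) \<longleftrightarrow> ?Y"
    "(\<forall>j\<in>{3..s}. P 1 <+>\<^bsub>S\<^esub> P j \<noteq> \<mm> \<or> P 2 <+>\<^bsub>S\<^esub> P j \<noteq> \<mm>) \<longleftrightarrow> ?Z"
    "(\<exists>k\<in>{3..s}. P 1 <+>\<^bsub>S\<^esub> P k \<noteq> \<mm> \<and> \<mm> \<noteq> P 2 <+>\<^bsub>S\<^esub> P k) \<longleftrightarrow> ?W"
    by (intro bex_cong ball_cong refl; simp only: c1 c2)+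
  consider (disconnected) "\<exists>j\<in>{3..s}. ?c1 j \<and> ?c2 j"
    | (cyclic) "\<forall>j\<in>{3..s}. \<not> (?c1 j \<and> ?c2 j)" "\<exists>j\<in>{3..s}. \<not> ?c1 j \<and> \<not> ?c2 j"
    | (acyclic) "\<forall>j\<in>{3..s}. \<not> (?c1 j \<and> ?c2 j)" "\<forall>j\<in>{3..s}. ?c1 j \<or> ?c2 j" by blast
  then show ?thesis
    unfolding e
  proof cases
    case disconnected
    then have "\<not> ?Y" "\<not> ?Z" by blast+
    with disconnected depth_1 show "?D \<in> {1, 2, 1 + q} \<and> (?D = 1 \<longleftrightarrow> ?X) \<and> (?D > 2 \<longleftrightarrow> q > 1 \<and> ?Y) \<and>
        (?D = 2 \<longleftrightarrow> ?Z \<and> (q = 1 \<or> ?W))"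
      by (simp add: num qd)
  next
    case cyclic
    then have "\<not> ?X" "\<not> ?Y" "?Z" "?W" by blast+
    with depth_2[OF cyclic] show "?D \<in> {1, 2, 1 + q} \<and> (?D = 1 \<longleftrightarrow> ?X) \<and> (?D > 2 \<longleftrightarrow> q > 1 \<and> ?Y) \<and>
        (?D = 2 \<longleftrightarrow> ?Z \<and> (q = 1 \<or> ?W))"
      by (simp add: num qd)
  next
    case acyclic
    then have "\<not> ?X" "?Y" "?Z" "\<not> ?W" by blast+
    with depth_d[OF acyclic] d1 show "?D \<in> {1, 2, 1 + q} \<and> (?D = 1 \<longleftrightarrow> ?X) \<and> (?D > 2 \<longleftrightarrow> q > 1 \<and> ?Y) \<and>
        (?D = 2 \<longleftrightarrow> ?Z \<and> (q = 1 \<or> ?W))"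
      by (auto simp add: num qd)
  qed
qed

end
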